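(* Let $X$ and $Y$ be random vectors in $\mathbb{R}^d$ whose distributions $\mathsf{P}_X$ and $\mathsf{P}_Y$ have densities $p$ and $q$, respectively, with respect to Lebesgue measure. Suppose that for some $\varepsilon_i>0$, $R_i>0$ ($i=1,2,3,4$) and some $N_1,N_2\in\mathbb{N}$ the functionals $K_{p,q}(2,N_1)$, $Q_{p,q}(\varepsilon_1,R_1)$, $T_{p,q}(\varepsilon_2,R_2)$, $K_{p,p}(2,N_2)$, $Q_{p,p}(\varepsilon_3,R_3)$, $T_{p,p}(\varepsilon_4,R_4)$ are finite. Then, for any fixed $k,l\in\mathbb{N}$, the estimates $\widehat{D}_{n,m}(k,l)$ are $L^2$-consistent, i.e. $$\lim_{n,m\to\infty}\mathsf{E}\left(\widehat{D}_{n,m}(k,l)-D(\mathsf{P}_X\|\mathsf{P}_Y)\right)^2=0.$$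
   Context: Kullback-Leibler divergence: for probability measures with Lebesgue densities $p,q$ on $\mathbb{R}^d$, $D(\mathsf{P}_X\|\mathsf{P}_Y)=\int_{\mathbb{R}^d}p(x)\log\frac{p(x)}{q(x)}\,dx$ if $\mathsf{P}_X\ll\mathsf{P}_Y$, and $D(\mathsf{P}_X\|\mathsf{P}_Y)=+\infty$ otherwise (natural logarithm; $0/0:=0$, $0\cdot\log 0:=0$). Estimator: $X_1,X_2,\ldots$ are i.i.d. with the law of $X$, $Y_1,Y_2,\ldots$ are i.i.d. with the law of $Y$, and all the vectors $X_i,Y_i$, $i\in\mathbb{N}$, are independent. $\|\cdot\|$ is the Euclidean norm. $\mathbb{X}_n=\{X_1,\ldots,X_n\}$, $\mathbb{Y}_m=\{Y_1,\ldots,Y_m\}$ (almost surely all points are distinct). For a finite set $E$ and a point $v$, $z_{(k)}(v,E)$ denotes the $k$-th nearest neighbor of $v$ in $E$ (ties broken by increasing index). For $n\ge k+1$, $m\ge l$, $i=1,\ldots,n$ let $R_{n,k}(i)=\|X_i-X_{(k)}(X_i,\mathbb{X}_n\setminus\{X_i\})\|$ (distance from $X_i$ to its $k$-th nearest neighbor among the other $X_j$) and $V_{m,l}(i)=\|X_i-Y_{(l)}(X_i,\mathbb{Y}_m)\|$ (distance from $X_i$ to its $l$-th nearest neighbor in $\mathbb{Y}_m$). Put $$\widehat{D}_{n,m}(k,l)=\psi(k)-\psi(l)+\frac1n\sum_{i=1}^n\log\left(\frac{m\,V_{m,l}^d(i)}{(n-1)\,R_{n,k}^d(i)}\right),$$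 where $\psi(t)=\Gamma'(t)/\Gamma(t)$ is the digamma function. Functionals: let $e_{[0]}=1$, $e_{[N]}=\exp\{e_{[N-1]}\}$, $\log_{[1]}(t)=\log t$, $\log_{[N]}(t)=\log(\log_{[N-1]}(t))$ for $N>1$ and $t>e_{[N-2]}$. Let $G_N:\mathbb{R}_+\to\mathbb{R}_+$, $G_N(t)=0$ for $t\in[0,e_{[N-1]}]$ and $G_N(t)=t\log_{[N]}(t)$ for $t>e_{[N-1]}$. Let $B(x,r)=\{y:\|x-y\|\le r\}$ and let $V_d$ be the volume of the unit ball in $\mathbb{R}^d$. For a probability density $f$ on $\mathbb{R}^d$, $x\in\mathbb{R}^d$, $r,R>0$, set $I_f(x,r)=\frac{1}{r^dV_d}\int_{B(x,r)}f(y)\,dy$, $M_f(x,R)=\sup_{r\in(0,R]}I_f(x,r)$, $m_f(x,R)=\inf_{r\in(0,R]}I_f(x,r)$. For probability densities $p,q$ (possibly $q=p$), $\nu,\varepsilon,R>0$ and $N\in\mathbb{N}$ define, with values in $[0,\infty]$, $$K_{p,q}(\nu,N)=\iint_{\|x-y\|>e_{[N]}}G_N\big(|\log\|x-y\||^{\nu}\big)p(x)q(y)\,dx\,dy,$$ $$Q_{p,q}(\varepsilon,R)=\int_{\mathbb{R}^d}M_q(x,R)^{\varepsilon}p(x)\,dx,\qquad T_{p,q}(\varepsilon,R)=\int_{\mathbb{R}^d}m_q(x,R)^{-\varepsilon}p(x)\,dx,$$ where $1/0:=\infty$; the integrals defining $Q_{p,q}$ and $T_{p,q}$ may equivalently be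 taken over $\{x:p(x)>0\}$. *)

theory Defs
  imports "HOL-Probability.Probability"
begin

text \<open>
  The ambient space is an arbitrary Euclidean space \<open>'a\<close> of dimension \<open>d = DIM('a)\<close>.
  Densities are nonnegative real functions; every integral that may diverge is a
  nonnegative integral with values in \<open>[0, \<infinity>]\<close>.
\<close>

definition kl_div :: "('a::euclidean_space \<Rightarrow> real) \<Rightarrow> ('a \<Rightarrow> real) \<Rightarrow> ereal" where
  "kl_div p q =
     (if absolutely_continuous (density lborel (\<lambda>x. ennreal (q x))) (density lborel (\<lambda>x. ennreal (p x)))
      then enn2ereal (\<integral>\<^sup>+x. ennreal (p x * ln (p x / q x)) \<partial>lborel)
           - enn2ereal (\<integral>\<^sup>+x. ennreal (- (p x * ln (p x / q x))) \<partial>lborel)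
      else \<infinity>)"
  \<comment> \<open>Positive part minus negative part, since \<^const>\<open>ennreal\<close> truncates negative reals to \<open>0\<close>.
      For probability densities the negative part always has a finite integral, so
      \<open>\<infinity> - \<infinity>\<close> does not occur. \<^const>\<open>KL_divergence\<close> is not used because it is real-valued.\<close>

definition knn_index :: "(nat \<Rightarrow> 'a::euclidean_space) \<Rightarrow> 'a \<Rightarrow> nat set \<Rightarrow> nat \<Rightarrow> nat" where
  "knn_index z v J k = sort_key (\<lambda>j. norm (v - z j)) (sorted_list_of_set J) ! (k - 1)"
  \<comment> \<open>The index in \<open>J\<close> of the \<open>k\<close>-th nearest neighbour of \<open>v\<close> among the points \<open>z j\<close>, where
      \<open>1 \<le> k \<le> card J\<close>. Since \<^const>\<open>sort_key\<close> is stable, ties are broken by increasing index.\<close>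

text \<open>Samples are indexed from \<open>0\<close>: the first \<open>n\<close> points are \<open>x 0, \<dots>, x (n - 1)\<close>.\<close>

definition R_dist :: "(nat \<Rightarrow> 'a::euclidean_space) \<Rightarrow> nat \<Rightarrow> nat \<Rightarrow> nat \<Rightarrow> real" where
  "R_dist x n k i = norm (x i - x (knn_index x (x i) ({..<n} - {i}) k))"

definition V_dist :: "(nat \<Rightarrow> 'a::euclidean_space) \<Rightarrow> (nat \<Rightarrow> 'a) \<Rightarrow> nat \<Rightarrow> nat \<Rightarrow> nat \<Rightarrow> real" where
  "V_dist x y m l i = norm (x i - y (knn_index y (x i) {..<m} l))"

definition D_hat ::
  "(nat \<Rightarrow> 'a::euclidean_space) \<Rightarrow> (nat \<Rightarrow> 'a) \<Rightarrow> nat \<Rightarrow> nat \<Rightarrow> nat \<Rightarrow> nat \<Rightarrow> real" where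
  "D_hat x y n m k l =
     Digamma (real k) - Digamma (real l)
     + 1 / real n * (\<Sum>i<n. ln (real m * V_dist x y m l i ^ DIM('a)
                                / ((real n - 1) * R_dist x n k i ^ DIM('a))))"

definition e_iter :: "nat \<Rightarrow> real" where
  "e_iter N = (exp ^^ N) 1"

definition log_iter :: "nat \<Rightarrow> real \<Rightarrow> real" where
  "log_iter N t = (ln ^^ N) t"

definition G_fun :: "nat \<Rightarrow> real \<Rightarrow> real" where
  "G_fun N t = (if t \<le> e_iter (N - 1) then 0 else t * log_iter N t)"
  \<comment> \<open>Meant for \<open>N \<ge> 1\<close> and \<open>t \<ge> 0\<close>; for \<open>t > e_iter (N - 1)\<close> all the iterated logarithms
      have positive arguments.\<close>

definition I_avg :: "('a::euclidean_space \<Rightarrow> real) \<Rightarrow> 'a \<Rightarrow> real \<Rightarrow> ennreal" where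
  "I_avg f x r = (\<integral>\<^sup>+y\<in>cball x r. ennreal (f y) \<partial>lborel)
                   / ennreal (r ^ DIM('a) * measure lborel (cball (0::'a) 1))"

definition M_sup :: "('a::euclidean_space \<Rightarrow> real) \<Rightarrow> 'a \<Rightarrow> real \<Rightarrow> ennreal" where
  "M_sup f x R = (SUP r\<in>{0<..R}. I_avg f x r)"

definition m_inf :: "('a::euclidean_space \<Rightarrow> real) \<Rightarrow> 'a \<Rightarrow> real \<Rightarrow> ennreal" where
  "m_inf f x R = (INF r\<in>{0<..R}. I_avg f x r)"

definition ennreal_powr :: "ennreal \<Rightarrow> real \<Rightarrow> ennreal" where
  "ennreal_powr t a = (if t = \<infinity> then \<infinity> else ennreal (enn2real t powr a))"
  \<comment> \<open>Only meant for exponents \<open>a > 0\<close>; the negative power in \<open>T_fun\<close> below is an explicit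
      \<^const>\<open>inverse\<close>, for which \<open>inverse 0 = \<infinity>\<close> in \<^typ>\<open>ennreal\<close>.\<close>

definition K_fun :: "('a::euclidean_space \<Rightarrow> real) \<Rightarrow> ('a \<Rightarrow> real) \<Rightarrow> real \<Rightarrow> nat \<Rightarrow> ennreal" where
  "K_fun p q \<nu> N =
     (\<integral>\<^sup>+x. (\<integral>\<^sup>+y\<in>{y. norm (x - y) > e_iter N}.
        ennreal (G_fun N (\<bar>ln (norm (x - y))\<bar> powr \<nu>) * p x * q y) \<partial>lborel) \<partial>lborel)"

text \<open>In \<open>Q_fun\<close> and \<open>T_fun\<close> points with \<open>p x = 0\<close> contribute nothing, as \<open>\<infinity> * 0 = 0\<close>
  in \<^typ>\<open>ennreal\<close>.\<close>

definition Q_fun :: "('a::euclidean_space \<Rightarrow> real) \<Rightarrow> ('a \<Rightarrow> real) \<Rightarrow> real \<Rightarrow> real \<Rightarrow> ennreal" where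
  "Q_fun p q \<epsilon> R = (\<integral>\<^sup>+x. ennreal_powr (M_sup q x R) \<epsilon> * ennreal (p x) \<partial>lborel)"

definition T_fun :: "('a::euclidean_space \<Rightarrow> real) \<Rightarrow> ('a \<Rightarrow> real) \<Rightarrow> real \<Rightarrow> real \<Rightarrow> ennreal" where
  "T_fun p q \<epsilon> R = (\<integral>\<^sup>+x. inverse (ennreal_powr (m_inf q x R) \<epsilon>) * ennreal (p x) \<partial>lborel)"

end

theory Submission
  imports Defs
begin

text \<open>
  Write \<open>D_hat - D\<close> as the difference of the errors of two averages of \<open>Z\<^sub>i = ln (m V\<^sub>d \<rho>\<^sub>i\<^sup>d)\<close>, where
  \<open>\<rho>\<^sub>i\<close> is the distance from \<open>X\<^sub>i\<close> to its \<open>l\<close>-th neighbour in a sample of size \<open>m\<close> with density \<open>f\<close>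
  (\<open>f = q\<close>, and \<open>f = p\<close> with \<open>m = n - 1\<close>). The event \<open>Z\<^sub>i > u\<close> says that a ball around \<open>X\<^sub>i\<close> of volume
  \<open>e\<^sup>u / m\<close> contains fewer than \<open>l\<close> sample points. By Lebesgue differentiation and the Poisson limit its
  probability tends to \<open>h u = P (T / f X > e\<^sup>u)\<close> with \<open>T\<close> Erlang distributed, and for two distinct centres the
  balls are eventually disjoint, so the trinomial law of the two counts gives the limit \<open>(h u)\<^sup>2\<close>. Hence the
  fraction \<open>S u\<close> of indices with \<open>Z\<^sub>i > u\<close> tends to \<open>h u\<close> in mean square. The functionals \<open>Q\<close> and \<open>T\<close> bound
  \<open>E (S u - h u)\<^sup>2\<close> by a multiple of \<open>exp (- \<epsilon> \<bar>u\<bar>)\<close> as long as the radius stays below \<open>R\<close>, so a weighted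
  Cauchy-Schwarz inequality and dominated convergence in \<open>u\<close> control the integral of \<open>S - h\<close>, which is the error
  of the average truncated at radius \<open>R\<close>. The excess \<open>ln\<^sup>+ (\<rho>\<^sub>i / R)\<close> is controlled by \<open>K\<close>. Finally
  \<open>E ln T = \<psi> l\<close> identifies the limit.
\<close>

section \<open>Lebesgue differentiation for ball averages\<close>

text \<open>The sizes n and m tend to infinity with no relation between them, so the error is
  bounded by a function of n plus a function of m, each tending to 0. This is why the mean square of
  \<open>S u - h u\<close> is capped by min(B, 1/n) + min(B, gap), where B is the exponential bound:
  the diagonal pairs cost 1/n whatever the sample is, and the gap between the law of a pair and a
  product depends on the sample size alone. Logarithms are replaced by tail functions because, at a
  fixed threshold, a statement about a nearest neighbour distance is a statement about a count,
  whose law is explicit. The Cauchy-Schwarz step in u then avoids joint laws at two different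
  thresholds. For f = p the samples of two centres differ, and each centre belongs to the sample of
  the other. Dropping both leaves m - 1 common points that are independent of the two centres. A
  smaller sample has larger distances, so this yields an upper bound for the pair probability, which
  is the direction that a bound on the second moment of \<open>S u\<close> requires.\<close>

lemma disjoint_cballs:
  fixes x y :: "'a::metric_space"
  assumes "2 * r < dist x y"
  shows "cball x r \<inter> cball y r = {}"
proof (rule equals0I)
  fix z assume "z \<in> cball x r \<inter> cball y r"
  then have "dist x z \<le> r" "dist y z \<le> r" by auto
  then show False using dist_triangle[of x y z] assms by (simp add: dist_commute)
qed

section \<open>Ball probabilities and ball averages of a density\<close>

locale prob_density =
  fixes f :: "'a::euclidean_space \<Rightarrow> real"
  assumes dens_measurable[measurable]: "f \<in> borel_measurable borel"
    and dens_nonneg: "\<And>x. 0 \<le> f x"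
    and dens_total: "(\<integral>\<^sup>+x. ennreal (f x) \<partial>lborel) = 1"
begin

definition law :: "'a measure" where
  "law = density lborel (\<lambda>x. ennreal (f x))"

definition ball_prob :: "'a \<Rightarrow> real \<Rightarrow> real" where
  "ball_prob x r = measure law (cball x r)"

definition ball_avg :: "'a \<Rightarrow> real \<Rightarrow> real" where
  "ball_avg x r = ball_prob x r / (unit_ball_vol (real DIM('a)) * r ^ DIM('a))"

lemma sets_law[measurable_cong]: "sets law = sets borel"
  by (simp add: law_def)

lemma space_law[simp]: "space law = UNIV"
  by (simp add: law_def)

sublocale law: prob_space law
  by (rule prob_spaceI) (simp add: law_def emeasure_density dens_total)

lemma AE_law: "AE x in lborel. Q x \<Longrightarrow> AE x in law. Q x"
  unfolding law_def by (subst AE_density) auto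

lemma measurable_ball_prob[measurable]:
  assumes [measurable]: "g \<in> borel_measurable N" "r \<in> borel_measurable N"
  shows "(\<lambda>w. ball_prob (g w) (r w)) \<in> borel_measurable N"
proof -
  have *: "ball_prob x s = (\<integral>y. indicator {y. dist x y \<le> s} y \<partial>law)" for x s
    unfolding ball_prob_def by (simp add: cball_def)
  have "(\<lambda>w. \<integral>y. indicator {y. dist (g w) y \<le> r w} y \<partial>law :: real) \<in> borel_measurable N"
    unfolding indicator_def by measurable
  then show ?thesis unfolding * .
qed

lemma ball_prob_nonneg[simp]: "0 \<le> ball_prob x r"
  and ball_prob_le_1[simp]: "ball_prob x r \<le> 1"
  unfolding ball_prob_def by (auto)

lemma prob_law_UNIV[simp]: "measure law UNIV = 1"
  using law.prob_space by simp

lemma emeasure_law_UNIV[simp]: "emeasure law UNIV = 1"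
  using law.emeasure_space_1 by simp

lemma ball_prob_add_le_1:
  assumes "2 * r < dist x y"
  shows "ball_prob x r + ball_prob y r \<le> 1"
proof -
  have "cball x r \<inter> cball y r = {}" by (rule disjoint_cballs[OF assms])
  then have "ball_prob x r + ball_prob y r = measure law (cball x r \<union> cball y r)"
    unfolding ball_prob_def by (subst law.finite_measure_Union) (auto simp: sets_law)
  then show ?thesis by simp
qed

lemma ball_prob_mono: "r \<le> s \<Longrightarrow> ball_prob x r \<le> ball_prob x s"
  unfolding ball_prob_def by (intro law.finite_measure_mono subset_cball) (auto simp: sets_law)

lemma ball_avg_nonneg[simp]: "0 \<le> r \<Longrightarrow> 0 \<le> ball_avg x r"
  unfolding ball_avg_def by auto

lemma unit_ball_vol_DIM_pos[simp]: "0 < unit_ball_vol (real DIM('a))"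
  by simp

lemma unit_ball_vol_DIM_nz[simp]: "unit_ball_vol (real DIM('a)) \<noteq> 0"
  using unit_ball_vol_pos[of "real DIM('a)"] by linarith

lemma ball_prob_eq_avg: "0 < r \<Longrightarrow> ball_prob x r = ball_avg x r * measure lborel (cball x r)"
  by (simp add: ball_avg_def content_cball)

text \<open>Closed balls whose radii decrease to r intersect in the closed ball of radius r, so
  continuity from above applies. Monotonicity extends the limit from the radii
  \<open>r + 1 / Suc n\<close> to all radii.\<close>

lemma ball_prob_right_cont:
  "(ball_prob x \<longlongrightarrow> ball_prob x r) (at_right r)"
proof (rule decreasing_tendsto)
  show "\<forall>\<^sub>F s in at_right r. ball_prob x r \<le> ball_prob x s"
    by (auto simp: eventually_at_right_field intro!: exI[of _ "r+1"] ball_prob_mono)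
next
  fix c assume c: "ball_prob x r < c"
  define A where "A n = cball x (r + 1 / Suc n)" for n :: nat
  have "(\<lambda>n. measure law (A n)) \<longlonglongrightarrow> measure law (\<Inter>n. A n)"
    by (intro law.finite_Lim_measure_decseq)
       (auto simp: sets_law A_def decseq_def simp del: of_nat_Suc intro!: subset_cball frac_le)
  moreover have "(\<Inter>n. A n) = cball x r"
  proof (intro equalityI subsetI)
    fix y assume "y \<in> (\<Inter>n. A n)"
    then have "\<And>n. dist x y \<le> r + 1 / Suc n" by (auto simp: A_def)
    moreover have "(\<lambda>n. r + 1 / real (Suc n)) \<longlonglongrightarrow> r + 0"
      by (intro tendsto_intros LIMSEQ_Suc[OF lim_1_over_n])
    ultimately have "dist x y \<le> r" by (intro LIMSEQ_le_const[of _ r]) auto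
    then show "y \<in> cball x r" by simp
  qed (auto simp: A_def intro: order_trans)
  ultimately have "\<forall>\<^sub>F n in sequentially. measure law (A n) < c"
    using c by (intro order_tendstoD) (auto simp: ball_prob_def)
  then obtain n where n: "measure law (A n) < c" by (auto simp: eventually_sequentially)
  have "ball_prob x s < c" if "s < r + 1 / Suc n" for s
    using n ball_prob_mono[of s "r + 1 / Suc n" x] that by (simp add: A_def ball_prob_def)
  then show "\<forall>\<^sub>F s in at_right r. ball_prob x s < c"
    by (auto simp: eventually_at_right_field intro!: exI[of _ "r + 1 / Suc n"])
qed

lemma ball_avg_right_cont:
  assumes "0 < r" shows "(ball_avg x \<longlongrightarrow> ball_avg x r) (at_right r)"
  unfolding ball_avg_def[abs_def]
  by (intro tendsto_intros ball_prob_right_cont) (use assms in auto)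

lemma emeasure_law_ball: "0 < r \<Longrightarrow> emeasure law (cball x r) = ennreal (ball_avg x r) * emeasure lborel (cball x r)"
  unfolding law.emeasure_eq_measure ball_prob_def[symmetric] ball_prob_eq_avg
  by (simp add: ennreal_mult emeasure_eq_ennreal_measure emeasure_cball)

section \<open>Vitali coverings: from ball averages to masses of sets\<close>

lemma vitali_subfamily:
  fixes E U :: "'a set" and Pr :: "'a \<Rightarrow> real \<Rightarrow> bool"
  assumes E: "E \<in> sets borel" "E \<subseteq> U" "open U"
    and Pr: "\<And>x d. x \<in> E \<Longrightarrow> 0 < d \<Longrightarrow> \<exists>r>0. r < d \<and> Pr x r"
  obtains C :: "('a \<times> real) set" where "countable C" "disjoint_family_on (\<lambda>i. cball (fst i) (snd i)) C"
    "\<And>i. i \<in> C \<Longrightarrow> 0 < snd i \<and> Pr (fst i) (snd i) \<and> cball (fst i) (snd i) \<subseteq> U"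
    "E - (\<Union>i\<in>C. cball (fst i) (snd i)) \<in> null_sets lborel"
proof -
  \<comment> \<open>Keeping the balls inside U prevents a disjoint family from carrying more mass
    than U has. Nothing is lost, since U is open and admissible radii are arbitrarily small.\<close>
  define K where "K = {(x, r). 0 < r \<and> Pr x r \<and> cball x r \<subseteq> U}"
  have fine: "\<exists>i. i \<in> K \<and> x \<in> cball (fst i) (snd i) \<and> snd i < d" if x: "x \<in> E" and d: "0 < d" for x d
  proof -
    obtain e where e: "e > 0" "cball x e \<subseteq> U"
      using E x by (meson open_contains_cball subsetD)
    obtain r where "r > 0" "r < min d e" "Pr x r" using Pr[OF x, of "min d e"] d e by auto
    moreover have "cball x r \<subseteq> U" using e \<open>r < min d e\<close> subset_cball[of r e x] by auto
    ultimately show ?thesis by (intro exI[of _ "(x,r)"]) (auto simp: K_def)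
  qed
  have K0: "0 < snd i" if "i \<in> K" for i using that by (auto simp: K_def)
  obtain C where C: "countable C" "C \<subseteq> K"
     "pairwise (\<lambda>i j. disjnt (cball (fst i) (snd i)) (cball (fst j) (snd j))) C"
     "negligible(E - (\<Union>i \<in> C. cball (fst i) (snd i)))"
    by (rule Vitali_covering_theorem_cballs[OF K0 fine]) (assumption, assumption, assumption, rule that)
  show thesis
  proof
    show "disjoint_family_on (\<lambda>i. cball (fst i) (snd i)) C"
      using C(3) by (auto simp: pairwise_def disjnt_def disjoint_family_on_def)
    have m: "E - (\<Union>i \<in> C. cball (fst i) (snd i)) \<in> sets borel"
      using E C(1) by (intro sets.Diff sets.countable_UN') auto
    with C(4) show "E - (\<Union>i \<in> C. cball (fst i) (snd i)) \<in> null_sets lborel"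
      by (simp add: negligible_iff_null_sets null_sets_completion_iff)
  qed (use C in \<open>auto simp: K_def subset_iff split: prod.splits\<close>)
qed

text \<open>The disjoint Vitali balls fill E up to a Lebesgue null set, stay inside U, and each
  carries mass above b times its volume. Summing gives the bound with U on the right, and outer
  regularity of \<open>law\<close> shrinks U to E.\<close>

lemma law_ge_of_avg:
  assumes E[measurable]: "E \<in> sets borel" and b: "0 \<le> b"
    and Pr: "\<And>x d. x \<in> E \<Longrightarrow> 0 < d \<Longrightarrow> \<exists>r>0. r < d \<and> b < ball_avg x r"
  shows "ennreal b * emeasure lborel E \<le> emeasure law E"
proof -
  have "ennreal b * emeasure lborel E \<le> emeasure law U" if U: "E \<subseteq> U" "open U" for U
  proof -
    obtain C where C: "countable C" "disjoint_family_on (\<lambda>i. cball (fst i) (snd i)) C"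
      "\<And>i. i \<in> C \<Longrightarrow> 0 < snd i \<and> b < ball_avg (fst i) (snd i) \<and> cball (fst i) (snd i) \<subseteq> U"
      "E - (\<Union>i\<in>C. cball (fst i) (snd i)) \<in> null_sets lborel"
      using vitali_subfamily[OF E U, of "\<lambda>x r. b < ball_avg x r"] Pr by blast
    let ?B = "\<lambda>i. cball (fst i) (snd i :: real) :: 'a set"
    have UC: "(\<Union>i\<in>C. ?B i) \<in> sets borel" using C(1) by (intro sets.countable_UN') auto
    have "emeasure lborel E \<le> emeasure lborel (\<Union>i\<in>C. ?B i) + emeasure lborel (E - (\<Union>i\<in>C. ?B i))"
      using UC by (intro order_trans[OF _ emeasure_subadditive] emeasure_mono) auto
    also have "emeasure lborel (E - (\<Union>i\<in>C. ?B i)) = 0" using C(4) by auto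
    finally have "ennreal b * emeasure lborel E \<le> ennreal b * (\<integral>\<^sup>+i. emeasure lborel (?B i) \<partial>count_space C)"
      by (intro mult_left_mono) (simp_all add: emeasure_UN_countable C(1,2))
    also have "\<dots> = (\<integral>\<^sup>+i. ennreal b * emeasure lborel (?B i) \<partial>count_space C)"
      by (subst nn_integral_cmult) auto
    also have "\<dots> \<le> (\<integral>\<^sup>+i. emeasure law (?B i) \<partial>count_space C)"
      using C(3) by (intro nn_integral_mono) (fastforce simp: emeasure_law_ball intro!: mult_right_mono ennreal_leI)
    also have "\<dots> = emeasure law (\<Union>i\<in>C. ?B i)"
      by (intro emeasure_UN_countable[symmetric] C) (auto simp: sets_law)
    also have "\<dots> \<le> emeasure law U"
      using C(3) U by (intro emeasure_mono) (auto simp: sets_law)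
    finally show ?thesis .
  qed
  then have "ennreal b * emeasure lborel E \<le> (INF U\<in>{U. E \<subseteq> U \<and> open U}. emeasure law U)"
    by (intro INF_greatest) auto
  also have "\<dots> = emeasure law E"
    by (rule outer_regular[symmetric]) (auto simp: sets_law law.emeasure_eq_measure)
  finally show ?thesis .
qed

text \<open>Mirror image of the previous comparison, with two new points. The uncovered remainder
  must be null for \<open>law\<close>, which absolute continuity provides. U is now shrunk with
  respect to Lebesgue measure, for which E should have finite volume: infinite volume is trivial if
  a > 0, and for a = 0 the choice U = UNIV gives mass 0.\<close>

lemma law_le_of_avg:
  assumes E[measurable]: "E \<in> sets borel" and a: "0 \<le> a"
    and Pr: "\<And>x d. x \<in> E \<Longrightarrow> 0 < d \<Longrightarrow> \<exists>r>0. r < d \<and> ball_avg x r < a"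
  shows "emeasure law E \<le> ennreal a * emeasure lborel E"
proof (cases "emeasure lborel E = \<infinity> \<and> a > 0")
  case True
  then show ?thesis by (simp add: ennreal_mult_top)
next
  case fin: False
  have *: "emeasure law E \<le> ennreal a * emeasure lborel U" if U: "E \<subseteq> U" "open U" for U
  proof -
    obtain C where C: "countable C" "disjoint_family_on (\<lambda>i. cball (fst i) (snd i)) C"
      "\<And>i. i \<in> C \<Longrightarrow> 0 < snd i \<and> ball_avg (fst i) (snd i) < a \<and> cball (fst i) (snd i) \<subseteq> U"
      "E - (\<Union>i\<in>C. cball (fst i) (snd i)) \<in> null_sets lborel"
      using vitali_subfamily[OF E U, of "\<lambda>x r. ball_avg x r < a"] Pr by blast
    let ?B = "\<lambda>i. cball (fst i) (snd i :: real) :: 'a set"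
    have UC: "(\<Union>i\<in>C. ?B i) \<in> sets borel" using C(1) by (intro sets.countable_UN') auto
    have "AE x in law. x \<notin> E - (\<Union>i\<in>C. ?B i)"
      by (rule AE_law) (rule AE_not_in[OF C(4)])
    then have n0: "emeasure law (E - (\<Union>i\<in>C. ?B i)) = 0"
      using UC by (subst (asm) AE_iff_measurable[where N="E - (\<Union>i\<in>C. ?B i)"]) (auto simp: sets_law)
    have "emeasure law E \<le> emeasure law (\<Union>i\<in>C. ?B i) + emeasure law (E - (\<Union>i\<in>C. ?B i))"
      using UC by (intro order_trans[OF _ emeasure_subadditive] emeasure_mono) (auto simp: sets_law)
    also have "\<dots> = (\<integral>\<^sup>+i. emeasure law (?B i) \<partial>count_space C)"
      by (simp add: n0) (intro emeasure_UN_countable C, auto simp: sets_law)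
    also have "\<dots> \<le> (\<integral>\<^sup>+i. ennreal a * emeasure lborel (?B i) \<partial>count_space C)"
      using C(3) by (intro nn_integral_mono) (fastforce simp: emeasure_law_ball intro!: mult_right_mono ennreal_leI)
    also have "\<dots> = ennreal a * (\<integral>\<^sup>+i. emeasure lborel (?B i) \<partial>count_space C)"
      by (subst nn_integral_cmult) auto
    also have "\<dots> = ennreal a * emeasure lborel (\<Union>i\<in>C. ?B i)"
      by (subst emeasure_UN_countable) (use C in auto)
    also have "\<dots> \<le> ennreal a * emeasure lborel U"
      using C(3) U by (intro mult_left_mono emeasure_mono) auto
    finally show ?thesis .
  qed
  show ?thesis
  proof (cases "a = 0")
    case True
    then show ?thesis using *[of UNIV] by auto
  next
    case False
    then have a: "a > 0" using a by simp
    have finE: "emeasure lborel E < \<infinity>" using fin a by (auto simp: less_top)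
    show ?thesis
    proof (rule ennreal_le_epsilon)
      fix e :: real assume e: "e > 0"
      obtain U where U: "open U" "E \<subseteq> U" "emeasure lborel (U - E) < e / a"
        using outer_regular_lborel[of E "e/a"] a e by auto
      have "emeasure lborel U \<le> emeasure lborel E + emeasure lborel (U - E)"
        using U by (intro order_trans[OF _ emeasure_subadditive] emeasure_mono) auto
      also have "\<dots> \<le> emeasure lborel E + ennreal (e/a)"
        using U(3) by (intro add_left_mono) auto
      finally have "ennreal a * emeasure lborel U \<le> ennreal a * (emeasure lborel E + ennreal (e/a))"
        by (intro mult_left_mono) auto
      also have "\<dots> = ennreal a * emeasure lborel E + ennreal e"
        using a e by (simp add: distrib_left ennreal_mult[symmetric])
      finally show "emeasure law E \<le> ennreal a * emeasure lborel E + ennreal e"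
        using *[OF U(2,1)] by (rule order_trans[rotated])
    qed
  qed
qed

lemma measurable_ball_avg[measurable]:
  assumes [measurable]: "g \<in> borel_measurable N" "r \<in> borel_measurable N"
  shows "(\<lambda>w. ball_avg (g w) (r w)) \<in> borel_measurable N"
  unfolding ball_avg_def by measurable

lemma law_density_le:
  assumes E[measurable]: "E \<in> sets borel" and "\<And>x. x \<in> E \<Longrightarrow> f x \<le> a"
  shows "emeasure law E \<le> ennreal a * emeasure lborel E"
proof -
  have "emeasure law E = (\<integral>\<^sup>+x. ennreal (f x) * indicator E x \<partial>lborel)"
    unfolding law_def by (rule emeasure_density) auto
  also have "\<dots> \<le> (\<integral>\<^sup>+x. ennreal a * indicator E x \<partial>lborel)"
    using assms by (intro nn_integral_mono) (auto split: split_indicator intro!: ennreal_leI)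
  finally show ?thesis by (simp add: nn_integral_cmult)
qed

lemma law_density_ge:
  assumes E[measurable]: "E \<in> sets borel" and "\<And>x. x \<in> E \<Longrightarrow> b \<le> f x"
  shows "ennreal b * emeasure lborel E \<le> emeasure law E"
proof -
  have "ennreal b * emeasure lborel E = (\<integral>\<^sup>+x. ennreal b * indicator E x \<partial>lborel)"
    by (simp add: nn_integral_cmult)
  also have "\<dots> \<le> (\<integral>\<^sup>+x. ennreal (f x) * indicator E x \<partial>lborel)"
    using assms by (intro nn_integral_mono) (auto split: split_indicator intro!: ennreal_leI)
  also have "\<dots> = emeasure law E"
    unfolding law_def by (rule emeasure_density[symmetric]) auto
  finally show ?thesis .
qed

text \<open>The total mass 1 bounds \<open>ennreal b * emeasure lborel E\<close>, so E has finite
  volume; real arithmetic with a < b then leaves 0 as its only value.\<close>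

lemma null_of_squeeze:
  assumes "0 \<le> a" "a < b" "ennreal b * emeasure lborel E \<le> emeasure law E"
    "emeasure law E \<le> ennreal a * emeasure lborel E"
  shows "emeasure lborel E = 0"
proof -
  have "ennreal b * emeasure lborel E < \<infinity>"
    using order.strict_trans1[OF order_trans[OF assms(3) law.emeasure_le_1] ennreal_one_less_top] by simp
  then have fin: "emeasure lborel E < \<infinity>"
    using assms by (auto simp: ennreal_mult_less_top)
  then obtain t where t: "emeasure lborel E = ennreal t" "t \<ge> 0"
    by (cases "emeasure lborel E") auto
  have "b * t \<le> a * t" using order_trans[OF assms(3,4)] t assms by (simp add: ennreal_mult[symmetric])
  then have "t = 0" using assms t by (simp add: mult_le_cancel_right)
  then show ?thesis using t by simp
qed

text \<open>Only rational radii enter the exceptional sets, which keeps them Borel; right-continuity of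
  \<open>ball_prob\<close> recovers the remaining radii.\<close>

lemma AE_avg_upper:
  assumes "0 \<le> a" "a < b"
  shows "AE x in lborel. f x < a \<longrightarrow> (\<exists>n::nat. \<forall>r\<in>\<rat>. 0 < r \<and> r < 1 / Suc n \<longrightarrow> ball_avg x r \<le> b)"
proof -
  define E where "E = {x. f x < a \<and> (\<forall>n::nat. \<exists>r\<in>\<rat>. (0 < r \<and> r < 1 / Suc n) \<and> b < ball_avg x r)}"
  have E[measurable]: "E \<in> sets borel"
  proof -
    have "E = {x. f x < a} \<inter> (\<Inter>n::nat. \<Union>r\<in>\<rat> \<inter> {0<..<1 / Suc n}. {x. b < ball_avg x r})"
      by (auto simp: E_def Bex_def)
    also have "\<dots> \<in> sets borel"
      by (intro sets.Int sets.countable_INT' sets.countable_UN') (auto simp: countable_rat)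
    finally show ?thesis .
  qed
  have "emeasure lborel E = 0"
  proof (rule null_of_squeeze[OF assms])
    show "emeasure law E \<le> ennreal a * emeasure lborel E"
      by (rule law_density_le[OF E]) (auto simp: E_def)
    show "ennreal b * emeasure lborel E \<le> emeasure law E"
    proof (rule law_ge_of_avg)
      fix x d assume x: "x \<in> E" and d: "(0::real) < d"
      obtain n where n: "1 / Suc n < d" using reals_Archimedean[OF d] by (auto simp: inverse_eq_divide)
      obtain r where "0 < r" "r < 1 / Suc n" "b < ball_avg x r" using x unfolding E_def by blast
      then show "\<exists>r>0. r < d \<and> b < ball_avg x r" using n less_trans by blast
    qed (use assms E in auto)
  qed
  then have "E \<in> null_sets lborel" using E by auto
  from AE_not_in[OF this] show ?thesis
    by eventually_elim (auto simp: E_def not_less not_le simp del: of_nat_Suc, meson not_le)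
qed

lemma AE_avg_lower:
  assumes "0 \<le> a" "a < b"
  shows "AE x in lborel. b < f x \<longrightarrow> (\<exists>n::nat. \<forall>r\<in>\<rat>. 0 < r \<and> r < 1 / Suc n \<longrightarrow> a \<le> ball_avg x r)"
proof -
  define E where "E = {x. b < f x \<and> (\<forall>n::nat. \<exists>r\<in>\<rat>. (0 < r \<and> r < 1 / Suc n) \<and> ball_avg x r < a)}"
  have E[measurable]: "E \<in> sets borel"
  proof -
    have "E = {x. b < f x} \<inter> (\<Inter>n::nat. \<Union>r\<in>\<rat> \<inter> {0<..<1 / Suc n}. {x. ball_avg x r < a})"
      by (auto simp: E_def Bex_def)
    also have "\<dots> \<in> sets borel"
      by (intro sets.Int sets.countable_INT' sets.countable_UN') (auto simp: countable_rat)
    finally show ?thesis .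
  qed
  have "emeasure lborel E = 0"
  proof (rule null_of_squeeze[OF assms])
    show "ennreal b * emeasure lborel E \<le> emeasure law E"
      by (rule law_density_ge[OF E]) (auto simp: E_def)
    show "emeasure law E \<le> ennreal a * emeasure lborel E"
    proof (rule law_le_of_avg)
      fix x d assume x: "x \<in> E" and d: "(0::real) < d"
      obtain n where n: "1 / Suc n < d" using reals_Archimedean[OF d] by (auto simp: inverse_eq_divide)
      obtain r where "0 < r" "r < 1 / Suc n" "ball_avg x r < a" using x unfolding E_def by blast
      then show "\<exists>r>0. r < d \<and> ball_avg x r < a" using n less_trans by blast
    qed (use assms E in auto)
  qed
  then have "E \<in> null_sets lborel" using E by auto
  from AE_not_in[OF this] show ?thesis
    by eventually_elim (auto simp: E_def not_less not_le simp del: of_nat_Suc, meson not_le)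
qed

lemma right_rat_approx:
  assumes r: "0 < r" "r < (d::real)" and ev: "\<And>s. s \<in> \<rat> \<Longrightarrow> 0 < s \<Longrightarrow> s < d \<Longrightarrow> ball_avg x s \<in> S" and S: "closed S"
  shows "ball_avg x r \<in> S"
proof (rule ccontr)
  assume "ball_avg x r \<notin> S"
  then have "\<forall>\<^sub>F s in at_right r. ball_avg x s \<in> - S"
    using S by (intro topological_tendstoD[OF ball_avg_right_cont[OF r(1)]]) auto
  then obtain b where b: "b > r" "\<And>s. r < s \<Longrightarrow> s < b \<Longrightarrow> ball_avg x s \<notin> S"
    by (auto simp: eventually_at_right_field)
  obtain s where "s \<in> \<rat>" "r < s" "s < min b d"
    using Rats_dense_in_real[of r "min b d"] b r by auto
  then show False using b(2)[of s] ev[of s] r by auto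
qed

theorem lebesgue_differentiation:
  "AE x in lborel. (ball_avg x \<longlongrightarrow> f x) (at_right 0)"
proof -
  \<comment> \<open>Countably many levels give one exceptional null set. They come in pairs because
    the squeeze requires a strict gap between the level that bounds f and the level that bounds the
    averages.\<close>
  define D where "D = {(a, b) \<in> \<rat> \<times> \<rat>. 0 \<le> a \<and> a < (b::real)}"
  have "countable D" unfolding D_def
    by (rule countable_subset[of _ "\<rat> \<times> \<rat>"]) (auto simp: countable_rat)
  then have U: "AE x in lborel. \<forall>(a,b)\<in>D. f x < a \<longrightarrow> (\<exists>n::nat. \<forall>r\<in>\<rat>. 0 < r \<and> r < 1 / Suc n \<longrightarrow> ball_avg x r \<le> b)"
    and L: "AE x in lborel. \<forall>(a,b)\<in>D. b < f x \<longrightarrow> (\<exists>n::nat. \<forall>r\<in>\<rat>. 0 < r \<and> r < 1 / Suc n \<longrightarrow> a \<le> ball_avg x r)"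
    using AE_avg_upper AE_avg_lower
    by (subst AE_ball_countable; fastforce simp: D_def simp del: of_nat_Suc)+
  from U L show ?thesis
  proof eventually_elim
    case (elim x)
    show ?case
    proof (rule order_tendstoI)
      fix c assume c: "c < f x"
      show "\<forall>\<^sub>F r in at_right 0. c < ball_avg x r"
      \<comment> \<open>\<open>D\<close> contains no negative levels; below 0 the nonnegativity of
        the averages is enough.\<close>
      proof (cases "c < 0")
        case True
        then show ?thesis
          by (auto simp: eventually_at_right_field intro!: exI[of _ 1] less_le_trans[OF _ ball_avg_nonneg])
      next
        case False
        obtain a where a: "a \<in> \<rat>" "c < a" "a < f x" using Rats_dense_in_real[OF c] by auto
        obtain b where b: "b \<in> \<rat>" "a < b" "b < f x" using Rats_dense_in_real[OF a(3)] by auto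
        have "(a,b) \<in> D" using a b False by (auto simp: D_def)
        then obtain n where n: "\<forall>r\<in>\<rat>. 0 < r \<and> r < 1 / Suc n \<longrightarrow> a \<le> ball_avg x r"
          using elim(2) b by blast
        have "a \<le> ball_avg x r" if "0 < r" "r < 1 / Suc n" for r
          using right_rat_approx[OF that, of x "{a..}"] n by auto
        then show ?thesis using a
          by (auto simp: eventually_at_right_field simp del: of_nat_Suc intro!: exI[of _ "1 / Suc n"] intro: less_le_trans)
      qed
    next
      fix c assume c: "f x < c"
      obtain b where b: "b \<in> \<rat>" "f x < b" "b < c" using Rats_dense_in_real[OF c] by auto
      obtain a where a: "a \<in> \<rat>" "f x < a" "a < b" using Rats_dense_in_real[OF b(2)] by auto
      have "(a,b) \<in> D" using a b dens_nonneg[of x] by (auto simp: D_def)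
      then obtain n where n: "\<forall>r\<in>\<rat>. 0 < r \<and> r < 1 / Suc n \<longrightarrow> ball_avg x r \<le> b"
        using elim(1) a by blast
      have "ball_avg x r \<le> b" if "0 < r" "r < 1 / Suc n" for r
        using right_rat_approx[OF that, of x "{..b}"] n by auto
      then show "\<forall>\<^sub>F r in at_right 0. ball_avg x r < c" using b
        by (auto simp: eventually_at_right_field simp del: of_nat_Suc intro!: exI[of _ "1 / Suc n"] intro: le_less_trans)
    qed
  qed
qed

end

section \<open>Counts of independent points in two disjoint sets\<close>

text \<open>The multinomial point probability for m independent trials with cell probabilities s, t
  and 1 - s - t. Truncated subtraction is harmless: if a > m or b > m - a, a binomial coefficient
  vanishes.\<close>

definition trinom :: "nat \<Rightarrow> nat \<Rightarrow> nat \<Rightarrow> real \<Rightarrow> real \<Rightarrow> real" where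
  "trinom m a b s t = real (m choose a) * s ^ a * (real ((m - a) choose b) * t ^ b * (1 - s - t) ^ (m - a - b))"

definition trinom_cdf :: "nat \<Rightarrow> nat \<Rightarrow> nat \<Rightarrow> real \<Rightarrow> real \<Rightarrow> real" where
  "trinom_cdf m l1 l2 s t = (\<Sum>a<l1. \<Sum>b<l2. trinom m a b s t)"

definition binom_cdf :: "nat \<Rightarrow> nat \<Rightarrow> real \<Rightarrow> real" where
  "binom_cdf m l s = (\<Sum>a<l. real (m choose a) * s ^ a * (1 - s) ^ (m - a))"

text \<open>The probability that a Poisson variable with mean s lies strictly below l. Strictness,
  here and in the two functions above, matches the event that a ball contains fewer than l
  points.\<close>

definition poisson_cdf :: "nat \<Rightarrow> real \<Rightarrow> real" where
  "poisson_cdf l s = (\<Sum>a<l. s ^ a * exp (- s) / fact a)"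

lemma sum_subsets_by_card:
  fixes g :: "nat \<Rightarrow> real"
  assumes "finite J"
  shows "(\<Sum>A | A \<subseteq> J \<and> card A < l. g (card A)) = (\<Sum>a<l. real (card J choose a) * g a)"
proof -
  have "(\<Sum>A | A \<subseteq> J \<and> card A < l. g (card A)) = (\<Sum>a<l. \<Sum>A | A \<in> {A. A \<subseteq> J \<and> card A < l} \<and> card A = a. g (card A))"
    using assms by (intro sum.group[symmetric]) auto
  also have "\<dots> = (\<Sum>a<l. \<Sum>A | A \<subseteq> J \<and> card A = a. g a)"
    by (intro sum.cong) auto
  also have "\<dots> = (\<Sum>a<l. real (card J choose a) * g a)"
    using assms by (simp add: n_subsets)
  finally show ?thesis .
qed

text \<open>The event is split by the exact index sets A and B of the points that fall into
  \<open>A1\<close> and \<open>A2\<close>. Fixing both makes it a product event over the indices, so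
  independence gives a probability that depends on the cardinalities alone.\<close>

lemma (in prob_space) prob_two_counts:
  fixes W :: "'i \<Rightarrow> 'a \<Rightarrow> 'b::topological_space"
  assumes ind: "indep_vars (\<lambda>_. borel) W J" and J: "finite J" "J \<noteq> {}"
    and A[measurable]: "A1 \<in> sets borel" "A2 \<in> sets borel" and disj: "A1 \<inter> A2 = {}"
    and s: "\<And>j. j \<in> J \<Longrightarrow> prob {w \<in> space M. W j w \<in> A1} = s"
    and t: "\<And>j. j \<in> J \<Longrightarrow> prob {w \<in> space M. W j w \<in> A2} = t"
  shows "prob {w \<in> space M. card {j\<in>J. W j w \<in> A1} < l1 \<and> card {j\<in>J. W j w \<in> A2} < l2} = trinom_cdf (card J) l1 l2 s t"
proof -
  have W[measurable]: "j \<in> J \<Longrightarrow> W j \<in> borel_measurable M" for j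
    using ind by (auto simp: indep_vars_def)
  define cell where "cell A B j = (if j \<in> A then A1 else if j \<in> B then A2 else - (A1 \<union> A2))" for A B and j :: 'i
  define E where "E A B = {w \<in> space M. \<forall>j\<in>J. W j w \<in> cell A B j}" for A B
  define T where "T = (SIGMA A:{A. A \<subseteq> J \<and> card A < l1}. {B. B \<subseteq> J - A \<and> card B < l2})"
  have cell[measurable]: "cell A B j \<in> sets borel" for A B j unfolding cell_def by auto
  have E: "E A B \<in> events" for A B unfolding E_def using J by (intro sets.sets_Collect_finite_All) auto
  have u: "prob {w \<in> space M. W j w \<in> - (A1 \<union> A2)} = 1 - s - t" if j: "j \<in> J" for j
  proof -
    note [measurable] = W[OF j]
    have "prob {w \<in> space M. W j w \<in> A1 \<union> A2} = prob ({w \<in> space M. W j w \<in> A1} \<union> {w \<in> space M. W j w \<in> A2})"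
      by (rule arg_cong[where f=prob]) auto
    also have "\<dots> = s + t"
      using disj by (subst finite_measure_Union) (auto simp: s[OF j] t[OF j])
    finally have *: "prob {w \<in> space M. W j w \<in> A1 \<union> A2} = s + t" .
    have "prob {w \<in> space M. W j w \<in> - (A1 \<union> A2)} = prob (space M - {w \<in> space M. W j w \<in> A1 \<union> A2})"
      by (rule arg_cong[where f=prob]) auto
    also have "\<dots> = 1 - (s + t)" by (subst prob_compl) (auto simp only: *, measurable)
    finally show ?thesis by simp
  qed
  have PE: "prob (E A B) = s ^ card A * (t ^ card B * (1 - s - t) ^ (card J - card A - card B))"
    if AB: "A \<subseteq> J" "B \<subseteq> J - A" for A B
  proof -
    have fin: "finite A" "finite B" using AB J by (auto intro: finite_subset)
    have "E A B = (\<Inter>j\<in>J. W j -` cell A B j \<inter> space M)" using J by (auto simp: E_def)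
    then have "prob (E A B) = (\<Prod>j\<in>J. prob (W j -` cell A B j \<inter> space M))"
      using indep_varsD_finite[OF ind, of "cell A B"] J by auto
    also have "\<dots> = (\<Prod>j\<in>J. if j \<in> A then s else if j \<in> B then t else 1 - s - t)"
      using s t u by (intro prod.cong) (auto simp: cell_def vimage_def Int_def conj_commute)
    also have "\<dots> = (\<Prod>j\<in>A \<union> (B \<union> (J - A - B)). if j \<in> A then s else if j \<in> B then t else 1 - s - t)"
      using AB by (intro prod.cong) auto
    also have "\<dots> = (\<Prod>j\<in>A. if j \<in> A then s else if j \<in> B then t else 1 - s - t)
        * ((\<Prod>j\<in>B. if j \<in> A then s else if j \<in> B then t else 1 - s - t)
        * (\<Prod>j\<in>J - A - B. if j \<in> A then s else if j \<in> B then t else 1 - s - t))"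
    proof -
      have "A \<inter> (B \<union> (J - A - B)) = {}" "B \<inter> (J - A - B) = {}" using AB by auto
      then show ?thesis using fin J by (simp only: prod.union_disjoint finite_Un finite_Diff)
    qed
    also have "(\<Prod>j\<in>A. if j \<in> A then s else if j \<in> B then t else 1 - s - t) = s ^ card A"
      by simp
    also have "(\<Prod>j\<in>B. if j \<in> A then s else if j \<in> B then t else 1 - s - t) = (\<Prod>j\<in>B. t)"
      using AB by (intro prod.cong) auto
    also have "(\<Prod>j\<in>J - A - B. if j \<in> A then s else if j \<in> B then t else 1 - s - t) = (\<Prod>j\<in>J - A - B. 1 - s - t)"
      by (intro prod.cong) auto
    also have "\<dots> = (1 - s - t) ^ (card J - card A - card B)"
      using AB fin J by (simp add: card_Diff_subset)
    finally show ?thesis by simp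
  qed
  have eq: "{w \<in> space M. card {j\<in>J. W j w \<in> A1} < l1 \<and> card {j\<in>J. W j w \<in> A2} < l2} = (\<Union>(A,B)\<in>T. E A B)"
  proof (intro equalityI subsetI)
    fix w assume w: "w \<in> {w \<in> space M. card {j\<in>J. W j w \<in> A1} < l1 \<and> card {j\<in>J. W j w \<in> A2} < l2}"
    have "({j\<in>J. W j w \<in> A1}, {j\<in>J. W j w \<in> A2}) \<in> T"
      using w disj by (auto simp: T_def)
    moreover have "w \<in> E {j\<in>J. W j w \<in> A1} {j\<in>J. W j w \<in> A2}"
      using w by (auto simp: E_def cell_def)
    ultimately show "w \<in> (\<Union>(A,B)\<in>T. E A B)" by blast
  next
    fix w assume "w \<in> (\<Union>(A,B)\<in>T. E A B)"
    then obtain A B where AB: "(A,B) \<in> T" and w: "w \<in> E A B" by auto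
    have "{j\<in>J. W j w \<in> A1} = A" "{j\<in>J. W j w \<in> A2} = B"
      using AB w disj by (auto simp: T_def E_def cell_def split: if_splits)
    then show "w \<in> {w \<in> space M. card {j\<in>J. W j w \<in> A1} < l1 \<and> card {j\<in>J. W j w \<in> A2} < l2}"
      using AB w by (auto simp: T_def E_def)
  qed
  have disjT: "disjoint_family_on (\<lambda>(A,B). E A B) T"
    unfolding disjoint_family_on_def
  proof (clarsimp simp: disjoint_iff)
    fix A B A' B' w assume *: "(A, B) \<in> T" "(A', B') \<in> T" "A = A' \<longrightarrow> B \<noteq> B'" "w \<in> E A B" "w \<in> E A' B'"
    have "{j\<in>J. W j w \<in> A1} = A" "{j\<in>J. W j w \<in> A2} = B" "{j\<in>J. W j w \<in> A1} = A'" "{j\<in>J. W j w \<in> A2} = B'"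
      using * disj by (auto simp: T_def E_def cell_def split: if_splits)
    then show False using *(3) by auto
  qed
  have finT: "finite T" unfolding T_def using J by (intro finite_SigmaI) (auto intro: finite_subset)
  have "prob (\<Union>(A,B)\<in>T. E A B) = (\<Sum>(A,B)\<in>T. prob (E A B))"
    using finite_measure_finite_Union[OF finT _ disjT] E by (auto simp: split_beta image_subset_iff)
  also have "\<dots> = (\<Sum>(A,B)\<in>T. s ^ card A * (t ^ card B * (1 - s - t) ^ (card J - card A - card B)))"
    by (intro sum.cong) (auto simp: T_def PE)
  also have "\<dots> = (\<Sum>A | A \<subseteq> J \<and> card A < l1. \<Sum>B | B \<subseteq> J - A \<and> card B < l2.
      s ^ card A * (t ^ card B * (1 - s - t) ^ (card J - card A - card B)))"
    unfolding T_def using J by (intro sum.Sigma[symmetric]) auto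
  \<comment> \<open>The division compensates for the coefficient contained in \<open>trinom\<close>,
    which counting the sets A of a given size brings back.\<close>
  also have "\<dots> = (\<Sum>A | A \<subseteq> J \<and> card A < l1. \<Sum>b<l2. trinom (card J) (card A) b s t / real (card J choose card A))"
  proof (intro sum.cong refl)
    fix A assume A: "A \<in> {A. A \<subseteq> J \<and> card A < l1}"
    then have fA: "finite A" "card A \<le> card J" using J by (auto intro: finite_subset card_mono)
    show "(\<Sum>B | B \<subseteq> J - A \<and> card B < l2. s ^ card A * (t ^ card B * (1 - s - t) ^ (card J - card A - card B)))
      = (\<Sum>b<l2. trinom (card J) (card A) b s t / real (card J choose card A))"
      using A fA J by (subst sum_subsets_by_card[where g="\<lambda>b. s ^ card A * (t ^ b * (1 - s - t) ^ (card J - card A - b))"])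
        (auto simp: card_Diff_subset trinom_def mult_ac intro!: sum.cong)
  qed
  also have "\<dots> = trinom_cdf (card J) l1 l2 s t"
    using J by (subst sum_subsets_by_card[where g="\<lambda>a. \<Sum>b<l2. trinom (card J) a b s t / real (card J choose a)"])
       (auto simp: trinom_cdf_def sum_distrib_left trinom_def intro!: sum.cong)
  finally show ?thesis unfolding eq .
qed

lemma trinom_cdf_eq_binom_cdf: "trinom_cdf m l 1 s 0 = binom_cdf m l s"
  by (simp add: trinom_cdf_def binom_cdf_def trinom_def)

lemma (in prob_space) prob_count:
  fixes W :: "'i \<Rightarrow> 'a \<Rightarrow> 'b::topological_space"
  assumes ind: "indep_vars (\<lambda>_. borel) W J" and J: "finite J" "J \<noteq> {}"
    and A: "A \<in> sets borel" and s: "\<And>j. j \<in> J \<Longrightarrow> prob {w \<in> space M. W j w \<in> A} = s"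
  shows "prob {w \<in> space M. card {j\<in>J. W j w \<in> A} < l} = binom_cdf (card J) l s"
  using prob_two_counts[OF ind J A, of "{}" s 0 l 1] s by (simp add: trinom_cdf_eq_binom_cdf del: One_nat_def)

section \<open>Elementary bounds for binomial tails\<close>

lemma binom_cdf_nonneg: "0 \<le> s \<Longrightarrow> s \<le> 1 \<Longrightarrow> 0 \<le> binom_cdf m l s"
  by (auto simp: binom_cdf_def intro!: sum_nonneg)

lemma binom_term_le_1:
  assumes "0 \<le> s" "s \<le> (1::real)"
  shows "real (m choose a) * s ^ a * (1 - s) ^ (m - a) \<le> 1"
proof (cases "a \<le> m")
  case True
  have "real (m choose a) * s ^ a * (1 - s) ^ (m - a) \<le> (\<Sum>k\<le>m. real (m choose k) * s ^ k * (1 - s) ^ (m - k))"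
    using assms True by (intro member_le_sum[of a]) auto
  also have "\<dots> = 1" using binomial_ring[of s "1 - s" m] by simp
  finally show ?thesis .
qed (simp add: binomial_eq_0)

lemma binom_cdf_le_1:
  assumes "0 \<le> s" "s \<le> 1"
  shows "binom_cdf m l s \<le> 1"
proof -
  have "binom_cdf m l s = (\<Sum>a\<in>{..<l} \<inter> {..m}. real (m choose a) * s ^ a * (1 - s) ^ (m - a))"
    unfolding binom_cdf_def by (intro sum.mono_neutral_right) (auto simp: binomial_eq_0)
  also have "\<dots> \<le> (\<Sum>a\<le>m. real (m choose a) * s ^ a * (1 - s) ^ (m - a))"
    using assms by (intro sum_mono2) auto
  also have "\<dots> = 1" using binomial_ring[of s "1 - s" m] by simp
  finally show ?thesis .
qed

lemma trinom_cdf_nonneg: "0 \<le> s \<Longrightarrow> 0 \<le> t \<Longrightarrow> s + t \<le> 1 \<Longrightarrow> 0 \<le> trinom_cdf m l1 l2 s t"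
  by (auto simp: trinom_cdf_def trinom_def intro!: sum_nonneg mult_nonneg_nonneg)

lemma trinom_cdf_le_binom_cdf:
  assumes "0 \<le> s" "0 \<le> t" "s + t \<le> 1"
  shows "trinom_cdf m l1 l2 s t \<le> binom_cdf m l1 s"
  unfolding trinom_cdf_def binom_cdf_def
proof (rule sum_mono)
  fix a
  let ?g = "\<lambda>b. real ((m - a) choose b) * t ^ b * (1 - s - t) ^ (m - a - b)"
  have "(\<Sum>b<l2. ?g b) = (\<Sum>b\<in>{..<l2} \<inter> {..m - a}. ?g b)"
    by (intro sum.mono_neutral_right) (auto simp: binomial_eq_0)
  also have "\<dots> \<le> (\<Sum>b\<le>m - a. ?g b)"
    using assms by (intro sum_mono2) auto
  also have "\<dots> = (1 - s) ^ (m - a)" using binomial_ring[of t "1 - s - t" "m - a"] by simp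
  finally have "real (m choose a) * s ^ a * (\<Sum>b<l2. ?g b) \<le> real (m choose a) * s ^ a * (1 - s) ^ (m - a)"
    using assms by (intro mult_left_mono) auto
  then show "(\<Sum>b<l2. trinom m a b s t) \<le> real (m choose a) * s ^ a * (1 - s) ^ (m - a)"
    by (simp add: trinom_def sum_distrib_left)
qed

text \<open>The absorption identity (m+1) C(m,a) = (a+1) C(m+1,a+1) turns a term times (m+1) s into
  a + 1 times a point probability for m + 1 trials, which is at most 1. The slow decay 1 / (m s)
  suffices because it is later raised to a power \<epsilon> \<le> 1.\<close>

lemma binom_cdf_le_inverse:
  assumes "0 \<le> s" "s \<le> 1"
  shows "binom_cdf m l s * (real m * s) \<le> (real l)\<^sup>2"
proof -
  have "binom_cdf m l s * (real m * s) \<le> (\<Sum>a<l. real l)"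
    unfolding binom_cdf_def sum_distrib_right
  proof (rule sum_mono)
    fix a assume a: "a \<in> {..<l}"
    let ?b = "real (m choose a) * s ^ a * (1 - s) ^ (m - a)"
    have "?b * (real m * s) \<le> ?b * (real (Suc m) * s)"
      using assms by (intro mult_left_mono mult_right_mono) auto
    also have "\<dots> = (real (Suc m) * real (m choose a)) * s ^ Suc a * (1 - s) ^ (Suc m - Suc a)"
      by simp
    also have "real (Suc m) * real (m choose a) = real (Suc a) * real (Suc m choose Suc a)"
      by (metis Suc_times_binomial_eq mult.commute of_nat_mult)
    also have "real (Suc a) * real (Suc m choose Suc a) * s ^ Suc a * (1 - s) ^ (Suc m - Suc a)
       = real (Suc a) * (real (Suc m choose Suc a) * s ^ Suc a * (1 - s) ^ (Suc m - Suc a))"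
      by (simp only: mult.assoc)
    also have "\<dots> \<le> real (Suc a) * 1"
      by (rule mult_left_mono[OF binom_term_le_1[OF assms]]) simp
    also have "\<dots> \<le> real l" using a by auto
    finally show "?b * (real m * s) \<le> real l" .
  qed
  then show ?thesis by (simp add: power2_eq_square)
qed

text \<open>The term a = 0 is (1 - s)^m, which Bernoulli's inequality bounds from below; l \<ge> 1
  makes this term present.\<close>

lemma binom_cdf_ge:
  assumes "0 \<le> s" "s \<le> 1" "1 \<le> l"
  shows "1 - binom_cdf m l s \<le> real m * s"
proof -
  have "1 + real m * (- s) \<le> (1 + (- s)) ^ m"
    using assms by (intro Bernoulli_inequality) auto
  also have "\<dots> = real (m choose 0) * s ^ 0 * (1 - s) ^ (m - 0)" by simp
  also have "\<dots> \<le> binom_cdf m l s"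
    unfolding binom_cdf_def using assms by (intro member_le_sum) auto
  finally show ?thesis by simp
qed

lemma poisson_cdf_nonneg: "0 \<le> s \<Longrightarrow> 0 \<le> poisson_cdf l s"
  by (auto simp: poisson_cdf_def intro!: sum_nonneg)

lemma poisson_cdf_eq_erlang: "1 \<le> l \<Longrightarrow> 0 \<le> s \<Longrightarrow> poisson_cdf l s = 1 - erlang_CDF (l - 1) 1 s"
  by (cases l) (auto simp: poisson_cdf_def erlang_CDF_def lessThan_Suc_atMost)

lemma poisson_cdf_le_1: "1 \<le> l \<Longrightarrow> 0 \<le> s \<Longrightarrow> poisson_cdf l s \<le> 1"
  by (simp add: poisson_cdf_eq_erlang)

section \<open>Poisson limits\<close>

lemma tendsto_choose_power:
  fixes s :: "nat \<Rightarrow> real" and k :: "nat \<Rightarrow> nat"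
  assumes ks: "(\<lambda>m. real (k m) * s m) \<longlonglongrightarrow> L" and s0: "s \<longlonglongrightarrow> 0"
  shows "(\<lambda>m. real (k m choose a) * s m ^ a) \<longlonglongrightarrow> L ^ a / fact a"
proof -
  \<comment> \<open>Spreading the powers of s over the falling factorial makes each of the a factors
    converge to L.\<close>
  have "real (k m choose a) * s m ^ a = (\<Prod>i<a. real (k m) * s m - real i * s m) / fact a" for m
  proof -
    have "real (k m choose a) = (\<Prod>i<a. real (k m) - real i) / fact a"
      by (simp add: binomial_gbinomial gbinomial_prod_rev atLeast0LessThan)
    then show ?thesis
      by (simp add: left_diff_distrib[symmetric] prod.distrib prod_constant)
  qed
  moreover have "(\<lambda>m. (\<Prod>i<a. real (k m) * s m - real i * s m) / fact a) \<longlonglongrightarrow> (\<Prod>i<a. L - real i * 0) / fact a"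
    by (intro tendsto_intros ks s0) auto
  ultimately show ?thesis by simp
qed

text \<open>Squeezed between exp (- k y / (1 - y)) and exp (- k y). Both bounds come from 1 + x
  \<le> exp x, the lower one with x = y / (1 - y) and the upper one with x = - y.\<close>

lemma tendsto_one_minus_power:
  fixes y :: "nat \<Rightarrow> real" and k :: "nat \<Rightarrow> nat"
  assumes ky: "(\<lambda>m. real (k m) * y m) \<longlonglongrightarrow> L" and y0: "y \<longlonglongrightarrow> 0" and y: "\<And>m. 0 \<le> y m"
  shows "(\<lambda>m. (1 - y m) ^ k m) \<longlonglongrightarrow> exp (- L)"
proof (rule tendsto_sandwich)
  have y1: "\<forall>\<^sub>F m in sequentially. y m < 1" using y0 by (rule order_tendstoD) simp
  show "\<forall>\<^sub>F m in sequentially. (1 - y m) ^ k m \<le> exp (- (real (k m) * y m))"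
    using y1
  proof eventually_elim
    case (elim m)
    have "(1 - y m) ^ k m \<le> exp (- y m) ^ k m"
      using elim exp_ge_add_one_self[of "- y m"] by (intro power_mono) auto
    then show ?case by (simp add: exp_of_nat_mult[symmetric])
  qed
  show "\<forall>\<^sub>F m in sequentially. exp (- (real (k m) * y m / (1 - y m))) \<le> (1 - y m) ^ k m"
    using y1
  proof eventually_elim
    case (elim m)
    have "1 / (1 - y m) = 1 + y m / (1 - y m)" using elim by (simp add: field_simps)
    also have "\<dots> \<le> exp (y m / (1 - y m))" by (rule exp_ge_add_one_self)
    finally have "1 \<le> exp (y m / (1 - y m)) * (1 - y m)" using elim by (simp add: field_simps)
    then have "exp (- (y m / (1 - y m))) \<le> 1 - y m" by (simp add: exp_minus field_simps)
    then have "exp (- (y m / (1 - y m))) ^ k m \<le> (1 - y m) ^ k m" by (intro power_mono) auto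
    then show ?case by (simp add: exp_of_nat_mult[symmetric])
  qed
  show "(\<lambda>m. exp (- (real (k m) * y m))) \<longlonglongrightarrow> exp (- L)" by (intro tendsto_intros ky)
  have "(\<lambda>m. exp (- (real (k m) * y m / (1 - y m)))) \<longlonglongrightarrow> exp (- (L / (1 - 0)))"
    by (intro tendsto_intros ky y0) auto
  then show "(\<lambda>m. exp (- (real (k m) * y m / (1 - y m)))) \<longlonglongrightarrow> exp (- L)" by simp
qed

lemma tendsto_diff_mult:
  fixes s :: "nat \<Rightarrow> real" and k :: "nat \<Rightarrow> nat"
  assumes ks: "(\<lambda>m. real (k m) * s m) \<longlonglongrightarrow> L" and s0: "s \<longlonglongrightarrow> 0" and k: "filterlim k at_top sequentially"
  shows "(\<lambda>m. real (k m - a) * s m) \<longlonglongrightarrow> L"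
proof -
  have "(\<lambda>m. real (k m) * s m - real a * s m) \<longlonglongrightarrow> L - real a * 0" by (intro tendsto_intros ks s0)
  moreover have "\<forall>\<^sub>F m in sequentially. a \<le> k m" using k by (auto simp: filterlim_at_top)
  then have "\<forall>\<^sub>F m in sequentially. real (k m) * s m - real a * s m = real (k m - a) * s m"
    by eventually_elim (simp add: of_nat_diff left_diff_distrib)
  ultimately show ?thesis by (auto intro: Lim_transform_eventually)
qed

text \<open>The power of 1 - (s + t) tends to exp (- L1) exp (- L2), and removing a + b from its
  exponent does not change the limit; hence the factorisation. This asymptotic independence turns
  the pair probability into a square. The size is a sequence k because pairs are counted with m - 1
  points.\<close>

lemma trinom_cdf_poisson_limit:
  fixes s t :: "nat \<Rightarrow> real" and k :: "nat \<Rightarrow> nat"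
  assumes ks: "(\<lambda>m. real (k m) * s m) \<longlonglongrightarrow> L1" and kt: "(\<lambda>m. real (k m) * t m) \<longlonglongrightarrow> L2"
    and s0: "s \<longlonglongrightarrow> 0" and t0: "t \<longlonglongrightarrow> 0" and nn: "\<And>m. 0 \<le> s m" "\<And>m. 0 \<le> t m"
    and k: "filterlim k at_top sequentially"
  shows "(\<lambda>m. trinom_cdf (k m) l1 l2 (s m) (t m)) \<longlonglongrightarrow> poisson_cdf l1 L1 * poisson_cdf l2 L2"
proof -
  have "(\<lambda>m. trinom (k m) a b (s m) (t m)) \<longlonglongrightarrow> L1 ^ a / fact a * (L2 ^ b / fact b * exp (- (L1 + L2)))" for a b
  proof -
    have "(\<lambda>m. real (k m - (a + b)) * (s m + t m)) \<longlonglongrightarrow> L1 + L2"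
      using tendsto_add[OF tendsto_diff_mult[OF ks s0 k, of "a+b"] tendsto_diff_mult[OF kt t0 k, of "a+b"]]
      by (simp add: distrib_left)
    then have "(\<lambda>m. (1 - (s m + t m)) ^ (k m - (a + b))) \<longlonglongrightarrow> exp (- (L1 + L2))"
      using tendsto_add[OF s0 t0] nn by (intro tendsto_one_minus_power) auto
    then show ?thesis unfolding trinom_def
      by (intro tendsto_mult[of "\<lambda>m. real (k m choose a) * s m ^ a"] tendsto_mult[of "\<lambda>m. real (k m - a choose b) * t m ^ b"]
           tendsto_choose_power tendsto_diff_mult ks kt s0 t0 k)
        (simp add: diff_diff_eq)
  qed
  then have "(\<lambda>m. trinom_cdf (k m) l1 l2 (s m) (t m)) \<longlonglongrightarrow> (\<Sum>a<l1. \<Sum>b<l2. L1 ^ a / fact a * (L2 ^ b / fact b * exp (- (L1 + L2))))"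
    unfolding trinom_cdf_def by (intro tendsto_sum)
  also have "(\<Sum>a<l1. \<Sum>b<l2. L1 ^ a / fact a * (L2 ^ b / fact b * exp (- (L1 + L2)))) = poisson_cdf l1 L1 * poisson_cdf l2 L2"
    unfolding poisson_cdf_def sum_product minus_add_distrib exp_add by (simp add: mult_ac)
  finally show ?thesis .
qed

lemma binom_cdf_poisson_limit:
  fixes s :: "nat \<Rightarrow> real" and k :: "nat \<Rightarrow> nat"
  assumes ks: "(\<lambda>m. real (k m) * s m) \<longlonglongrightarrow> L" and s0: "s \<longlonglongrightarrow> 0" and nn: "\<And>m. 0 \<le> s m"
    and k: "filterlim k at_top sequentially"
  shows "(\<lambda>m. binom_cdf (k m) l (s m)) \<longlonglongrightarrow> poisson_cdf l L"
  using trinom_cdf_poisson_limit[OF ks _ s0 _ nn _ k, of "\<lambda>_. 0" 0 l 1]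
  by (simp add: trinom_cdf_eq_binom_cdf poisson_cdf_def[of 1] del: One_nat_def)

section \<open>Nearest neighbour distances as order statistics\<close>

lemma nth_le_iff_card:
  fixes f :: "'a \<Rightarrow> real"
  assumes s: "sorted (map f xs)" and d: "distinct xs" and i: "i < length xs"
  shows "f (xs ! i) \<le> r \<longleftrightarrow> i < card {x \<in> set xs. f x \<le> r}"
proof -
  let ?I = "{i. i < length xs \<and> f (xs ! i) \<le> r}"
  have "{x \<in> set xs. f x \<le> r} = (!) xs ` ?I" by (auto simp: in_set_conv_nth)
  moreover have "inj_on ((!) xs) ?I" using d by (auto simp: inj_on_def nth_eq_iff_index_eq)
  ultimately have c: "card {x \<in> set xs. f x \<le> r} = card ?I" by (simp add: card_image)
  have mono: "f (xs ! a) \<le> f (xs ! b)" if "a \<le> b" "b < length xs" for a b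
    using sorted_nth_mono[OF s, of a b] that by simp
  show ?thesis
  proof (cases "f (xs ! i) \<le> r")
    case True
    then have "{..i} \<subseteq> ?I" using mono i by (auto intro: order_trans)
    then have "card {..i} \<le> card ?I" by (intro card_mono) auto
    then show ?thesis using True c by simp
  next
    case False
    have "?I \<subseteq> {..<i}"
    proof
      fix a assume "a \<in> ?I"
      then show "a \<in> {..<i}" using mono[of i a] False by (cases "i \<le> a") auto
    qed
    then have "card ?I \<le> i" using card_mono[of "{..<i}" ?I] by simp
    then show ?thesis using False c by simp
  qed
qed

text \<open>The bridge from sorting to counting. In a sorted list the entry at position k - 1 is
  within r exactly when at least k entries are; which of several tied indices is selected does not
  affect the distance.\<close>

lemma knn_dist_le_iff:
  assumes "finite J" "1 \<le> k" "k \<le> card J"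
  shows "norm (v - z (knn_index z v J k)) \<le> r \<longleftrightarrow> k \<le> card {j\<in>J. norm (v - z j) \<le> r}"
proof -
  let ?f = "\<lambda>j. norm (v - z j)" and ?xs = "sort_key (\<lambda>j. norm (v - z j)) (sorted_list_of_set J)"
  have "?f (?xs ! (k - 1)) \<le> r \<longleftrightarrow> k - 1 < card {x \<in> set ?xs. ?f x \<le> r}"
    using assms by (intro nth_le_iff_card) auto
  then show ?thesis using assms by (auto simp: knn_index_def)
qed

section \<open>Tail integrals and the logarithmic moment of the Erlang distribution\<close>

text \<open>A layer-cake formula for numbers of either sign: the step at 0 removes the infinite
  contribution of negative u. It is applied pathwise to log distances and, through Fubini, to
  expectations.\<close>

lemma step_integral:
  fixes z :: real
  shows "integrable lborel (\<lambda>u. of_bool (u < z) - of_bool (u < 0) :: real)" (is ?A)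
    and "(\<integral>u. (of_bool (u < z) - of_bool (u < 0)) \<partial>lborel) = z" (is ?B)
    and "(\<integral>u. \<bar>of_bool (u < z) - of_bool (u < 0)\<bar> \<partial>lborel) = \<bar>z\<bar>" (is ?C)
proof -
  have *: "?A \<and> ?B \<and> ?C"
  proof (cases "z \<ge> 0")
    case True
    have "(\<lambda>u. of_bool (u < z) - of_bool (u < 0) :: real) = indicator {0..<z}"
      using True by (auto simp: indicator_def)
    then show ?thesis using True by simp
  next
    case False
    have "(\<lambda>u. of_bool (u < z) - of_bool (u < 0) :: real) = (\<lambda>u. - indicator {z..<0} u)"
      using False by (auto simp: indicator_def)
    moreover have "(\<lambda>u. \<bar>of_bool (u < z) - of_bool (u < 0)\<bar> :: real) = indicator {z..<0}"
      using False by (auto simp: indicator_def)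
    ultimately show ?thesis using False by (simp add: fun_eq_iff)
  qed
  show ?A ?B ?C using * by auto
qed

lemma (in prob_space) tail_integral:
  fixes Z :: "'a \<Rightarrow> real"
  assumes Z: "integrable M Z"
  shows "integrable lborel (\<lambda>u. prob {w \<in> space M. u < Z w} - of_bool (u < 0))" (is ?A)
    and "(\<integral>u. (prob {w \<in> space M. u < Z w} - of_bool (u < 0)) \<partial>lborel) = expectation Z" (is ?B)
proof -
  interpret P: pair_sigma_finite M "lborel :: real measure" ..
  have [measurable]: "Z \<in> borel_measurable M" using Z by auto
  have int: "integrable (M \<Otimes>\<^sub>M lborel) (\<lambda>(w, u). of_bool (u < Z w) - of_bool (u < 0) :: real)"
  proof (rule P.Fubini_integrable)
    show "(\<lambda>(w, u). of_bool (u < Z w) - of_bool (u < 0) :: real) \<in> borel_measurable (M \<Otimes>\<^sub>M lborel)"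
      by measurable
  qed (use Z in \<open>simp_all add: step_integral\<close>)
  have inner: "(\<integral>w. (of_bool (u < Z w) - of_bool (u < 0)) \<partial>M) = prob {w \<in> space M. u < Z w} - of_bool (u < 0)" for u
  proof -
    have "(\<integral>w. (of_bool (u < Z w) - of_bool (u < 0)) \<partial>M) = (\<integral>w. (indicator {w \<in> space M. u < Z w} w - of_bool (u < 0)) \<partial>M)"
      by (intro Bochner_Integration.integral_cong) auto
    also have "\<dots> = prob {w \<in> space M. u < Z w} - of_bool (u < 0)"
      by (subst Bochner_Integration.integral_diff) (auto simp: prob_space emeasure_eq_measure intro!: integrable_real_indicator arg_cong[where f=prob])
    finally show ?thesis .
  qed
  show ?A using P.integrable_snd[OF int] by (simp add: inner)
  show ?B using P.integral_snd[OF int] P.integral_fst[OF int] by (simp add: inner step_integral)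
qed

text \<open>\<open>erlang_density\<close> counts its shape from 0, so \<open>l - 1\<close> gives the
  Gamma distribution with shape l and rate 1. It is the waiting time for the l-th point of a unit
  Poisson process, whence the link to \<open>poisson_cdf\<close>.\<close>

definition erlang_law :: "nat \<Rightarrow> real measure" where
  "erlang_law l = density lborel (\<lambda>t. ennreal (erlang_density (l - 1) 1 t))"

lemma prob_space_erlang_law: "prob_space (erlang_law l)"
  unfolding erlang_law_def by (rule prob_space_erlang_density) simp

lemma sets_erlang_law[measurable_cong]: "sets (erlang_law l) = sets borel"
  and space_erlang_law[simp]: "space (erlang_law l) = UNIV"
  by (auto simp: erlang_law_def)

lemma AE_erlang_pos: "AE t in erlang_law l. 0 < t"
proof -
  have "AE t in lborel. t \<noteq> (0::real)" by (rule AE_lborel_singleton)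
  then show ?thesis unfolding erlang_law_def
    by (subst AE_density) (auto elim!: eventually_mono simp: erlang_density_def)
qed

lemma nn_integral_erlang_powr:
  assumes l: "1 \<le> l" and s: "- real l < s"
  shows "(\<integral>\<^sup>+t. ennreal (t powr s) \<partial>erlang_law l) = ennreal (Gamma (real l + s) / Gamma (real l))"
proof -
  have "(\<integral>\<^sup>+t. ennreal (t powr s) \<partial>erlang_law l) = (\<integral>\<^sup>+t. ennreal (erlang_density (l - 1) 1 t) * ennreal (t powr s) \<partial>lborel)"
    unfolding erlang_law_def by (subst nn_integral_density) auto
  also have "\<dots> = (\<integral>\<^sup>+t. ennreal (1 / Gamma (real l)) * ennreal (indicator {0..} t * t powr (real l + s - 1) / exp t) \<partial>lborel)"
  proof (rule nn_integral_cong_AE)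
    show "AE t in lborel. ennreal (erlang_density (l - 1) 1 t) * ennreal (t powr s)
      = ennreal (1 / Gamma (real l)) * ennreal (indicator {0..} t * t powr (real l + s - 1) / exp t)"
      using AE_lborel_singleton[of 0]
    proof eventually_elim
      case (elim t)
      have G: "Gamma (real l) = fact (l - 1)" using Gamma_fact[of "l - 1", where 'a=real] l by simp
      show ?case
      proof (cases "t > 0")
        case True
        have "t powr (real l + s - 1) = t powr (real (l - 1) + s)" using l by (simp add: of_nat_diff algebra_simps)
        also have "\<dots> = t ^ (l - 1) * t powr s" using True by (simp add: powr_add powr_realpow)
        finally show ?thesis using True l
          by (simp add: ennreal_mult[symmetric] erlang_density_def G exp_minus field_simps)
      qed (use elim in \<open>auto simp: erlang_density_def\<close>)
    qed
  qed
  also have "\<dots> = ennreal (1 / Gamma (real l)) * ennreal (Gamma (real l + s))"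
    using s by (subst nn_integral_cmult) (auto simp: Gamma_conv_nn_integral_real)
  also have "\<dots> = ennreal (Gamma (real l + s) / Gamma (real l))"
    using l s Gamma_real_pos[of "real l + s"] by (subst ennreal_mult[symmetric]) (auto simp: less_imp_le)
  finally show ?thesis .
qed

lemma integral_erlang_powr:
  assumes l: "1 \<le> l" and s: "- real l < s"
  shows "integrable (erlang_law l) (\<lambda>t. t powr s)"
    and "(\<integral>t. t powr s \<partial>erlang_law l) = Gamma (real l + s) / Gamma (real l)"
proof -
  have g: "Gamma (real l + s) / Gamma (real l) \<ge> 0"
    using Gamma_real_pos[of "real l + s"] Gamma_real_pos[of "real l"] l s by simp
  show "integrable (erlang_law l) (\<lambda>t. t powr s)"
    using nn_integral_erlang_powr[OF assms] by (intro integrableI_nonneg) auto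
  show "(\<integral>t. t powr s \<partial>erlang_law l) = Gamma (real l + s) / Gamma (real l)"
    using nn_integral_erlang_powr[OF assms] g by (subst integral_eq_nn_integral) auto
qed

lemma ln_le_powr:
  fixes t s :: real
  assumes "0 < t" "s \<noteq> 0"
  shows "s * ln t \<le> t powr s - 1"
  using ln_le_minus_one[of "t powr s"] assms by (simp add: ln_powr)

lemma abs_ln_le_powr:
  fixes t s :: real
  assumes "0 < t" "0 < s"
  shows "\<bar>ln t\<bar> \<le> (t powr s + t powr (- s)) / s"
proof -
  have "s * ln t \<le> t powr s - 1" "- s * ln t \<le> t powr (- s) - 1"
    using ln_le_powr[of t s] ln_le_powr[of t "- s"] assms by auto
  then have "s * ln t \<le> t powr s + t powr (- s)" "s * (- ln t) \<le> t powr s + t powr (- s)"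
    using powr_ge_zero[of t s] powr_ge_zero[of t "-s"] by linarith+
  then have "ln t \<le> (t powr s + t powr (- s)) / s" "- ln t \<le> (t powr s + t powr (- s)) / s"
    using assms by (simp_all add: pos_le_divide_eq mult.commute)
  then show ?thesis by (rule abs_leI)
qed

text \<open>The moments \<open>E t\<^sup>s = \<Gamma>(l+s)/\<Gamma>(l)\<close> sandwich \<open>E (ln t)\<close> between difference quotients of \<open>\<Gamma>\<close> at \<open>l\<close>,
  since \<open>s ln t \<le> t\<^sup>s - 1\<close> for either sign of \<open>s\<close>.\<close>

lemma expectation_ln_erlang:
  assumes l: "1 \<le> l"
  shows "integrable (erlang_law l) ln" and "(\<integral>t. ln t \<partial>erlang_law l) = Digamma (real l)"
proof -
  have "integrable (erlang_law l) (\<lambda>t. (t powr (1/2) + t powr (- (1/2))) / (1/2))"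
    using l by (intro Bochner_Integration.integrable_divide Bochner_Integration.integrable_add integral_erlang_powr) auto
  then show int: "integrable (erlang_law l) ln"
    by (rule Bochner_Integration.integrable_bound)
       (use AE_erlang_pos[of l] in \<open>auto elim!: eventually_mono intro: order_trans[OF abs_ln_le_powr[where s="1/2"]]\<close>)
  have le: "s * (\<integral>t. ln t \<partial>erlang_law l) \<le> Gamma (real l + s) / Gamma (real l) - 1"
    if s: "s \<noteq> 0" "- real l < s" for s
  proof -
    interpret prob_space "erlang_law l" by (rule prob_space_erlang_law)
    have "(\<integral>t. s * ln t \<partial>erlang_law l) \<le> (\<integral>t. t powr s - 1 \<partial>erlang_law l)"
      using AE_erlang_pos[of l] s ln_le_powr integral_erlang_powr[OF l s(2)] int
      by (intro integral_mono_AE) (auto elim!: eventually_mono)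
    then show ?thesis using integral_erlang_powr[OF l s(2)] prob_space by simp
  qed
  let ?D = "\<lambda>s. (Gamma (real l + s) - Gamma (real l)) / s"
  have G: "Gamma (real l) > 0" using l by (intro Gamma_real_pos) auto
  have "(Gamma has_field_derivative Gamma (real l) * Digamma (real l)) (at (real l))"
    using l by (intro has_field_derivative_Gamma) (auto elim!: nonpos_Ints_cases)
  then have "(?D \<longlongrightarrow> Gamma (real l) * Digamma (real l)) (at 0)"
    by (simp add: has_field_derivative_def DERIV_def[symmetric]  DERIV_def)
  then have lim: "((\<lambda>s. ?D s / Gamma (real l)) \<longlongrightarrow> Digamma (real l)) (at 0)"
    using tendsto_divide[OF _ tendsto_const, of ?D "Gamma (real l) * Digamma (real l)" "at 0" "Gamma (real l)"] G by simp
  have eq: "?D s / Gamma (real l) = (Gamma (real l + s) / Gamma (real l) - 1) / s" for s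
    using G by (simp add: field_simps)
  show "(\<integral>t. ln t \<partial>erlang_law l) = Digamma (real l)"
  proof (rule antisym)
    have "((\<lambda>s. ?D s / Gamma (real l)) \<longlongrightarrow> Digamma (real l)) (at_right 0)"
      using lim by (simp add: filterlim_at_split)
    moreover have "\<forall>\<^sub>F s in at_right 0. (\<integral>t. ln t \<partial>erlang_law l) \<le> ?D s / Gamma (real l)"
      unfolding eq eventually_at_right_field using le l
      by (intro exI[of _ 1]) (auto simp: pos_le_divide_eq mult.commute)
    ultimately show "(\<integral>t. ln t \<partial>erlang_law l) \<le> Digamma (real l)"
      by (intro tendsto_lowerbound) auto
    have "((\<lambda>s. ?D s / Gamma (real l)) \<longlongrightarrow> Digamma (real l)) (at_left 0)"
      using lim by (simp add: filterlim_at_split)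
    moreover have "\<forall>\<^sub>F s in at_left 0. ?D s / Gamma (real l) \<le> (\<integral>t. ln t \<partial>erlang_law l)"
      unfolding eq eventually_at_left_field using le l
      by (intro exI[of _ "-1"]) (auto simp: neg_divide_le_eq mult.commute)
    ultimately show "Digamma (real l) \<le> (\<integral>t. ln t \<partial>erlang_law l)"
      by (intro tendsto_upperbound) auto
  qed
qed

section \<open>Limits and bounds for the tail functions\<close>

text \<open>Interpolates between the trivial bound 1 and a bound linear in the ball average, so that
  a moment of order e \<le> 1 of that average controls the integral.\<close>

lemma min_one_le_powr:
  fixes z e :: real
  assumes "0 \<le> z" "0 < e" "e \<le> 1"
  shows "min 1 z \<le> z powr e"
proof (cases "z \<le> 1")
  case True
  then show ?thesis using assms powr_mono'[of e 1 z] by simp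
next
  case False
  then show ?thesis using ge_one_powr_ge_zero[of z e] assms by simp
qed

lemma measurable_binom_cdf[measurable]:
  assumes [measurable]: "s \<in> borel_measurable M"
  shows "(\<lambda>x. binom_cdf m l (s x)) \<in> borel_measurable M"
  unfolding binom_cdf_def by measurable

lemma measurable_trinom_cdf[measurable]:
  assumes [measurable]: "s \<in> borel_measurable M" "t \<in> borel_measurable M"
  shows "(\<lambda>x. trinom_cdf m l1 l2 (s x) (t x)) \<in> borel_measurable M"
  unfolding trinom_cdf_def trinom_def by measurable

lemma measurable_poisson_cdf[measurable]:
  assumes [measurable]: "s \<in> borel_measurable M"
  shows "(\<lambda>x. poisson_cdf l (s x)) \<in> borel_measurable M"
  unfolding poisson_cdf_def by measurable

lemma nn_integral_exp_abs_finite: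
  fixes d :: real
  assumes d: "0 < d"
  shows "(\<integral>\<^sup>+u. ennreal (exp (- d * \<bar>u\<bar>)) \<partial>lborel) < \<infinity>"
proof -
  have half: "(\<integral>\<^sup>+u. ennreal (exp (- d * u)) * indicator {0..} u \<partial>lborel) = ennreal (1 / d)"
  proof -
    have "(\<integral>\<^sup>+u. ennreal (exp (- d * u)) * indicator {0..} u \<partial>lborel) = ennreal (0 - (- exp (- d * 0) / d))"
    proof (rule nn_integral_FTC_atLeast)
      show "((\<lambda>u. - exp (- d * u) / d) has_real_derivative exp (- d * u)) (at u)" for u
        using d by (auto intro!: derivative_eq_intros)
      have "((\<lambda>u. exp (- d * u)) \<longlongrightarrow> 0) at_top"
        using d by (intro filterlim_compose[OF exp_at_bot]) (simp add: filterlim_uminus_at_bot filterlim_tendsto_pos_mult_at_top[OF tendsto_const] filterlim_ident)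
      then show "((\<lambda>u. - exp (- d * u) / d) \<longlongrightarrow> 0) at_top"
        using tendsto_divide[OF tendsto_minus, of "\<lambda>u. exp (- d * u)" 0 at_top "\<lambda>_. d" d] d by simp
    qed auto
    then show ?thesis by simp
  qed
  have "(\<integral>\<^sup>+u. ennreal (exp (- d * \<bar>u\<bar>)) \<partial>lborel)
    \<le> (\<integral>\<^sup>+u. ennreal (exp (- d * u)) * indicator {0..} u + ennreal (exp (- d * (- u))) * indicator {0..} (- u) \<partial>lborel)"
    by (intro nn_integral_mono) (auto simp: indicator_def abs_if)
  also have "\<dots> = (\<integral>\<^sup>+u. ennreal (exp (- d * u)) * indicator {0..} u \<partial>lborel)
     + (\<integral>\<^sup>+u. ennreal (exp (- d * (- u))) * indicator {0..} (- u) \<partial>lborel)"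
    by (rule nn_integral_add) auto
  also have "(\<integral>\<^sup>+u. ennreal (exp (- d * (- u))) * indicator {0..} (- u) \<partial>lborel)
     = (\<integral>\<^sup>+u. ennreal (exp (- d * u)) * indicator {0..} u \<partial>lborel)"
    using nn_integral_real_affine[of "\<lambda>u. ennreal (exp (- d * u)) * indicator {0..} u" "-1" 0] by simp
  finally show ?thesis unfolding half by (auto simp: order.strict_trans1 ennreal_add_eq_top)
qed

text \<open>The moment conditions concern one radius at a time, so their integrands are Borel
  functions; \<open>M_sup\<close> and \<open>m_inf\<close> enter when the conditions are verified.
  The restriction \<epsilon> \<le> 1 is the one of \<open>min_one_le_powr\<close>.\<close>

locale knn_moments = P: prob_density p + Q: prob_density f for p f :: "'a::euclidean_space \<Rightarrow> real" +
  fixes \<epsilon> R CQ CT :: real and l :: nat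
  assumes eps: "0 < \<epsilon>" "\<epsilon> \<le> 1" and R_pos: "0 < R" and C_nonneg: "0 \<le> CQ" "0 \<le> CT" and l_ge: "1 \<le> l"
    and upper_moment: "\<And>r. 0 < r \<Longrightarrow> r \<le> R \<Longrightarrow> (\<integral>\<^sup>+x. ennreal (Q.ball_avg x r powr \<epsilon>) \<partial>P.law) \<le> ennreal CQ"
    and lower_moment: "\<And>r. 0 < r \<Longrightarrow> r \<le> R \<Longrightarrow> (\<integral>\<^sup>+x. inverse (ennreal (Q.ball_avg x r powr \<epsilon>)) \<partial>P.law) \<le> ennreal CT"
    and log_moment: "(\<integral>\<^sup>+x. \<integral>\<^sup>+y. ennreal ((max 0 (ln (dist x y / R)))\<^sup>2) \<partial>Q.law \<partial>P.law) < \<infinity>"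
begin

definition rad :: "nat \<Rightarrow> real \<Rightarrow> real" where
  "rad m u = (exp u / (real m * unit_ball_vol (real DIM('a)))) powr (1 / real DIM('a))"

definition emp_tail :: "nat \<Rightarrow> real \<Rightarrow> real" where
  "emp_tail m u = (\<integral>x. binom_cdf m l (Q.ball_prob x (rad m u)) \<partial>P.law)"

text \<open>An upper bound, not the exact probability, for two distances exceeding the radius: it
  counts among the m - 1 points common to both samples, and it takes the value 1 where the balls may
  meet and the trinomial law does not apply.\<close>

definition pair_tail :: "nat \<Rightarrow> real \<Rightarrow> real" where
  "pair_tail m u = (\<integral>x. (\<integral>y. (if dist x y \<le> 2 * rad m u then 1
     else trinom_cdf (m - 1) l l (Q.ball_prob x (rad m u)) (Q.ball_prob y (rad m u))) \<partial>P.law) \<partial>P.law)"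

definition lim_tail :: "real \<Rightarrow> real" where
  "lim_tail u = (\<integral>x. poisson_cdf l (exp u * f x) \<partial>P.law)"

text \<open>Here y is one sample point, and the binomial factor is the probability that the other m
  - 1 points put fewer than l into the ball of radius R around x.\<close>

definition log_tail :: "nat \<Rightarrow> ennreal" where
  "log_tail m = (\<integral>\<^sup>+x. \<integral>\<^sup>+y. ennreal ((max 0 (ln (dist x y / R)))\<^sup>2) * ennreal (binom_cdf (m - 1) l (Q.ball_prob x R)) \<partial>Q.law \<partial>P.law)"

section \<open>Calibrated radii and limits of the tail functions\<close>

lemma rad_pow: "0 < m \<Longrightarrow> real m * (unit_ball_vol (real DIM('a)) * rad m u ^ DIM('a)) = exp u"
  unfolding rad_def by (subst powr_realpow[symmetric]) (auto simp: powr_powr field_simps)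

lemma rad_pos: "0 < m \<Longrightarrow> 0 < rad m u"
  unfolding rad_def by (auto simp: field_simps)

lemma rad_less_iff:
  assumes "0 < m" "0 < r"
  shows "rad m u < r \<longleftrightarrow> u < ln (real m * (unit_ball_vol (real DIM('a)) * r ^ DIM('a)))"
proof -
  have "rad m u < r \<longleftrightarrow> rad m u ^ DIM('a) < r ^ DIM('a)"
    using assms rad_pos[of m u]
    by (intro iffI power_strict_mono) (auto intro: power_less_imp_less_base[of "rad m u" "DIM('a)" r])
  also have "\<dots> \<longleftrightarrow> real m * (unit_ball_vol (real DIM('a)) * rad m u ^ DIM('a)) < real m * (unit_ball_vol (real DIM('a)) * r ^ DIM('a))"
    using assms by (simp add: mult_less_cancel_left_pos)
  also have "\<dots> \<longleftrightarrow> exp u < real m * (unit_ball_vol (real DIM('a)) * r ^ DIM('a))"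
    using assms by (simp only: rad_pow)
  also have "\<dots> \<longleftrightarrow> u < ln (real m * (unit_ball_vol (real DIM('a)) * r ^ DIM('a)))"
    using assms by (subst exp_less_cancel_iff[symmetric]) simp
  finally show ?thesis .
qed

lemma measurable_rad[measurable]: "g \<in> borel_measurable M \<Longrightarrow> (\<lambda>w. rad m (g w)) \<in> borel_measurable M"
  unfolding rad_def by measurable

lemma rad_tendsto_0: "(\<lambda>m. rad m u) \<longlonglongrightarrow> 0"
proof -
  have "(\<lambda>m. exp u / unit_ball_vol (real DIM('a)) * (1 / real m)) \<longlonglongrightarrow> exp u / unit_ball_vol (real DIM('a)) * 0"
    by (intro tendsto_intros lim_1_over_n)
  then have "(\<lambda>m. exp u / (real m * unit_ball_vol (real DIM('a)))) \<longlonglongrightarrow> 0" by (simp add: field_simps)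
  then show ?thesis unfolding rad_def
    using tendsto_powr'[of "\<lambda>m. exp u / (real m * unit_ball_vol (real DIM('a)))" 0 sequentially "\<lambda>_. 1 / real DIM('a)" "1 / real DIM('a)"]
    by (auto simp: less_imp_le)
qed

lemma eventually_rad_less: "0 < r \<Longrightarrow> \<forall>\<^sub>F m in sequentially. rad m u < r"
  using order_tendstoD(2)[OF rad_tendsto_0] by auto

lemma rad_tendsto_at_right: "filterlim (\<lambda>m. rad m u) (at_right 0) sequentially"
  unfolding filterlim_at using rad_tendsto_0
  by (auto intro!: eventually_mono[OF eventually_gt_at_top[of 0]] simp: rad_pos less_imp_neq[OF rad_pos, symmetric])

lemma mass_eq: "0 < m \<Longrightarrow> real m * Q.ball_prob x (rad m u) = exp u * Q.ball_avg x (rad m u)"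
  by (subst rad_pow[symmetric, of m u]) (auto simp: Q.ball_avg_def less_imp_neq[OF rad_pos, symmetric])

text \<open>The quantifier over u stands inside the almost-everywhere statement because the
  exceptional set, the complement of the Lebesgue points, is the same for all u. The version with m
  - 1 serves \<open>pair_tail\<close>.\<close>

lemma AE_mass_limit:
  "AE x in lborel. \<forall>u. (\<lambda>m. real m * Q.ball_prob x (rad m u)) \<longlonglongrightarrow> exp u * f x \<and> (\<lambda>m. Q.ball_prob x (rad m u)) \<longlonglongrightarrow> 0
     \<and> (\<lambda>m. real (m - 1) * Q.ball_prob x (rad m u)) \<longlonglongrightarrow> exp u * f x"
  using Q.lebesgue_differentiation
proof eventually_elim
  case (elim x)
  show ?case
  proof (intro allI)
    fix u
    have "(\<lambda>m. exp u * Q.ball_avg x (rad m u)) \<longlonglongrightarrow> exp u * f x"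
      by (intro tendsto_intros filterlim_compose[OF elim rad_tendsto_at_right])
    then have 1: "(\<lambda>m. real m * Q.ball_prob x (rad m u)) \<longlonglongrightarrow> exp u * f x"
      by (rule Lim_transform_eventually) (auto intro!: eventually_mono[OF eventually_gt_at_top[of 0]] simp: mass_eq)
    have "(\<lambda>m. (1 / real m) * (real m * Q.ball_prob x (rad m u))) \<longlonglongrightarrow> 0 * (exp u * f x)"
      by (intro tendsto_intros lim_1_over_n 1)
    then have "(\<lambda>m. (1 / real m) * (real m * Q.ball_prob x (rad m u))) \<longlonglongrightarrow> 0" by simp
    then have 2: "(\<lambda>m. Q.ball_prob x (rad m u)) \<longlonglongrightarrow> 0"
      by (rule Lim_transform_eventually) (rule eventually_mono[OF eventually_gt_at_top[of 0]], simp)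
    show "(\<lambda>m. real m * Q.ball_prob x (rad m u)) \<longlonglongrightarrow> exp u * f x \<and> (\<lambda>m. Q.ball_prob x (rad m u)) \<longlonglongrightarrow> 0
     \<and> (\<lambda>m. real (m - 1) * Q.ball_prob x (rad m u)) \<longlonglongrightarrow> exp u * f x"
      using 1 2 tendsto_diff_mult[OF 1 2 filterlim_ident] by auto
  qed
qed

lemma binom_cdf_ball_bounds: "0 \<le> binom_cdf m l (Q.ball_prob x r)" "binom_cdf m l (Q.ball_prob x r) \<le> 1"
  by (auto intro: binom_cdf_nonneg binom_cdf_le_1)

lemma emp_tail_bounds: "0 \<le> emp_tail m u" "emp_tail m u \<le> 1"
proof -
  show "0 \<le> emp_tail m u" unfolding emp_tail_def
    by (intro Bochner_Integration.integral_nonneg binom_cdf_ball_bounds)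
  have "emp_tail m u \<le> (\<integral>x. 1 \<partial>P.law)" unfolding emp_tail_def
    by (intro integral_mono P.law.integrable_const_bound[where B=1]) (auto simp: binom_cdf_ball_bounds)
  then show "emp_tail m u \<le> 1" by simp
qed

lemma emp_tail_limit: "(\<lambda>m. emp_tail m u) \<longlonglongrightarrow> lim_tail u"
  unfolding emp_tail_def lim_tail_def
proof (rule integral_dominated_convergence[where w="\<lambda>_. 1"])
  show "AE x in P.law. (\<lambda>m. binom_cdf m l (Q.ball_prob x (rad m u))) \<longlonglongrightarrow> poisson_cdf l (exp u * f x)"
    using P.AE_law[OF AE_mass_limit]
    by eventually_elim (intro binom_cdf_poisson_limit, auto simp: filterlim_ident)
qed (auto simp: binom_cdf_ball_bounds)

lemma pair_kernel_bounds:
  fixes x y :: 'a and r :: real and m l1 l2 :: nat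
  assumes g_def: "g = (if dist x y \<le> 2 * r then 1 else trinom_cdf m l1 l2 (Q.ball_prob x r) (Q.ball_prob y r))"
  shows "0 \<le> g" "g \<le> 1"
  using Q.ball_prob_add_le_1[of r x y]
  by (auto simp: g_def not_le intro!: trinom_cdf_nonneg order_trans[OF trinom_cdf_le_binom_cdf] binom_cdf_le_1)

lemma pair_tail_limit: "(\<lambda>m. pair_tail m u) \<longlonglongrightarrow> (lim_tail u)\<^sup>2"
proof -
  let ?G = "\<lambda>m x y. if dist x y \<le> 2 * rad m u then 1
     else trinom_cdf (m - 1) l l (Q.ball_prob x (rad m u)) (Q.ball_prob y (rad m u))"
  let ?h = "\<lambda>x. poisson_cdf l (exp u * f x)"
  have inner: "AE x in P.law. (\<lambda>m. \<integral>y. ?G m x y \<partial>P.law) \<longlonglongrightarrow> ?h x * lim_tail u"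
    using P.AE_law[OF AE_mass_limit]
  proof eventually_elim
    case x: (elim x)
    have "(\<lambda>m. \<integral>y. ?G m x y \<partial>P.law) \<longlonglongrightarrow> (\<integral>y. ?h x * ?h y \<partial>P.law)"
    proof (rule integral_dominated_convergence[where w="\<lambda>_. 1"])
      \<comment> \<open>Points are null for a law with a density, so y differs from x almost surely,
        and the balls are disjoint once the radius is below half the distance.\<close>
      show "AE y in P.law. (\<lambda>m. ?G m x y) \<longlonglongrightarrow> ?h x * ?h y"
        using P.AE_law[OF AE_mass_limit] P.AE_law[OF AE_lborel_singleton[of x]]
      proof eventually_elim
        case y: (elim y)
        have "(\<lambda>m. trinom_cdf (m - 1) l l (Q.ball_prob x (rad m u)) (Q.ball_prob y (rad m u))) \<longlonglongrightarrow> ?h x * ?h y"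
          using x y by (intro trinom_cdf_poisson_limit) (auto simp: filterlim_minus_const_nat_at_top)
        moreover have "\<forall>\<^sub>F m in sequentially. rad m u < dist x y / 2"
          using y by (intro eventually_rad_less) auto
        then have "\<forall>\<^sub>F m in sequentially. trinom_cdf (m - 1) l l (Q.ball_prob x (rad m u)) (Q.ball_prob y (rad m u)) = ?G m x y"
          by eventually_elim auto
        ultimately show ?case by (rule Lim_transform_eventually)
      qed
    qed (auto simp: pair_kernel_bounds[OF refl])
    then show ?case by (simp add: lim_tail_def)
  qed
  have "(\<lambda>m. pair_tail m u) \<longlonglongrightarrow> (\<integral>x. ?h x * lim_tail u \<partial>P.law)"
    unfolding pair_tail_def
  proof (rule integral_dominated_convergence[where w="\<lambda>_. 1", OF _ _ _ inner])
    fix m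
    have "(\<lambda>x. \<integral>y. ?G m x y \<partial>P.law) \<in> borel_measurable P.law" by measurable
    then show "(\<lambda>x. \<integral>y. ?G m x y \<partial>P.law) \<in> borel_measurable P.law" .
    have "(\<integral>y. ?G m x y \<partial>P.law) \<le> (\<integral>y. 1 \<partial>P.law)" for x
      by (intro integral_mono P.law.integrable_const_bound[where B=1]) (auto simp: pair_kernel_bounds[OF refl])
    moreover have "0 \<le> (\<integral>y. ?G m x y \<partial>P.law)" for x
      by (intro Bochner_Integration.integral_nonneg pair_kernel_bounds[OF refl])
    ultimately show "AE x in P.law. norm (\<integral>y. ?G m x y \<partial>P.law) \<le> 1" by auto
  qed auto
  then show ?thesis by (simp add: lim_tail_def power2_eq_square)
qed

text \<open>With I the ball average at x, fewer than l hits have probability at most l^2 / (e^u I).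
  Capping by 1 and passing to the power \<epsilon> leaves the inverse \<epsilon>-moment of I, which
  \<open>lower_moment\<close> bounds for radii up to R.\<close>

lemma emp_tail_le:
  assumes m: "0 < m" and r: "rad m u \<le> R"
  shows "emp_tail m u \<le> (real l)\<^sup>2 * CT * exp (- \<epsilon> * u)"
proof -
  have l2: "(real l)\<^sup>2 \<ge> 1" using l_ge by simp
  have "ennreal (emp_tail m u) = (\<integral>\<^sup>+x. ennreal (binom_cdf m l (Q.ball_prob x (rad m u))) \<partial>P.law)"
    unfolding emp_tail_def
    by (intro nn_integral_eq_integral[symmetric] P.law.integrable_const_bound[where B=1]) (auto simp: binom_cdf_ball_bounds)
  also have "\<dots> \<le> (\<integral>\<^sup>+x. ennreal ((real l)\<^sup>2 * exp (- \<epsilon> * u)) * inverse (ennreal (Q.ball_avg x (rad m u) powr \<epsilon>)) \<partial>P.law)"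
  proof (rule nn_integral_mono)
    fix x
    let ?I = "Q.ball_avg x (rad m u)"
    have I: "?I \<ge> 0" using rad_pos[OF m] by (simp add: less_imp_le)
    show "ennreal (binom_cdf m l (Q.ball_prob x (rad m u))) \<le> ennreal ((real l)\<^sup>2 * exp (- \<epsilon> * u)) * inverse (ennreal (?I powr \<epsilon>))"
    proof (cases "?I = 0")
      \<comment> \<open>Here the right-hand side is a positive number times
        \<open>inverse 0\<close>, hence infinite.\<close>
      case True
      have "(real l)\<^sup>2 * exp (- \<epsilon> * u) > 0" using l_ge by simp
      then show ?thesis using True l_ge by (auto simp: ennreal_mult_top)
    next
      case False
      then have I: "?I > 0" using I by simp
      let ?z = "(real l)\<^sup>2 / (exp u * ?I)"
      have "binom_cdf m l (Q.ball_prob x (rad m u)) * (exp u * ?I) \<le> (real l)\<^sup>2"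
        using binom_cdf_le_inverse[of "Q.ball_prob x (rad m u)" m l] mass_eq[OF m] by simp
      then have "binom_cdf m l (Q.ball_prob x (rad m u)) \<le> ?z"
        using I by (simp add: pos_le_divide_eq)
      then have "binom_cdf m l (Q.ball_prob x (rad m u)) \<le> min 1 ?z"
        using binom_cdf_ball_bounds by simp
      also have "\<dots> \<le> ?z powr \<epsilon>" using eps I by (intro min_one_le_powr) auto
      also have "\<dots> = ((real l)\<^sup>2) powr \<epsilon> * exp (- \<epsilon> * u) * inverse (?I powr \<epsilon>)"
        using I by (simp add: powr_divide powr_mult exp_powr_real exp_minus mult_ac divide_simps)
      also have "\<dots> \<le> ((real l)\<^sup>2) powr 1 * exp (- \<epsilon> * u) * inverse (?I powr \<epsilon>)"
        using l2 eps by (intro mult_right_mono powr_mono) auto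
      also have "\<dots> = (real l)\<^sup>2 * exp (- \<epsilon> * u) * inverse (?I powr \<epsilon>)" by simp
      finally have "ennreal (binom_cdf m l (Q.ball_prob x (rad m u))) \<le> ennreal ((real l)\<^sup>2 * exp (- \<epsilon> * u) * inverse (?I powr \<epsilon>))"
        by (rule ennreal_leI)
      also have "\<dots> = ennreal ((real l)\<^sup>2 * exp (- \<epsilon> * u)) * inverse (ennreal (?I powr \<epsilon>))"
        using I by (simp add: ennreal_mult inverse_ennreal)
      finally show ?thesis .
    qed
  qed
  also have "\<dots> = ennreal ((real l)\<^sup>2 * exp (- \<epsilon> * u)) * (\<integral>\<^sup>+x. inverse (ennreal (Q.ball_avg x (rad m u) powr \<epsilon>)) \<partial>P.law)"
    by (rule nn_integral_cmult) measurable
  also have "\<dots> \<le> ennreal ((real l)\<^sup>2 * exp (- \<epsilon> * u)) * ennreal CT"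
    using rad_pos[OF m] r by (intro mult_left_mono lower_moment) auto
  also have "\<dots> = ennreal ((real l)\<^sup>2 * exp (- \<epsilon> * u) * CT)"
    using C_nonneg by (simp add: ennreal_mult)
  finally show ?thesis using C_nonneg by (simp add: mult_ac)
qed

lemma one_minus_emp_tail_le:
  assumes m: "0 < m" and r: "rad m u \<le> R"
  shows "1 - emp_tail m u \<le> CQ * exp (\<epsilon> * u)"
proof -
  have int: "integrable P.law (\<lambda>x. binom_cdf m l (Q.ball_prob x (rad m u)))"
    by (intro P.law.integrable_const_bound[where B=1]) (auto simp: binom_cdf_ball_bounds)
  have "1 - emp_tail m u = (\<integral>x. 1 - binom_cdf m l (Q.ball_prob x (rad m u)) \<partial>P.law)"
    unfolding emp_tail_def using int by simp
  then have "ennreal (1 - emp_tail m u) = (\<integral>\<^sup>+x. ennreal (1 - binom_cdf m l (Q.ball_prob x (rad m u))) \<partial>P.law)"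
    using int by (simp add: nn_integral_eq_integral binom_cdf_ball_bounds)
  also have "\<dots> \<le> (\<integral>\<^sup>+x. ennreal (exp (\<epsilon> * u)) * ennreal (Q.ball_avg x (rad m u) powr \<epsilon>) \<partial>P.law)"
  proof (rule nn_integral_mono)
    fix x
    let ?I = "Q.ball_avg x (rad m u)"
    have I: "?I \<ge> 0" using rad_pos[OF m] by (simp add: less_imp_le)
    have "1 - binom_cdf m l (Q.ball_prob x (rad m u)) \<le> exp u * ?I"
      using binom_cdf_ge[of "Q.ball_prob x (rad m u)" l m] mass_eq[OF m] l_ge by simp
    then have "1 - binom_cdf m l (Q.ball_prob x (rad m u)) \<le> min 1 (exp u * ?I)"
      using binom_cdf_ball_bounds by simp
    also have "\<dots> \<le> (exp u * ?I) powr \<epsilon>" using eps I by (intro min_one_le_powr) auto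
    also have "\<dots> = exp (\<epsilon> * u) * ?I powr \<epsilon>"
      using I by (simp add: powr_mult exp_powr_real mult_ac)
    finally show "ennreal (1 - binom_cdf m l (Q.ball_prob x (rad m u))) \<le> ennreal (exp (\<epsilon> * u)) * ennreal (?I powr \<epsilon>)"
      by (simp add: ennreal_mult[symmetric] ennreal_leI)
  qed
  also have "\<dots> = ennreal (exp (\<epsilon> * u)) * (\<integral>\<^sup>+x. ennreal (Q.ball_avg x (rad m u) powr \<epsilon>) \<partial>P.law)"
    by (rule nn_integral_cmult) measurable
  also have "\<dots> \<le> ennreal (exp (\<epsilon> * u)) * ennreal CQ"
    using rad_pos[OF m] r by (intro mult_left_mono upper_moment) auto
  also have "\<dots> = ennreal (exp (\<epsilon> * u) * CQ)"
    using C_nonneg by (simp add: ennreal_mult)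
  finally show ?thesis using C_nonneg by (simp add: mult_ac)
qed

text \<open>Limits of the finite-sample bounds as m grows. For fixed u the radius is eventually
  below R, so the restriction on the radius disappears.\<close>

lemma lim_tail_le: "lim_tail u \<le> (real l)\<^sup>2 * CT * exp (- \<epsilon> * u)"
  and one_minus_lim_tail_le: "1 - lim_tail u \<le> CQ * exp (\<epsilon> * u)"
  and lim_tail_bounds: "0 \<le> lim_tail u" "lim_tail u \<le> 1"
proof -
  have ev: "\<forall>\<^sub>F m in sequentially. 0 < m \<and> rad m u \<le> R"
    using eventually_rad_less[OF R_pos, of u] eventually_gt_at_top[of 0] by eventually_elim auto
  show "lim_tail u \<le> (real l)\<^sup>2 * CT * exp (- \<epsilon> * u)"
    by (rule tendsto_upperbound[OF emp_tail_limit]) (rule eventually_mono[OF ev], intro emp_tail_le, auto)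
  show "1 - lim_tail u \<le> CQ * exp (\<epsilon> * u)"
    by (rule tendsto_upperbound[OF tendsto_diff[OF tendsto_const emp_tail_limit]])
       (rule eventually_mono[OF ev], intro one_minus_emp_tail_le, auto)
  show "0 \<le> lim_tail u" by (rule tendsto_lowerbound[OF emp_tail_limit]) (auto simp: emp_tail_bounds)
  show "lim_tail u \<le> 1" by (rule tendsto_upperbound[OF emp_tail_limit]) (auto simp: emp_tail_bounds)
qed

text \<open>At Lebesgue points the averages over balls of radius R / (n + 1) converge to f, so
  Fatou's lemma passes both bounds on to f. Inversion is continuous on \<open>ennreal\<close>, also
  at 0.\<close>

lemma dens_moments:
  shows "(\<integral>\<^sup>+x. ennreal (f x powr \<epsilon>) \<partial>P.law) \<le> ennreal CQ"
    and "(\<integral>\<^sup>+x. inverse (ennreal (f x powr \<epsilon>)) \<partial>P.law) \<le> ennreal CT"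
proof -
  define r where "r n = R / real (Suc n)" for n
  have r: "0 < r n" "r n \<le> R" for n
    using R_pos unfolding r_def by (auto simp: divide_le_eq)
  have "r \<longlonglongrightarrow> 0"
    unfolding r_def using tendsto_mult[OF tendsto_const LIMSEQ_Suc[OF lim_1_over_n], of R] by simp
  then have rlim: "filterlim r (at_right 0) sequentially"
    using r by (auto simp: filterlim_at less_imp_neq[OF r(1), symmetric])
  have conv: "AE x in P.law. (\<lambda>n. ennreal (Q.ball_avg x (r n) powr \<epsilon>)) \<longlonglongrightarrow> ennreal (f x powr \<epsilon>)"
    using P.AE_law[OF Q.lebesgue_differentiation]
  proof eventually_elim
    case (elim x)
    have "(\<lambda>n. Q.ball_avg x (r n)) \<longlonglongrightarrow> f x" by (rule filterlim_compose[OF elim rlim])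
    then show ?case
      using eps r by (intro tendsto_ennrealI tendsto_powr') (auto simp: less_imp_le)
  qed
  have "(\<integral>\<^sup>+x. ennreal (f x powr \<epsilon>) \<partial>P.law) = (\<integral>\<^sup>+x. liminf (\<lambda>n. ennreal (Q.ball_avg x (r n) powr \<epsilon>)) \<partial>P.law)"
    by (intro nn_integral_cong_AE eventually_mono[OF conv] lim_imp_Liminf[symmetric]) (rule sequentially_bot, assumption)
  also have "\<dots> \<le> liminf (\<lambda>n. \<integral>\<^sup>+x. ennreal (Q.ball_avg x (r n) powr \<epsilon>) \<partial>P.law)"
    by (intro nn_integral_liminf) measurable
  also have "\<dots> \<le> liminf (\<lambda>n. ennreal CQ)"
    using r by (intro Liminf_mono always_eventually allI upper_moment) auto
  finally show "(\<integral>\<^sup>+x. ennreal (f x powr \<epsilon>) \<partial>P.law) \<le> ennreal CQ" by (simp add: Liminf_const)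
  have inv: "isCont inverse (z :: ennreal)" for z
    using continuous_on_inverse_ennreal[OF continuous_on_id, of UNIV] by (simp add: continuous_on_eq_continuous_at)
  have "(\<integral>\<^sup>+x. inverse (ennreal (f x powr \<epsilon>)) \<partial>P.law) = (\<integral>\<^sup>+x. liminf (\<lambda>n. inverse (ennreal (Q.ball_avg x (r n) powr \<epsilon>))) \<partial>P.law)"
    by (intro nn_integral_cong_AE eventually_mono[OF conv] lim_imp_Liminf[symmetric] isCont_tendsto_compose[OF inv])
      (rule sequentially_bot, assumption)
  also have "\<dots> \<le> liminf (\<lambda>n. \<integral>\<^sup>+x. inverse (ennreal (Q.ball_avg x (r n) powr \<epsilon>)) \<partial>P.law)"
    by (intro nn_integral_liminf) measurable
  also have "\<dots> \<le> liminf (\<lambda>n. ennreal CT)"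
    using r by (intro Liminf_mono always_eventually allI lower_moment) auto
  finally show "(\<integral>\<^sup>+x. inverse (ennreal (f x powr \<epsilon>)) \<partial>P.law) \<le> ennreal CT" by (simp add: Liminf_const)
qed

text \<open>A finite inverse moment rules out f = 0 on a set of positive mass. For f = q this is the
  absolute continuity of the law of X with respect to the law of Y.\<close>

lemma AE_dens_pos: "AE x in P.law. 0 < f x"
proof -
  have "(\<integral>\<^sup>+x. inverse (ennreal (f x powr \<epsilon>)) \<partial>P.law) \<noteq> \<infinity>"
    using dens_moments(2) by (auto simp: top_unique)
  then have "AE x in P.law. inverse (ennreal (f x powr \<epsilon>)) \<noteq> \<infinity>"
    by (intro nn_integral_PInf_AE) auto
  then show ?thesis
    by eventually_elim (use Q.dens_nonneg in \<open>force simp: less_le\<close>)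
qed

lemma AE_ball_prob_pos: "AE x in P.law. 0 < Q.ball_prob x R"
proof -
  have "(\<integral>\<^sup>+x. inverse (ennreal (Q.ball_avg x R powr \<epsilon>)) \<partial>P.law) \<noteq> \<infinity>"
    using lower_moment[OF R_pos order_refl] by (auto simp: top_unique)
  then have "AE x in P.law. inverse (ennreal (Q.ball_avg x R powr \<epsilon>)) \<noteq> \<infinity>"
    by (intro nn_integral_PInf_AE) auto
  then show ?thesis
  proof eventually_elim
    case (elim x)
    then have "Q.ball_prob x R \<noteq> 0" by (auto simp: Q.ball_avg_def)
    then show ?case using Q.ball_prob_nonneg[of x R] by linarith
  qed
qed

lemma integrable_ln_dens: "integrable P.law (\<lambda>x. ln (f x))"
proof -
  have "(\<integral>\<^sup>+x. ennreal (norm (ln (f x))) \<partial>P.law)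
    \<le> (\<integral>\<^sup>+x. ennreal (1/\<epsilon>) * (ennreal (f x powr \<epsilon>) + inverse (ennreal (f x powr \<epsilon>))) \<partial>P.law)"
  proof (rule nn_integral_mono_AE)
    show "AE x in P.law. ennreal (norm (ln (f x))) \<le> ennreal (1/\<epsilon>) * (ennreal (f x powr \<epsilon>) + inverse (ennreal (f x powr \<epsilon>)))"
      using AE_dens_pos
    proof eventually_elim
      case (elim x)
      have "ennreal (norm (ln (f x))) \<le> ennreal ((f x powr \<epsilon> + f x powr (- \<epsilon>)) / \<epsilon>)"
        using abs_ln_le_powr[OF elim, of \<epsilon>] eps by (intro ennreal_leI) auto
      also have "\<dots> = ennreal (1/\<epsilon>) * (ennreal (f x powr \<epsilon>) + inverse (ennreal (f x powr \<epsilon>)))"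
        using elim eps by (simp add: inverse_ennreal powr_minus ennreal_mult[symmetric] ennreal_plus[symmetric] del: ennreal_plus)
      finally show ?case .
    qed
  qed
  also have "\<dots> = ennreal (1/\<epsilon>) * ((\<integral>\<^sup>+x. ennreal (f x powr \<epsilon>) \<partial>P.law) + (\<integral>\<^sup>+x. inverse (ennreal (f x powr \<epsilon>)) \<partial>P.law))"
    by (subst nn_integral_cmult, measurable) (subst nn_integral_add, auto)
  also have "\<dots> \<le> ennreal (1/\<epsilon>) * (ennreal CQ + ennreal CT)"
    by (intro mult_left_mono add_mono dens_moments) auto
  also have "\<dots> < \<infinity>" by (simp add: ennreal_mult_less_top)
  finally show ?thesis by (intro integrableI_bounded) auto
qed

definition lim_const :: real where
  "lim_const = Digamma (real l) - (\<integral>x. ln (f x) \<partial>P.law)"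

text \<open>\<open>lim_tail\<close> is the tail function of \<open>ln T - ln (f X)\<close> for \<open>X\<close> with density \<open>p\<close> and an independent Erlang variable \<open>T\<close>.\<close>

lemma lim_tail_integral:
  shows "integrable lborel (\<lambda>u. lim_tail u - of_bool (u < 0))"
    and "(\<integral>u. (lim_tail u - of_bool (u < 0)) \<partial>lborel) = lim_const"
proof -
  interpret E: prob_space "erlang_law l" by (rule prob_space_erlang_law)
  interpret PE: pair_prob_space P.law "erlang_law l" ..
  let ?Z = "\<lambda>z :: 'a \<times> real. ln (snd z) - ln (f (fst z))"
  have i1: "integrable (P.law \<Otimes>\<^sub>M erlang_law l) (\<lambda>z. ln (snd z))"
    using expectation_ln_erlang(1)[OF l_ge]
    by (intro PE.Fubini_integrable) (auto simp: E.prob_space)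
  have i2: "integrable (P.law \<Otimes>\<^sub>M erlang_law l) (\<lambda>z. ln (f (fst z)))"
    using integrable_ln_dens E.prob_space by (intro PE.Fubini_integrable) auto
  have int: "integrable (P.law \<Otimes>\<^sub>M erlang_law l) ?Z" using i1 i2 by auto
  have ex: "(\<integral>z. ?Z z \<partial>(P.law \<Otimes>\<^sub>M erlang_law l)) = lim_const"
  proof -
    have "(\<integral>z. ?Z z \<partial>(P.law \<Otimes>\<^sub>M erlang_law l)) = (\<integral>x. (\<integral>t. (ln t - ln (f x)) \<partial>erlang_law l) \<partial>P.law)"
      using PE.integral_fst[of "\<lambda>x t. ln t - ln (f x)"] int by (simp add: split_beta')
    also have "\<dots> = (\<integral>x. (Digamma (real l) - ln (f x)) \<partial>P.law)"
      using expectation_ln_erlang[OF l_ge] E.prob_space by simp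
    also have "\<dots> = lim_const" using integrable_ln_dens by (simp add: lim_const_def)
    finally show ?thesis .
  qed
  have tail: "PE.prob {z \<in> space (P.law \<Otimes>\<^sub>M erlang_law l). u < ?Z z} = lim_tail u" for u
  proof -
    have "PE.prob {z \<in> space (P.law \<Otimes>\<^sub>M erlang_law l). u < ?Z z}
      = (\<integral>z. indicat_real {z. u < ?Z z} z \<partial>(P.law \<Otimes>\<^sub>M erlang_law l))"
      by (simp add: space_pair_measure)
    also have "\<dots> = (\<integral>x. (\<integral>t. indicat_real {z. u < ?Z z} (x, t) \<partial>erlang_law l) \<partial>P.law)"
      by (rule PE.integral_fst'[symmetric], rule PE.integrable_const_bound[where B=1]) (auto)
    also have "\<dots> = lim_tail u"
      unfolding lim_tail_def
    proof (intro integral_cong_AE)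
      show "AE x in P.law. (\<integral>t. indicat_real {z. u < ?Z z} (x, t) \<partial>erlang_law l) = poisson_cdf l (exp u * f x)"
        using AE_dens_pos
      proof eventually_elim
        case (elim x)
        have "(\<integral>t. indicat_real {z. u < ?Z z} (x, t) \<partial>erlang_law l) = (\<integral>t. indicat_real {exp u * f x<..} t \<partial>erlang_law l)"
        proof (intro integral_cong_AE)
          show "AE t in erlang_law l. indicat_real {z. u < ?Z z} (x, t) = (indicat_real {exp u * f x<..} t :: real)"
            using AE_erlang_pos
          proof eventually_elim
            case t: (elim t)
            have "u < ln t - ln (f x) \<longleftrightarrow> exp u * f x < t"
            proof -
              have "u < ln t - ln (f x) \<longleftrightarrow> u + ln (f x) < ln t" by auto
              also have "\<dots> \<longleftrightarrow> exp (u + ln (f x)) < t" using t by (metis exp_less_cancel_iff exp_ln)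
              finally show ?thesis using elim by (simp add: exp_add)
            qed
            then show ?case by (simp add: indicator_def)
          qed
        qed auto
        also have "\<dots> = E.prob (UNIV - {..exp u * f x})"
          by (simp add: Compl_eq_Diff_UNIV[symmetric] Compl_atMost)
        also have "\<dots> = 1 - E.prob {..exp u * f x}"
          using E.prob_compl[of "{..exp u * f x}"] by (simp add: sets_erlang_law)
        also have "E.prob {..exp u * f x} = erlang_CDF (l - 1) 1 (exp u * f x)"
          using emeasure_erlang_density[of 1 "l - 1" "exp u * f x"]
          by (simp add: erlang_law_def measure_def)
        also have "1 - \<dots> = poisson_cdf l (exp u * f x)"
          using elim l_ge by (simp add: poisson_cdf_eq_erlang)
        finally show ?case .
      qed
    qed auto
    finally show ?thesis .
  qed
  show "integrable lborel (\<lambda>u. lim_tail u - of_bool (u < 0))"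
    using PE.tail_integral(1)[OF int] unfolding tail .
  show "(\<integral>u. (lim_tail u - of_bool (u < 0)) \<partial>lborel) = lim_const"
    using PE.tail_integral(2)[OF int] unfolding tail ex .
qed

text \<open>Dominated convergence with the logarithmic second moment as majorant: at almost every x
  the ball of radius R has positive mass, so by \<open>binom_cdf_le_inverse\<close> the chance of
  fewer than l hits tends to 0.\<close>

lemma log_tail_limit: "log_tail \<longlonglongrightarrow> 0"
proof -
  let ?\<phi> = "\<lambda>x. \<integral>\<^sup>+y. ennreal ((max 0 (ln (dist x y / R)))\<^sup>2) \<partial>Q.law"
  let ?b = "\<lambda>m x. binom_cdf (m - 1) l (Q.ball_prob x R)"
  have fin: "(\<integral>\<^sup>+x. ?\<phi> x \<partial>P.law) < \<infinity>" by (rule log_moment)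
  have eq: "log_tail m = (\<integral>\<^sup>+x. ?\<phi> x * ennreal (?b m x) \<partial>P.law)" for m
    unfolding log_tail_def by (intro nn_integral_cong nn_integral_multc) measurable
  have AEfin: "AE x in P.law. ?\<phi> x \<noteq> \<infinity>"
    using fin by (intro nn_integral_PInf_AE) auto
  have "(\<lambda>m. \<integral>\<^sup>+x. ?\<phi> x * ennreal (?b m x) \<partial>P.law) \<longlonglongrightarrow> (\<integral>\<^sup>+x. 0 \<partial>P.law)"
  proof (rule nn_integral_dominated_convergence[where w = ?\<phi>])
    show "AE x in P.law. ?\<phi> x * ennreal (?b m x) \<le> ?\<phi> x" for m
      using mult_left_mono[of "ennreal (?b m x)" 1 "?\<phi> x" for x] binom_cdf_ball_bounds(2) by auto
    show "AE x in P.law. (\<lambda>m. ?\<phi> x * ennreal (?b m x)) \<longlonglongrightarrow> 0"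
      using AEfin AE_ball_prob_pos
    proof eventually_elim
      case (elim x)
      obtain c where c: "?\<phi> x = ennreal c" "c \<ge> 0" using elim(1) by (cases "?\<phi> x") auto
      have lim: "(\<lambda>m. (real l)\<^sup>2 / Q.ball_prob x R * (1 / real m)) \<longlonglongrightarrow> (real l)\<^sup>2 / Q.ball_prob x R * 0"
        by (intro tendsto_intros lim_1_over_n)
      have "(\<lambda>m. binom_cdf m l (Q.ball_prob x R)) \<longlonglongrightarrow> 0"
      proof (rule tendsto_sandwich[OF _ _ tendsto_const])
        show "\<forall>\<^sub>F m in sequentially. binom_cdf m l (Q.ball_prob x R) \<le> (real l)\<^sup>2 / Q.ball_prob x R * (1 / real m)"
          using eventually_gt_at_top[of 0]
        proof eventually_elim
          case (elim m)
          then show ?case using binom_cdf_le_inverse[of "Q.ball_prob x R" m l] \<open>0 < Q.ball_prob x R\<close>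
            by (simp add: field_simps)
        qed
      qed (use lim in \<open>auto simp: binom_cdf_ball_bounds\<close>)
      then have "(\<lambda>m. ?b m x) \<longlonglongrightarrow> 0"
        by (rule filterlim_compose[OF _ filterlim_minus_const_nat_at_top])
      then have "(\<lambda>m. ennreal (c * ?b m x)) \<longlonglongrightarrow> ennreal (c * 0)" by (intro tendsto_ennrealI tendsto_intros)
      then show ?case using c by (simp add: ennreal_mult binom_cdf_ball_bounds)
    qed
  qed (use fin in auto)
  moreover have "log_tail = (\<lambda>m. \<integral>\<^sup>+x. ?\<phi> x * ennreal (?b m x) \<partial>P.law)" by (rule ext) (rule eq)
  ultimately show ?thesis by (simp only: nn_integral_0_iff_AE nn_integral_const mult_zero_left)
qed

section \<open>Error rates integrated over the threshold\<close>

definition tail_bound :: "real \<Rightarrow> real" where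
  "tail_bound u = 2 * (CQ + (real l)\<^sup>2 * CT) * exp (- \<epsilon> * \<bar>u\<bar>)"

text \<open>The exponent is half that of \<open>tail_bound\<close>: both the product of the weight
  with \<open>tail_bound\<close> and the reciprocal of the weight are then integrable, as the two
  factors of Cauchy-Schwarz require.\<close>

definition weight :: "real \<Rightarrow> real" where
  "weight u = exp (\<epsilon> / 2 * \<bar>u\<bar>)"

text \<open>The expansion of E (S - h)^2 with the mean of S equal to \<open>emp_tail\<close> and
  with \<open>pair_tail\<close> in place of its second moment, which leaves out the diagonal. The
  maximum with 0 makes it a nonnegative bound without comparing \<open>pair_tail\<close> with the
  square of \<open>emp_tail\<close>.\<close>

definition tail_gap :: "nat \<Rightarrow> real \<Rightarrow> real" where
  "tail_gap m u = max 0 (pair_tail m u - 2 * lim_tail u * emp_tail m u + (lim_tail u)\<^sup>2)"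

definition rate_n :: "nat \<Rightarrow> ennreal" where
  "rate_n n = (\<integral>\<^sup>+u. ennreal (weight u * min (tail_bound u) (1 / real n)) \<partial>lborel)"

text \<open>Where the radius reaches R the full \<open>tail_bound\<close> is paid. For a fixed u
  this happens for finitely many m, so the integrand still tends to 0.\<close>

definition rate_m :: "nat \<Rightarrow> ennreal" where
  "rate_m m = (\<integral>\<^sup>+u. ennreal (weight u * (if rad m u < R then min (tail_bound u) (tail_gap m u) else tail_bound u)) \<partial>lborel)"

lemma measurable_weight[measurable]: "weight \<in> borel_measurable borel"
  unfolding weight_def by measurable

lemma measurable_tail_bound[measurable]: "tail_bound \<in> borel_measurable borel"
  unfolding tail_bound_def by measurable

lemma measurable_emp_tail[measurable]: "emp_tail m \<in> borel_measurable borel"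
  unfolding emp_tail_def by measurable

lemma measurable_lim_tail[measurable]: "lim_tail \<in> borel_measurable borel"
  unfolding lim_tail_def by measurable

lemma measurable_pair_tail[measurable]: "pair_tail m \<in> borel_measurable borel"
  unfolding pair_tail_def by measurable

lemma measurable_tail_gap[measurable]: "tail_gap m \<in> borel_measurable borel"
  unfolding tail_gap_def by measurable

lemma tail_bound_nonneg: "0 \<le> tail_bound u"
  using C_nonneg by (simp add: tail_bound_def)

lemma weight_pos: "0 < weight u"
  by (simp add: weight_def)

lemma nn_integral_weight_tail_bound: "(\<integral>\<^sup>+u. ennreal (weight u * tail_bound u) \<partial>lborel) < \<infinity>"
proof -
  have "(\<integral>\<^sup>+u. ennreal (weight u * tail_bound u) \<partial>lborel)
    = (\<integral>\<^sup>+u. ennreal (2 * (CQ + (real l)\<^sup>2 * CT)) * ennreal (exp (- (\<epsilon> / 2) * \<bar>u\<bar>)) \<partial>lborel)"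
  proof (intro nn_integral_cong)
    fix u
    have "\<epsilon> / 2 * \<bar>u\<bar> + (- \<epsilon> * \<bar>u\<bar>) = - (\<epsilon> / 2) * \<bar>u\<bar>" by (simp add: field_simps)
    then have "exp (\<epsilon> / 2 * \<bar>u\<bar>) * exp (- \<epsilon> * \<bar>u\<bar>) = exp (- (\<epsilon> / 2) * \<bar>u\<bar>)" by (metis exp_add)
    then have "weight u * tail_bound u = 2 * (CQ + (real l)\<^sup>2 * CT) * exp (- (\<epsilon> / 2) * \<bar>u\<bar>)"
      unfolding weight_def tail_bound_def by (metis mult.assoc mult.commute)
    then show "ennreal (weight u * tail_bound u) = ennreal (2 * (CQ + (real l)\<^sup>2 * CT)) * ennreal (exp (- (\<epsilon> / 2) * \<bar>u\<bar>))"
      using C_nonneg by (simp add: ennreal_mult)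
  qed
  also have "\<dots> = ennreal (2 * (CQ + (real l)\<^sup>2 * CT)) * (\<integral>\<^sup>+u. ennreal (exp (- (\<epsilon> / 2) * \<bar>u\<bar>)) \<partial>lborel)"
    by (rule nn_integral_cmult) measurable
  also have "\<dots> < \<infinity>"
    using nn_integral_exp_abs_finite[of "\<epsilon> / 2"] eps by (auto simp: ennreal_mult_less_top)
  finally show ?thesis .
qed

lemma rate_n_limit: "rate_n \<longlonglongrightarrow> 0"
proof -
  have "(\<lambda>n. rate_n n) \<longlonglongrightarrow> (\<integral>\<^sup>+u. 0 \<partial>(lborel :: real measure))"
    unfolding rate_n_def
  proof (rule nn_integral_dominated_convergence[where w="\<lambda>u. ennreal (weight u * tail_bound u)"])
    show "AE u in lborel. ennreal (weight u * min (tail_bound u) (1 / real n)) \<le> ennreal (weight u * tail_bound u)" for n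
      by (auto intro!: ennreal_leI mult_left_mono less_imp_le[OF weight_pos])
    show "AE u in lborel. (\<lambda>n. ennreal (weight u * min (tail_bound u) (1 / real n))) \<longlonglongrightarrow> 0"
    proof (intro AE_I2)
      fix u
      have "(\<lambda>n. ennreal (weight u * min (tail_bound u) (1 / real n))) \<longlonglongrightarrow> ennreal (weight u * min (tail_bound u) 0)"
        by (intro tendsto_intros tendsto_ennrealI lim_1_over_n)
      then show "(\<lambda>n. ennreal (weight u * min (tail_bound u) (1 / real n))) \<longlonglongrightarrow> 0"
        by (simp add: min_absorb2[OF tail_bound_nonneg])
    qed
  qed (use nn_integral_weight_tail_bound in auto)
  then show ?thesis by simp
qed

lemma rate_m_limit: "rate_m \<longlonglongrightarrow> 0"
proof -
  have "(\<lambda>m. rate_m m) \<longlonglongrightarrow> (\<integral>\<^sup>+u. 0 \<partial>(lborel :: real measure))"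
    unfolding rate_m_def
  proof (rule nn_integral_dominated_convergence[where w="\<lambda>u. ennreal (weight u * tail_bound u)"])
    show "AE u in lborel. ennreal (weight u * (if rad m u < R then min (tail_bound u) (tail_gap m u) else tail_bound u))
       \<le> ennreal (weight u * tail_bound u)" for m
      by (auto intro!: ennreal_leI mult_left_mono less_imp_le[OF weight_pos])
    show "AE u in lborel. (\<lambda>m. ennreal (weight u * (if rad m u < R then min (tail_bound u) (tail_gap m u) else tail_bound u))) \<longlonglongrightarrow> 0"
    proof (intro AE_I2)
      fix u
      have "(\<lambda>m. tail_gap m u) \<longlonglongrightarrow> max 0 ((lim_tail u)\<^sup>2 - 2 * lim_tail u * lim_tail u + (lim_tail u)\<^sup>2)"
        unfolding tail_gap_def by (intro tendsto_intros pair_tail_limit emp_tail_limit)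
      then have "(\<lambda>m. tail_gap m u) \<longlonglongrightarrow> 0" by (simp add: power2_eq_square)
      then have "(\<lambda>m. ennreal (weight u * min (tail_bound u) (tail_gap m u))) \<longlonglongrightarrow> ennreal (weight u * min (tail_bound u) 0)"
        by (intro tendsto_intros tendsto_ennrealI)
      then have "(\<lambda>m. ennreal (weight u * min (tail_bound u) (tail_gap m u))) \<longlonglongrightarrow> 0"
        by (simp add: min_absorb2[OF tail_bound_nonneg])
      then show "(\<lambda>m. ennreal (weight u * (if rad m u < R then min (tail_bound u) (tail_gap m u) else tail_bound u))) \<longlonglongrightarrow> 0"
        by (rule Lim_transform_eventually) (rule eventually_mono[OF eventually_rad_less[OF R_pos, of u]], simp)
    qed
  qed (use nn_integral_weight_tail_bound in auto)
  then show ?thesis by simp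
qed

definition weight_mass :: ennreal where
  "weight_mass = (\<integral>\<^sup>+u. ennreal (exp (- (\<epsilon> / 2) * \<bar>u\<bar>)) \<partial>lborel)"

lemma square_integral_le:
  assumes g: "integrable lborel g"
  shows "ennreal ((\<integral>u. g u \<partial>lborel)\<^sup>2) \<le> weight_mass * (\<integral>\<^sup>+u. ennreal (weight u * (g u)\<^sup>2) \<partial>lborel)"
proof -
  have [measurable]: "g \<in> borel_measurable borel" using g by auto
  \<comment> \<open>Cauchy-Schwarz squares both factors, so \<epsilon> / 4 becomes \<epsilon> / 2:
    one square is the integrand of \<open>weight_mass\<close>, the other contains
    \<open>weight\<close>.\<close>
  let ?e = "\<lambda>s u. exp (s * (\<epsilon> / 4) * \<bar>u\<bar>)"
  have "ennreal ((\<integral>u. g u \<partial>lborel)\<^sup>2) = (ennreal \<bar>\<integral>u. g u \<partial>lborel\<bar>)\<^sup>2"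
    by (simp add: ennreal_power)
  also have "\<dots> \<le> (\<integral>\<^sup>+u. ennreal \<bar>g u\<bar> \<partial>lborel)\<^sup>2"
    using integral_norm_bound_ennreal[OF g] by (intro power_mono) auto
  also have "(\<integral>\<^sup>+u. ennreal \<bar>g u\<bar> \<partial>lborel) = (\<integral>\<^sup>+u. ennreal (?e (-1) u) * ennreal (?e 1 u * \<bar>g u\<bar>) \<partial>lborel)"
  proof (intro nn_integral_cong)
    fix u
    have "\<bar>g u\<bar> = ?e (-1) u * (?e 1 u * \<bar>g u\<bar>)" by (simp add: mult.assoc[symmetric] exp_add[symmetric])
    then show "ennreal \<bar>g u\<bar> = ennreal (?e (-1) u) * ennreal (?e 1 u * \<bar>g u\<bar>)"
      by (subst ennreal_mult[symmetric]) auto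
  qed
  also have "(\<integral>\<^sup>+u. ennreal (?e (-1) u) * ennreal (?e 1 u * \<bar>g u\<bar>) \<partial>lborel)\<^sup>2
     \<le> (\<integral>\<^sup>+u. (ennreal (?e (-1) u))\<^sup>2 \<partial>lborel) * (\<integral>\<^sup>+u. (ennreal (?e 1 u * \<bar>g u\<bar>))\<^sup>2 \<partial>lborel)"
    by (rule Cauchy_Schwarz_nn_integral) measurable
  also have "(\<integral>\<^sup>+u. (ennreal (?e (-1) u))\<^sup>2 \<partial>lborel) = weight_mass"
    unfolding weight_mass_def
    by (intro nn_integral_cong) (simp add: ennreal_power exp_double[symmetric])
  also have "(\<integral>\<^sup>+u. (ennreal (?e 1 u * \<bar>g u\<bar>))\<^sup>2 \<partial>lborel) = (\<integral>\<^sup>+u. ennreal (weight u * (g u)\<^sup>2) \<partial>lborel)"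
    by (intro nn_integral_cong) (simp add: ennreal_power power_mult_distrib exp_double[symmetric] weight_def)
  finally show ?thesis .
qed

definition err_n :: "nat \<Rightarrow> ennreal" where
  "err_n n = 2 * weight_mass * rate_n n"

text \<open>The factor 2 comes from (A + B)^2 \<le> 2 A^2 + 2 B^2, the squared dimension from the
  logarithm of a d-th power, and l from the l sample points among which the excess distance is
  shared out.\<close>

definition err_m :: "nat \<Rightarrow> ennreal" where
  "err_m m = 2 * weight_mass * rate_m m + of_nat (2 * DIM('a)\<^sup>2 * l) * log_tail m"

lemma weight_mass_finite: "2 * weight_mass < top"
  using nn_integral_exp_abs_finite[of "\<epsilon> / 2"] eps by (simp add: weight_mass_def ennreal_mult_less_top)

lemma err_n_limit: "err_n \<longlonglongrightarrow> 0"
  using ennreal_tendsto_cmult[OF weight_mass_finite rate_n_limit] by (simp add: err_n_def[abs_def])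

lemma err_m_limit: "err_m \<longlonglongrightarrow> 0"
proof -
  have "(\<lambda>m. 2 * weight_mass * rate_m m + of_nat (2 * DIM('a)\<^sup>2 * l) * log_tail m)
     \<longlonglongrightarrow> 2 * weight_mass * 0 + of_nat (2 * DIM('a)\<^sup>2 * l) * 0"
    by (intro tendsto_add ennreal_tendsto_cmult weight_mass_finite rate_m_limit log_tail_limit of_nat_less_top)
  then show ?thesis by (simp add: err_m_def[abs_def])
qed

end

section \<open>Mean square error for a sample\<close>

lemma (in prob_space) indep_var_nn_integral:
  assumes ind: "indep_var S X T Y" and g[measurable]: "g \<in> borel_measurable (S \<Otimes>\<^sub>M T)"
  shows "(\<integral>\<^sup>+w. g (X w, Y w) \<partial>M) = (\<integral>\<^sup>+x. (\<integral>\<^sup>+w. g (x, Y w) \<partial>M) \<partial>distr M S X)"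
proof -
  have [measurable]: "X \<in> measurable M S" "Y \<in> measurable M T"
    using ind by (auto simp: indep_var_rv1 indep_var_rv2)
  interpret Y: prob_space "distr M T Y" by (rule prob_space_distr) simp
  have "(\<integral>\<^sup>+w. g (X w, Y w) \<partial>M) = (\<integral>\<^sup>+z. g z \<partial>distr M (S \<Otimes>\<^sub>M T) (\<lambda>w. (X w, Y w)))"
    by (subst nn_integral_distr) auto
  also have "distr M (S \<Otimes>\<^sub>M T) (\<lambda>w. (X w, Y w)) = distr M S X \<Otimes>\<^sub>M distr M T Y"
    using ind by (simp add: indep_var_distribution_eq)
  also have "(\<integral>\<^sup>+z. g z \<partial>(distr M S X \<Otimes>\<^sub>M distr M T Y)) = (\<integral>\<^sup>+x. \<integral>\<^sup>+y. g (x, y) \<partial>distr M T Y \<partial>distr M S X)"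
    by (rule Y.nn_integral_fst[symmetric]) simp
  also have "\<dots> = (\<integral>\<^sup>+x. (\<integral>\<^sup>+w. g (x, Y w) \<partial>M) \<partial>distr M S X)"
    by (intro nn_integral_cong nn_integral_distr) (auto simp: measurable_split_conv)
  finally show ?thesis .
qed

text \<open>Disjoint index sets give independent blocks, so the centre can be frozen at a point x
  while the sample stays random; the random ball becomes a fixed one, to which
  \<open>prob_count\<close> applies.\<close>

lemma (in prob_space) nn_integral_centre_sample:
  fixes W :: "'i \<Rightarrow> 'a \<Rightarrow> 'b::euclidean_space"
  assumes ind: "indep_vars (\<lambda>_. borel) W UNIV" and a: "a \<notin> K"
    and g: "g \<in> borel_measurable (borel \<Otimes>\<^sub>M PiM K (\<lambda>_. borel))"
  shows "(\<integral>\<^sup>+w. g (W a w, \<lambda>j\<in>K. W j w) \<partial>M) = (\<integral>\<^sup>+x. (\<integral>\<^sup>+w. g (x, \<lambda>j\<in>K. W j w) \<partial>M) \<partial>distr M borel (W a))"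
proof -
  have W[measurable]: "W j \<in> borel_measurable M" for j using ind by (auto simp: indep_vars_def)
  note [measurable] = g
  let ?X = "\<lambda>w. \<lambda>j\<in>{a}. W j w" and ?Y = "\<lambda>w. \<lambda>j\<in>K. W j w"
  have "indep_var (PiM {a} (\<lambda>_. borel)) ?X (PiM K (\<lambda>_. borel)) ?Y"
    using a by (intro indep_var_restrict[OF ind]) auto
  then have "(\<integral>\<^sup>+w. (\<lambda>(v, u). g (v a, u)) (?X w, ?Y w) \<partial>M)
     = (\<integral>\<^sup>+v. (\<integral>\<^sup>+w. (\<lambda>(v, u). g (v a, u)) (v, ?Y w) \<partial>M) \<partial>distr M (PiM {a} (\<lambda>_. borel)) ?X)"
    by (rule indep_var_nn_integral) measurable
  also have "\<dots> = (\<integral>\<^sup>+w'. (\<integral>\<^sup>+w. g (W a w', ?Y w) \<partial>M) \<partial>M)"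
    by (subst nn_integral_distr) simp_all
  also have "\<dots> = (\<integral>\<^sup>+x. (\<integral>\<^sup>+w. g (x, ?Y w) \<partial>M) \<partial>distr M borel (W a))"
    by (subst nn_integral_distr) simp_all
  finally show ?thesis by simp
qed

lemma (in prob_space) nn_integral_two_centres_sample:
  fixes W :: "'i \<Rightarrow> 'a \<Rightarrow> 'b::euclidean_space"
  assumes ind: "indep_vars (\<lambda>_. borel) W UNIV" and ab: "a \<notin> K" "b \<notin> K" "a \<noteq> b"
    and g[measurable]: "g \<in> borel_measurable ((borel \<Otimes>\<^sub>M borel) \<Otimes>\<^sub>M PiM K (\<lambda>_. borel))"
  shows "(\<integral>\<^sup>+w. g ((W a w, W b w), \<lambda>j\<in>K. W j w) \<partial>M)
    = (\<integral>\<^sup>+x. \<integral>\<^sup>+y. (\<integral>\<^sup>+w. g ((x, y), \<lambda>j\<in>K. W j w) \<partial>M) \<partial>distr M borel (W b) \<partial>distr M borel (W a))"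
proof -
  have W[measurable]: "W j \<in> borel_measurable M" for j using ind by (auto simp: indep_vars_def)
  let ?Y = "\<lambda>w. \<lambda>j\<in>K. W j w"
  have Y[measurable]: "?Y \<in> measurable M (PiM K (\<lambda>_. borel))" by measurable
  have "indep_var (PiM {a} (\<lambda>_. borel)) (\<lambda>w. \<lambda>j\<in>{a}. W j w) (PiM {b} (\<lambda>_. borel)) (\<lambda>w. \<lambda>j\<in>{b}. W j w)"
    using ab by (intro indep_var_restrict[OF ind]) auto
  then have "indep_var borel ((\<lambda>v. v a) \<circ> (\<lambda>w. \<lambda>j\<in>{a}. W j w)) borel ((\<lambda>v. v b) \<circ> (\<lambda>w. \<lambda>j\<in>{b}. W j w))"
    by (rule indep_var_compose) auto
  then have i2: "indep_var borel (W a) borel (W b)" by (simp add: o_def)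
  define h where "h z = (\<integral>\<^sup>+w. g (z, ?Y w) \<partial>M)" for z
  have h[measurable]: "h \<in> borel_measurable (borel \<Otimes>\<^sub>M borel)" unfolding h_def by measurable
  let ?X = "\<lambda>w. \<lambda>j\<in>{a, b}. W j w"
  have "indep_var (PiM {a, b} (\<lambda>_. borel)) ?X (PiM K (\<lambda>_. borel)) ?Y"
    using ab by (intro indep_var_restrict[OF ind]) auto
  then have "(\<integral>\<^sup>+w. (\<lambda>(v, u). g ((v a, v b), u)) (?X w, ?Y w) \<partial>M)
     = (\<integral>\<^sup>+v. (\<integral>\<^sup>+w. (\<lambda>(v, u). g ((v a, v b), u)) (v, ?Y w) \<partial>M) \<partial>distr M (PiM {a, b} (\<lambda>_. borel)) ?X)"
    by (rule indep_var_nn_integral) measurable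
  also have "\<dots> = (\<integral>\<^sup>+w. h (W a w, W b w) \<partial>M)"
    unfolding h_def by (subst nn_integral_distr) simp_all
  also have "\<dots> = (\<integral>\<^sup>+x. (\<integral>\<^sup>+w. h (x, W b w) \<partial>M) \<partial>distr M borel (W a))"
    by (rule indep_var_nn_integral[OF i2 h])
  also have "\<dots> = (\<integral>\<^sup>+x. \<integral>\<^sup>+y. h (x, y) \<partial>distr M borel (W b) \<partial>distr M borel (W a))"
    by (intro nn_integral_cong nn_integral_distr[symmetric]) auto
  finally show ?thesis by (simp add: h_def)
qed

lemma pred_card_less[measurable (raw)]:
  assumes K: "finite K" and P: "\<And>j. j \<in> K \<Longrightarrow> Measurable.pred N (\<lambda>z. P z j)"
  shows "Measurable.pred N (\<lambda>z. card {j\<in>K. P z j} < l)"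
proof -
  have *: "real (card {j\<in>K. P z j}) = (\<Sum>j\<in>K. of_bool (P z j))" for z
    using K by (simp add: sum.If_cases of_bool_def Int_def)
  have "card {j\<in>K. P z j} < l \<longleftrightarrow> (\<Sum>j\<in>K. of_bool (P z j)) < real l" for z
    by (subst *[symmetric]) simp
  moreover have "Measurable.pred N (\<lambda>z. (\<Sum>j\<in>K. of_bool (P z j)) < real l)"
    using P by measurable
  ultimately show ?thesis by simp
qed

text \<open>Covers a Y-sample shared by all centres as well as leave-one-out X-samples with m = n -
  1, where every centre belongs to the samples of the others. V is specified by counts,
  independently of its construction by sorting. \<open>rad_0\<close> ensures that thresholds whose
  radius reaches R are nonnegative.\<close>

locale knn_sample = knn_moments p f \<epsilon> R CQ CT l + prob_space M
  for p f :: "'a::euclidean_space \<Rightarrow> real" and \<epsilon> R CQ CT :: real and l :: nat and M :: "'w measure" +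
  fixes W :: "'i \<Rightarrow> 'w \<Rightarrow> 'a" and c :: "nat \<Rightarrow> 'i" and J :: "nat \<Rightarrow> 'i set" and n m :: nat and V :: "nat \<Rightarrow> 'w \<Rightarrow> real"
  assumes indep: "indep_vars (\<lambda>_. borel) W UNIV"
    and n_pos: "0 < n" and m_gt: "l < m" and rad_0: "rad m 0 < R"
    and centre_law: "\<And>i. i < n \<Longrightarrow> distr M borel (W (c i)) = P.law"
    and sample_law: "\<And>i j. i < n \<Longrightarrow> j \<in> J i \<Longrightarrow> distr M borel (W j) = Q.law"
    and finite_J: "\<And>i. i < n \<Longrightarrow> finite (J i)" and card_J: "\<And>i. i < n \<Longrightarrow> card (J i) = m"
    and centre_notin: "\<And>i. i < n \<Longrightarrow> c i \<notin> J i"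
    and pairs: "\<And>i i'. i < n \<Longrightarrow> i' < n \<Longrightarrow> i \<noteq> i' \<Longrightarrow>
      c i \<noteq> c i' \<and> (\<exists>K. K \<subseteq> J i \<and> K \<subseteq> J i' \<and> card K = m - 1 \<and> c i \<notin> K \<and> c i' \<notin> K)"
    and V_le_iff: "\<And>i w r. i < n \<Longrightarrow> V i w \<le> r \<longleftrightarrow> l \<le> card {j\<in>J i. dist (W (c i) w) (W j w) \<le> r}"
begin

lemma m_pos: "0 < m" and m1_pos: "0 < m - 1"
  using m_gt l_ge by auto

lemma W_measurable[measurable]: "W j \<in> borel_measurable M"
  using indep by (auto simp: indep_vars_def)

lemma less_V_iff: "i < n \<Longrightarrow> r < V i w \<longleftrightarrow> card {j\<in>J i. dist (W (c i) w) (W j w) \<le> r} < l"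
  using V_le_iff[of i w r] by auto

lemma V_measurable[measurable]: "i < n \<Longrightarrow> V i \<in> borel_measurable M"
  unfolding borel_measurable_iff_greater less_V_iff
  using finite_J by (intro allI predE) measurable

lemma V_nonneg: "i < n \<Longrightarrow> 0 \<le> V i w"
proof (rule ccontr)
  assume i: "i < n" and "\<not> 0 \<le> V i w"
  then have "l \<le> card {j\<in>J i. dist (W (c i) w) (W j w) \<le> V i w}" "V i w < 0"
    using V_le_iff[of i w "V i w"] by auto
  moreover from this have "{j\<in>J i. dist (W (c i) w) (W j w) \<le> V i w} = {}"
    by (auto simp: not_le intro: less_le_trans)
  ultimately show False using l_ge by simp
qed

lemma prob_in_ball:
  assumes "i < n" "j \<in> J i"
  shows "prob {w \<in> space M. W j w \<in> cball x r} = Q.ball_prob x r"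
proof -
  have "Q.ball_prob x r = measure (distr M borel (W j)) (cball x r)"
    using assms by (simp add: Q.ball_prob_def sample_law)
  also have "\<dots> = prob {w \<in> space M. W j w \<in> cball x r}"
    by (subst measure_distr) (auto simp: vimage_def Int_def conj_commute)
  finally show ?thesis by simp
qed

lemma indep_subset: "indep_vars (\<lambda>_. borel) W K"
  by (rule indep_vars_subset[OF indep]) auto

lemma emeasure_count:
  assumes i: "i < n" and K: "K \<subseteq> J i" "K \<noteq> {}"
  shows "emeasure M {w \<in> space M. card {j\<in>K. dist x (W j w) \<le> r} < l} = ennreal (binom_cdf (card K) l (Q.ball_prob x r))"
  using prob_count[OF indep_subset[of K], of "cball x r" "Q.ball_prob x r" l] i K finite_J[OF i] prob_in_ball[OF i]
  by (auto simp: emeasure_eq_measure finite_subset subset_iff)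

lemma emeasure_two_counts:
  assumes i: "i < n" and K: "K \<subseteq> J i" "K \<noteq> {}" and far: "2 * r < dist x y"
  shows "emeasure M {w \<in> space M. card {j\<in>K. dist x (W j w) \<le> r} < l \<and> card {j\<in>K. dist y (W j w) \<le> r} < l}
    = ennreal (trinom_cdf (card K) l l (Q.ball_prob x r) (Q.ball_prob y r))"
proof -
  have "cball x r \<inter> cball y r = {}" by (rule disjoint_cballs[OF far])
  then show ?thesis
    using prob_two_counts[OF indep_subset[of K], of "cball x r" "cball y r" "Q.ball_prob x r" "Q.ball_prob y r" l l]
      i K finite_J[OF i] prob_in_ball[OF i]
    by (auto simp: emeasure_eq_measure finite_subset subset_iff)
qed

lemma nn_integral_if_pred:
  assumes "Measurable.pred M Pr"
  shows "(\<integral>\<^sup>+w. (if Pr w then 1 else 0) \<partial>M) = emeasure M {w \<in> space M. Pr w}"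
proof -
  have "(\<integral>\<^sup>+w. (if Pr w then 1 else 0) \<partial>M) = (\<integral>\<^sup>+w. indicator {w \<in> space M. Pr w} w \<partial>M)"
    by (intro nn_integral_cong) auto
  then show ?thesis using assms by simp
qed

lemma prob_less_V:
  assumes i: "i < n"
  shows "prob {w \<in> space M. rad m u < V i w} = emp_tail m u"
proof -
  note [simp] = finite_J[OF i]
  have Jne: "J i \<noteq> {}" using card_J[OF i] m_pos by auto
  define g where "g = (\<lambda>z :: 'a \<times> ('i \<Rightarrow> 'a). if card {j\<in>J i. dist (fst z) (snd z j) \<le> rad m u} < l then 1 else (0 :: ennreal))"
  have g: "g \<in> borel_measurable (borel \<Otimes>\<^sub>M PiM (J i) (\<lambda>_. borel))"
    unfolding g_def by measurable
  have "emeasure M {w \<in> space M. rad m u < V i w} = (\<integral>\<^sup>+w. (if rad m u < V i w then 1 else 0) \<partial>M)"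
    using i by (intro nn_integral_if_pred[symmetric]) measurable
  also have "\<dots> = (\<integral>\<^sup>+w. g (W (c i) w, \<lambda>j\<in>J i. W j w) \<partial>M)"
    by (intro nn_integral_cong) (simp add: less_V_iff[OF i] g_def cong: conj_cong)
  also have "\<dots> = (\<integral>\<^sup>+x. (\<integral>\<^sup>+w. g (x, \<lambda>j\<in>J i. W j w) \<partial>M) \<partial>P.law)"
    using nn_integral_centre_sample[OF indep centre_notin[OF i] g] by (simp add: centre_law[OF i])
  also have "\<dots> = (\<integral>\<^sup>+x. ennreal (binom_cdf m l (Q.ball_prob x (rad m u))) \<partial>P.law)"
  proof (rule nn_integral_cong)
    fix x
    have "(\<integral>\<^sup>+w. g (x, \<lambda>j\<in>J i. W j w) \<partial>M) = (\<integral>\<^sup>+w. (if card {j\<in>J i. dist x (W j w) \<le> rad m u} < l then 1 else 0) \<partial>M)"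
      by (intro nn_integral_cong) (simp add: g_def cong: conj_cong)
    also have "\<dots> = emeasure M {w \<in> space M. card {j\<in>J i. dist x (W j w) \<le> rad m u} < l}"
      by (intro nn_integral_if_pred) measurable
    also have "\<dots> = ennreal (binom_cdf m l (Q.ball_prob x (rad m u)))"
      using emeasure_count[OF i order_refl Jne] by (simp only: card_J[OF i])
    finally show "(\<integral>\<^sup>+w. g (x, \<lambda>j\<in>J i. W j w) \<partial>M) = ennreal (binom_cdf m l (Q.ball_prob x (rad m u)))" .
  qed
  also have "\<dots> = ennreal (emp_tail m u)"
    unfolding emp_tail_def
    by (intro nn_integral_eq_integral P.law.integrable_const_bound[where B=1]) (auto simp: binom_cdf_ball_bounds)
  finally show ?thesis by (simp add: emeasure_eq_measure emp_tail_bounds)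
qed

text \<open>Counting in the common set K enlarges the event and makes the sample independent of both
  centres. With the centres frozen at x and y, disjoint balls give trinomial counts.\<close>

lemma prob_less_V_pair:
  assumes i: "i < n" "i' < n" "i \<noteq> i'"
  shows "prob {w \<in> space M. rad m u < V i w \<and> rad m u < V i' w} \<le> pair_tail m u"
proof -
  obtain K where K: "K \<subseteq> J i" "K \<subseteq> J i'" "card K = m - 1" "c i \<notin> K" "c i' \<notin> K" and cc: "c i \<noteq> c i'"
    using pairs[OF i] by auto
  have fK[simp]: "finite K" using finite_J[OF i(1)] K(1) finite_subset by auto
  have Kne: "K \<noteq> {}" using K(3) m1_pos by auto
  define g where "g = (\<lambda>z :: ('a \<times> 'a) \<times> ('i \<Rightarrow> 'a). if card {j\<in>K. dist (fst (fst z)) (snd z j) \<le> rad m u} < l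
     \<and> card {j\<in>K. dist (snd (fst z)) (snd z j) \<le> rad m u} < l then 1 else (0 :: ennreal))"
  have g: "g \<in> borel_measurable ((borel \<Otimes>\<^sub>M borel) \<Otimes>\<^sub>M PiM K (\<lambda>_. borel))"
    unfolding g_def by measurable
  let ?G = "\<lambda>x y. if dist x y \<le> 2 * rad m u then 1
     else trinom_cdf (m - 1) l l (Q.ball_prob x (rad m u)) (Q.ball_prob y (rad m u))"
  have sub: "card {j\<in>K. dist (W (c i0) w) (W j w) \<le> rad m u} < l"
    if "i0 < n" "K \<subseteq> J i0" "rad m u < V i0 w" for w i0
  proof -
    have "card {j\<in>K. dist (W (c i0) w) (W j w) \<le> rad m u} \<le> card {j\<in>J i0. dist (W (c i0) w) (W j w) \<le> rad m u}"
      using that finite_J by (intro card_mono) auto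
    then show ?thesis using that less_V_iff[of i0 "rad m u" w] by linarith
  qed
  have "emeasure M {w \<in> space M. rad m u < V i w \<and> rad m u < V i' w}
     = (\<integral>\<^sup>+w. (if rad m u < V i w \<and> rad m u < V i' w then 1 else 0) \<partial>M)"
    using i by (intro nn_integral_if_pred[symmetric]) measurable
  also have "\<dots> \<le> (\<integral>\<^sup>+w. g ((W (c i) w, W (c i') w), \<lambda>j\<in>K. W j w) \<partial>M)"
    using sub[OF i(1) K(1)] sub[OF i(2) K(2)]
    by (intro nn_integral_mono) (simp add: g_def cong: conj_cong)
  also have "\<dots> = (\<integral>\<^sup>+x. \<integral>\<^sup>+y. (\<integral>\<^sup>+w. g ((x, y), \<lambda>j\<in>K. W j w) \<partial>M) \<partial>P.law \<partial>P.law)"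
    using nn_integral_two_centres_sample[OF indep K(4,5) cc g] by (simp add: centre_law i)
  also have "\<dots> \<le> (\<integral>\<^sup>+x. \<integral>\<^sup>+y. ennreal (?G x y) \<partial>P.law \<partial>P.law)"
  proof (intro nn_integral_mono)
    fix x y
    have "(\<integral>\<^sup>+w. g ((x, y), \<lambda>j\<in>K. W j w) \<partial>M)
       = (\<integral>\<^sup>+w. (if card {j\<in>K. dist x (W j w) \<le> rad m u} < l \<and> card {j\<in>K. dist y (W j w) \<le> rad m u} < l then 1 else 0) \<partial>M)"
      by (intro nn_integral_cong) (simp add: g_def cong: conj_cong)
    also have "\<dots> = emeasure M {w \<in> space M. card {j\<in>K. dist x (W j w) \<le> rad m u} < l \<and> card {j\<in>K. dist y (W j w) \<le> rad m u} < l}"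
      by (intro nn_integral_if_pred) measurable
    also have "\<dots> \<le> ennreal (?G x y)"
      using emeasure_two_counts[OF i(1) K(1) Kne, of "rad m u" x y] K(3) by (auto simp: emeasure_le_1)
    finally show "(\<integral>\<^sup>+w. g ((x, y), \<lambda>j\<in>K. W j w) \<partial>M) \<le> ennreal (?G x y)" .
  qed
  also have "\<dots> = (\<integral>\<^sup>+x. ennreal (\<integral>y. ?G x y \<partial>P.law) \<partial>P.law)"
    by (intro nn_integral_cong nn_integral_eq_integral P.law.integrable_const_bound[where B=1])
       (auto simp: pair_kernel_bounds[OF refl])
  also have "\<dots> = ennreal (pair_tail m u)"
    unfolding pair_tail_def
  proof (intro nn_integral_eq_integral P.law.integrable_const_bound[where B=1])
    have "(\<integral>y. ?G x y \<partial>P.law) \<le> (\<integral>y. 1 \<partial>P.law)" for x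
      by (intro integral_mono P.law.integrable_const_bound[where B=1]) (auto simp: pair_kernel_bounds[OF refl])
    moreover have "0 \<le> (\<integral>y. ?G x y \<partial>P.law)" for x
      by (intro Bochner_Integration.integral_nonneg pair_kernel_bounds[OF refl])
    ultimately show "AE x in P.law. norm (\<integral>y. ?G x y \<partial>P.law) \<le> 1" "AE x in P.law. 0 \<le> (\<integral>y. ?G x y \<partial>P.law)" by auto
  qed measurable
  finally show ?thesis
    by (simp add: emeasure_eq_measure pair_tail_def Bochner_Integration.integral_nonneg pair_kernel_bounds[OF refl])
qed

text \<open>If V > R, any l chosen sample points include one at distance at least V, so the excess
  is bounded by a sum over l fixed points. The other points still put fewer than l into the ball of
  radius R; as they are independent of the chosen point, this event supplies a factor that tends to
  0.\<close>

lemma nn_integral_log_V: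
  assumes i: "i < n"
  shows "(\<integral>\<^sup>+w. ennreal ((max 0 (ln (V i w / R)))\<^sup>2) \<partial>M) \<le> of_nat l * log_tail m"
proof -
  note fJ[simp] = finite_J[OF i]
  obtain J0 where J0: "J0 \<subseteq> J i" "card J0 = l" "finite J0"
    using obtain_subset_with_card_n[of l "J i"] m_gt card_J[OF i] by auto
  let ?L = "\<lambda>d. ennreal ((max 0 (ln (d / R)))\<^sup>2)"
  let ?t = "\<lambda>j w. ?L (dist (W (c i) w) (W j w)) * (if card {j'\<in>J i - {j}. dist (W (c i) w) (W j' w) \<le> R} < l then 1 else 0)"
  have "?L (V i w) \<le> (\<Sum>j\<in>J0. ?t j w)" for w
  proof (cases "V i w \<le> R")
    case True
    have "ln (V i w / R) \<le> 0"
      using True V_nonneg[OF i, of w] R_pos by (cases "V i w = 0") (auto simp: ln_le_zero_iff)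
    then show ?thesis by (simp add: max_def)
  next
    case False
    have "\<exists>j\<in>J0. V i w \<le> dist (W (c i) w) (W j w)"
    proof (rule ccontr)
      assume no: "\<not> ?thesis"
      define r where "r = Max ((\<lambda>j. dist (W (c i) w) (W j w)) ` J0)"
      have ne: "J0 \<noteq> {}" using J0 l_ge by auto
      have "r < V i w" unfolding r_def using no J0 ne by (subst Max_less_iff) auto
      moreover have "J0 \<subseteq> {j\<in>J i. dist (W (c i) w) (W j w) \<le> r}" using J0 by (auto simp: r_def)
      then have "card J0 \<le> card {j\<in>J i. dist (W (c i) w) (W j w) \<le> r}" by (intro card_mono) auto
      then have "l \<le> card {j\<in>J i. dist (W (c i) w) (W j w) \<le> r}" using J0 by simp
      ultimately show False using V_le_iff[OF i, of w r] by auto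
    qed
    then obtain j where j: "j \<in> J0" "V i w \<le> dist (W (c i) w) (W j w)" by auto
    have "card {j'\<in>J i - {j}. dist (W (c i) w) (W j' w) \<le> R} \<le> card {j'\<in>J i. dist (W (c i) w) (W j' w) \<le> R}"
      by (intro card_mono) auto
    also have "\<dots> < l" using False less_V_iff[OF i, of R w] by auto
    finally have cnt: "card {j'\<in>J i - {j}. dist (W (c i) w) (W j' w) \<le> R} < l" .
    have "ln (V i w / R) \<le> ln (dist (W (c i) w) (W j w) / R)"
      using j False R_pos by (intro ln_mono) (auto simp: divide_right_mono)
    then have "?L (V i w) \<le> ?L (dist (W (c i) w) (W j w))"
      by (intro ennreal_leI power_mono) auto
    then have "?L (V i w) \<le> ?t j w" using cnt by simp
    also have "\<dots> \<le> (\<Sum>j\<in>J0. ?t j w)" using j J0 by (intro member_le_sum) auto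
    finally show ?thesis .
  qed
  then have "(\<integral>\<^sup>+w. ?L (V i w) \<partial>M) \<le> (\<integral>\<^sup>+w. (\<Sum>j\<in>J0. ?t j w) \<partial>M)" by (intro nn_integral_mono)
  also have "\<dots> = (\<Sum>j\<in>J0. \<integral>\<^sup>+w. ?t j w \<partial>M)" by (intro nn_integral_sum) measurable
  also have "\<dots> = (\<Sum>j\<in>J0. log_tail m)"
  proof (rule sum.cong[OF refl])
    fix j assume "j \<in> J0"
    then have j: "j \<in> J i" using J0 by auto
    let ?K = "J i - {j}"
    have cK: "card ?K = m - 1" using j card_J[OF i] by simp
    then have Kne: "?K \<noteq> {}" using m1_pos by (metis card.empty less_irrefl)
    define g where "g = (\<lambda>z :: ('a \<times> 'a) \<times> ('i \<Rightarrow> 'a). ?L (dist (fst (fst z)) (snd (fst z))) *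
      (if card {j\<in>?K. dist (fst (fst z)) (snd z j) \<le> R} < l then 1 else 0))"
    have g: "g \<in> borel_measurable ((borel \<Otimes>\<^sub>M borel) \<Otimes>\<^sub>M PiM ?K (\<lambda>_. borel))"
      unfolding g_def by measurable
    have "(\<integral>\<^sup>+w. ?t j w \<partial>M) = (\<integral>\<^sup>+w. g ((W (c i) w, W j w), \<lambda>j\<in>?K. W j w) \<partial>M)"
      by (intro nn_integral_cong) (simp add: g_def cong: conj_cong)
    also have "\<dots> = (\<integral>\<^sup>+x. \<integral>\<^sup>+y. (\<integral>\<^sup>+w. g ((x, y), \<lambda>j\<in>?K. W j w) \<partial>M) \<partial>Q.law \<partial>P.law)"
      using centre_notin[OF i] j
      by (subst nn_integral_two_centres_sample[OF indep _ _ _ g]) (auto simp: centre_law[OF i] sample_law[OF i j])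
    also have "\<dots> = log_tail m"
      unfolding log_tail_def
    proof (intro nn_integral_cong)
      fix x y
      have "(\<integral>\<^sup>+w. g ((x, y), \<lambda>j\<in>?K. W j w) \<partial>M) = (\<integral>\<^sup>+w. ?L (dist x y) * (if card {j'\<in>?K. dist x (W j' w) \<le> R} < l then 1 else 0) \<partial>M)"
        by (intro nn_integral_cong) (simp add: g_def cong: conj_cong)
      also have "\<dots> = ?L (dist x y) * (\<integral>\<^sup>+w. (if card {j'\<in>?K. dist x (W j' w) \<le> R} < l then 1 else 0) \<partial>M)"
        by (rule nn_integral_cmult) measurable
      also have "(\<integral>\<^sup>+w. (if card {j'\<in>?K. dist x (W j' w) \<le> R} < l then 1 else 0) \<partial>M) = ennreal (binom_cdf (m - 1) l (Q.ball_prob x R))"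
        using emeasure_count[OF i _ Kne, of x R] cK by (subst nn_integral_if_pred) auto
      finally show "(\<integral>\<^sup>+w. g ((x, y), \<lambda>j\<in>?K. W j w) \<partial>M) = ?L (dist x y) * ennreal (binom_cdf (m - 1) l (Q.ball_prob x R))" .
    qed
    finally show "(\<integral>\<^sup>+w. ?t j w \<partial>M) = log_tail m" .
  qed
  also have "\<dots> = of_nat l * log_tail m" using J0 by simp
  finally show ?thesis .
qed

text \<open>The cut at radius R makes the integral over u an average of log distances capped at the
  level of R, the range in which the moment bounds hold.\<close>

definition near_frac :: "real \<Rightarrow> 'w \<Rightarrow> real" where
  "near_frac u w = (\<Sum>i<n. of_bool (rad m u < V i w \<and> rad m u < R)) / real n"

definition log_dist :: "nat \<Rightarrow> 'w \<Rightarrow> real" where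
  "log_dist i w = ln (real m * (unit_ball_vol (real DIM('a)) * V i w ^ DIM('a)))"

lemma near_frac_bounds: "0 \<le> near_frac u w" "near_frac u w \<le> 1"
proof -
  show "0 \<le> near_frac u w" unfolding near_frac_def by (intro divide_nonneg_nonneg sum_nonneg) auto
  have "(\<Sum>i<n. of_bool (rad m u < V i w \<and> rad m u < R) :: real) \<le> (\<Sum>i<n. 1)" by (intro sum_mono) auto
  then show "near_frac u w \<le> 1" unfolding near_frac_def using n_pos by (simp add: divide_le_eq)
qed

lemma measurable_near_frac[measurable]:
  assumes [measurable]: "u \<in> borel_measurable N" "g \<in> measurable N M"
  shows "(\<lambda>z. near_frac (u z) (g z)) \<in> borel_measurable N"
proof -
  have [measurable]: "(\<lambda>z. V i (g z)) \<in> borel_measurable N" if "i < n" for i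
    using measurable_compose[OF assms(2) V_measurable[OF that]] .
  show ?thesis unfolding near_frac_def
    by (intro borel_measurable_divide borel_measurable_sum) (auto intro!: measurable_of_bool)
qed

lemma integrable_near_frac: "integrable M (near_frac u)" "integrable M (\<lambda>w. (near_frac u w)\<^sup>2)"
  using near_frac_bounds by (auto intro!: integrable_const_bound[where B=1] simp: power_le_one_iff abs_square_le_1)

lemma expectation_of_bool:
  assumes "Measurable.pred M Pr"
  shows "expectation (\<lambda>w. of_bool (Pr w)) = prob {w \<in> space M. Pr w}"
proof -
  have "expectation (\<lambda>w. of_bool (Pr w)) = expectation (indicator {w \<in> space M. Pr w})"
    by (rule Bochner_Integration.integral_cong) auto
  also have "\<dots> = prob ({w \<in> space M. Pr w} \<inter> space M)" by simp
  also have "{w \<in> space M. Pr w} \<inter> space M = {w \<in> space M. Pr w}" by auto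
  finally show ?thesis .
qed

lemma expectation_near_frac:
  assumes u: "rad m u < R"
  shows "expectation (near_frac u) = emp_tail m u"
proof -
  have "expectation (\<lambda>w. of_bool (rad m u < V i w \<and> rad m u < R)) = emp_tail m u" if i: "i < n" for i
  proof -
    have "expectation (\<lambda>w. of_bool (rad m u < V i w \<and> rad m u < R)) = prob {w \<in> space M. rad m u < V i w}"
      using u V_measurable[OF i] by (simp add: expectation_of_bool)
    then show ?thesis by (simp add: prob_less_V[OF i])
  qed
  moreover have "integrable M (\<lambda>w. of_bool (rad m u < V i w \<and> rad m u < R) :: real)" if "i < n" for i
    using that by (intro integrable_const_bound[where B=1]) auto
  ultimately have "(\<integral>w. (\<Sum>i<n. of_bool (rad m u < V i w \<and> rad m u < R)) \<partial>M) = (\<Sum>i<n. emp_tail m u)"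
    by (subst Bochner_Integration.integral_sum) (auto intro!: sum.cong)
  then show ?thesis
    unfolding near_frac_def using n_pos by (simp del: sum_of_bool_eq)
qed

lemma pair_tail_nonneg: "0 \<le> pair_tail k u"
  unfolding pair_tail_def by (intro Bochner_Integration.integral_nonneg pair_kernel_bounds[OF refl])

lemma expectation_near_frac_square:
  assumes u: "rad m u < R"
  shows "expectation (\<lambda>w. (near_frac u w)\<^sup>2) \<le> 1 / real n + pair_tail m u"
proof -
  let ?E = "\<lambda>i j w. of_bool (rad m u < V i w \<and> rad m u < V j w) :: real"
  have int: "integrable M (?E i j)" if "i < n" "j < n" for i j
    using that by (intro integrable_const_bound[where B=1]) auto
  \<comment> \<open>On the diagonal the bound 1 is used; adding \<open>pair_tail\<close> there too
    is a harmless excess that makes all n^2 terms uniform.\<close>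
  have E: "expectation (?E i j) \<le> (if i = j then 1 else 0) + pair_tail m u" if ij: "i < n" "j < n" for i j
  proof -
    have "expectation (?E i j) = prob {w \<in> space M. rad m u < V i w \<and> rad m u < V j w}"
      using ij by (intro expectation_of_bool) measurable
    also have "\<dots> \<le> (if i = j then 1 else 0) + pair_tail m u"
      using prob_less_V_pair[OF ij] pair_tail_nonneg[of m u] by (auto intro: order_trans[OF prob_le_1])
    finally show ?thesis .
  qed
  have "(near_frac u w)\<^sup>2 = (\<Sum>i<n. \<Sum>j<n. ?E i j w) / (real n)\<^sup>2" for w
  proof -
    have "(\<Sum>i<n. of_bool (rad m u < V i w \<and> rad m u < R) :: real)\<^sup>2 = (\<Sum>i<n. \<Sum>j<n. ?E i j w)"
      unfolding power2_eq_square sum_product using u by (intro sum.cong refl) (simp add: of_bool_conj)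
    then show ?thesis by (simp only: near_frac_def power_divide)
  qed
  then have "expectation (\<lambda>w. (near_frac u w)\<^sup>2) = expectation (\<lambda>w. \<Sum>i<n. \<Sum>j<n. ?E i j w) / (real n)\<^sup>2"
    by (simp only: integral_divide_zero)
  moreover have "expectation (\<lambda>w. \<Sum>i<n. \<Sum>j<n. ?E i j w) = (\<Sum>i<n. expectation (\<lambda>w. \<Sum>j<n. ?E i j w))"
    by (rule Bochner_Integration.integral_sum) (use int in \<open>intro Bochner_Integration.integrable_sum, simp\<close>)
  moreover have "\<dots> = (\<Sum>i<n. \<Sum>j<n. expectation (?E i j))"
    by (intro sum.cong refl Bochner_Integration.integral_sum) (use int in simp)
  ultimately have "expectation (\<lambda>w. (near_frac u w)\<^sup>2) = (\<Sum>i<n. \<Sum>j<n. expectation (?E i j)) / (real n)\<^sup>2"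
    by (simp only:)
  also have "\<dots> \<le> (\<Sum>i<n. \<Sum>j<n. (if i = j then 1 else 0) + pair_tail m u) / (real n)\<^sup>2"
    using E by (intro divide_right_mono sum_mono) auto
  also have "\<dots> = 1 / real n + pair_tail m u"
    using n_pos by (simp add: sum.distrib field_simps power2_eq_square)
  finally show ?thesis .
qed

lemma expectation_near_frac_deviation:
  shows "expectation (\<lambda>w. (near_frac u w - lim_tail u)\<^sup>2)
    \<le> min (tail_bound u) (1 / real n) + (if rad m u < R then min (tail_bound u) (tail_gap m u) else tail_bound u)"
proof -
  note h = lim_tail_bounds[of u]
  have tb: "2 * ((real l)\<^sup>2 * CT * exp (- \<epsilon> * \<bar>u\<bar>)) \<le> tail_bound u" "2 * (CQ * exp (- \<epsilon> * \<bar>u\<bar>)) \<le> tail_bound u"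
    using C_nonneg by (auto simp: tail_bound_def distrib_left distrib_right)
  \<comment> \<open>Trades the square for a sum of two tails with the same exponential bound, whence
    the factor 2 in \<open>tail_bound\<close>. For negative u it is applied to the complements 1 - S
    and 1 - h.\<close>
  have sq: "(a - b)\<^sup>2 \<le> a + b" if "0 \<le> a" "a \<le> 1" "0 \<le> b" "b \<le> (1::real)" for a b
  proof -
    have "\<bar>a - b\<bar> * \<bar>a - b\<bar> \<le> 1 * \<bar>a - b\<bar>" using that by (intro mult_right_mono) auto
    then have "(a - b)\<^sup>2 \<le> \<bar>a - b\<bar>" by (simp add: power2_eq_square)
    also have "\<dots> \<le> a + b" using that by auto
    finally show ?thesis .
  qed
  \<comment> \<open>Separates the dependence on n from that on the sample size while both parts stay
    dominated by the integrable bound.\<close>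
  have split_min: "e \<le> min a b + min a c" if "e \<le> b + c" "e \<le> a" "0 \<le> a" "0 \<le> b" "0 \<le> c" for a b c e :: real
    using that by (auto simp: min_def)
  have i0: "integrable M (\<lambda>w. (near_frac u w - lim_tail u)\<^sup>2)"
    using integrable_near_frac[of u] by (simp add: power2_diff)
  show ?thesis
  proof (cases "rad m u < R")
    case False
    \<comment> \<open>The cut fraction is 0 here, so the deviation is h^2 \<le> h, and
      \<open>lim_tail_le\<close> gives the decay in the absolute value of u only for nonnegative
      u.\<close>
    have u: "0 \<le> u"
    proof (rule ccontr)
      assume "\<not> 0 \<le> u"
      then have "rad m u < R" using rad_0 rad_less_iff[OF m_pos R_pos] by auto
      then show False using False by simp
    qed
    have "(near_frac u w - lim_tail u)\<^sup>2 = (lim_tail u)\<^sup>2" for w using False by (simp add: near_frac_def)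
    then have "expectation (\<lambda>w. (near_frac u w - lim_tail u)\<^sup>2) = (lim_tail u)\<^sup>2" by (simp add: prob_space)
    also have "\<dots> \<le> lim_tail u" using h by (simp add: power2_eq_square mult_left_le_one_le)
    also have "\<dots> \<le> tail_bound u" using lim_tail_le[of u] tb(1) u h by simp
    also have "\<dots> \<le> min (tail_bound u) (1 / real n) + tail_bound u" using tail_bound_nonneg[of u] by simp
    finally show ?thesis using False by simp
  next
    case True
    note E = expectation_near_frac[OF True]
    have "expectation (\<lambda>w. (near_frac u w - lim_tail u)\<^sup>2) = expectation (\<lambda>w. (near_frac u w)\<^sup>2) - 2 * lim_tail u * emp_tail m u + (lim_tail u)\<^sup>2"
      using integrable_near_frac[of u] E by (simp add: power2_diff prob_space mult_ac)
    also have "\<dots> \<le> 1 / real n + tail_gap m u"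
      using expectation_near_frac_square[OF True] by (simp add: tail_gap_def)
    finally have A: "expectation (\<lambda>w. (near_frac u w - lim_tail u)\<^sup>2) \<le> 1 / real n + tail_gap m u" .
    have B: "expectation (\<lambda>w. (near_frac u w - lim_tail u)\<^sup>2) \<le> tail_bound u"
    proof (cases "0 \<le> u")
      case u: True
      have "expectation (\<lambda>w. (near_frac u w - lim_tail u)\<^sup>2) \<le> expectation (\<lambda>w. near_frac u w + lim_tail u)"
        using near_frac_bounds h integrable_near_frac[of u] i0 by (intro integral_mono sq) auto
      also have "\<dots> = emp_tail m u + lim_tail u" using integrable_near_frac[of u] E by (simp add: prob_space)
      also have "\<dots> \<le> tail_bound u"
        using emp_tail_le[OF m_pos, of u] lim_tail_le[of u] tb(1) u True by simp
      finally show ?thesis .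
    next
      case u: False
      have "expectation (\<lambda>w. (near_frac u w - lim_tail u)\<^sup>2) = expectation (\<lambda>w. ((1 - near_frac u w) - (1 - lim_tail u))\<^sup>2)"
        by (simp add: power2_commute)
      also have "\<dots> \<le> expectation (\<lambda>w. (1 - near_frac u w) + (1 - lim_tail u))"
        using near_frac_bounds h integrable_near_frac[of u] i0 by (intro integral_mono sq) (auto simp: power2_commute)
      also have "\<dots> = (1 - emp_tail m u) + (1 - lim_tail u)" using integrable_near_frac[of u] E by (simp add: prob_space)
      also have "\<dots> \<le> tail_bound u"
        using one_minus_emp_tail_le[OF m_pos, of u] one_minus_lim_tail_le[of u] tb(2) u True by simp
      finally show ?thesis .
    qed
    have "0 \<le> tail_gap m u" "0 \<le> 1 / real n" by (simp_all add: tail_gap_def)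
    then show ?thesis using A B True tail_bound_nonneg[of u] split_min by simp
  qed
qed

lemma nn_integral_weighted_deviation:
  "(\<integral>\<^sup>+w. \<integral>\<^sup>+u. ennreal (weight u * (near_frac u w - lim_tail u)\<^sup>2) \<partial>lborel \<partial>M) \<le> rate_n n + rate_m m"
proof -
  interpret LM: pair_sigma_finite "lborel :: real measure" M ..
  have "(\<integral>\<^sup>+w. \<integral>\<^sup>+u. ennreal (weight u * (near_frac u w - lim_tail u)\<^sup>2) \<partial>lborel \<partial>M)
    = (\<integral>\<^sup>+u. \<integral>\<^sup>+w. ennreal (weight u * (near_frac u w - lim_tail u)\<^sup>2) \<partial>M \<partial>lborel)"
    by (rule LM.Fubini') measurable
  also have "\<dots> \<le> (\<integral>\<^sup>+u. ennreal (weight u * min (tail_bound u) (1 / real n))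
     + ennreal (weight u * (if rad m u < R then min (tail_bound u) (tail_gap m u) else tail_bound u)) \<partial>lborel)"
  proof (rule nn_integral_mono)
    fix u
    let ?t = "if rad m u < R then min (tail_bound u) (tail_gap m u) else tail_bound u"
    have i0: "integrable M (\<lambda>w. (near_frac u w - lim_tail u)\<^sup>2)"
      using integrable_near_frac[of u] by (simp add: power2_diff)
    have "(\<integral>\<^sup>+w. ennreal (weight u * (near_frac u w - lim_tail u)\<^sup>2) \<partial>M) = ennreal (weight u * expectation (\<lambda>w. (near_frac u w - lim_tail u)\<^sup>2))"
      using i0 less_imp_le[OF weight_pos] by (subst nn_integral_eq_integral) auto
    also have "\<dots> \<le> ennreal (weight u * (min (tail_bound u) (1 / real n) + ?t))"
      by (intro ennreal_leI mult_left_mono expectation_near_frac_deviation less_imp_le[OF weight_pos])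
    also have "\<dots> = ennreal (weight u * min (tail_bound u) (1 / real n)) + ennreal (weight u * ?t)"
      using tail_bound_nonneg[of u] less_imp_le[OF weight_pos[of u]]
      by (subst ennreal_plus[symmetric]) (auto simp: distrib_left tail_gap_def)
    finally show "(\<integral>\<^sup>+w. ennreal (weight u * (near_frac u w - lim_tail u)\<^sup>2) \<partial>M)
      \<le> ennreal (weight u * min (tail_bound u) (1 / real n)) + ennreal (weight u * ?t)" .
  qed
  also have "\<dots> = rate_n n + rate_m m"
    unfolding rate_n_def rate_m_def by (rule nn_integral_add) measurable
  finally show ?thesis .
qed

text \<open>Excludes the conventional value \<open>ln 0 = 0\<close>, which would break the
  translation of radii into thresholds. A zero distance has probability at most
  \<open>1 - emp_tail m u\<close> for every u \<le> 0, and the bound on this vanishes as u tends to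
  minus infinity.\<close>

lemma AE_V_pos: "AE w in M. \<forall>i<n. 0 < V i w"
proof -
  have "AE w in M. 0 < V i w" if i: "i < n" for i
  proof -
    note [measurable] = V_measurable[OF i]
    have "prob {w \<in> space M. V i w \<le> 0} \<le> CQ * exp (\<epsilon> * u)" if u: "u \<le> 0" for u
    proof -
      have r: "rad m u \<le> R" using rad_0 u unfolding rad_less_iff[OF m_pos R_pos] by (intro less_imp_le) (simp only: rad_less_iff[OF m_pos R_pos])
      have "prob {w \<in> space M. V i w \<le> 0} \<le> prob (space M - {w \<in> space M. rad m u < V i w})"
        using rad_pos[OF m_pos, of u] by (intro finite_measure_mono) auto
      also have "\<dots> = 1 - emp_tail m u"
        by (subst prob_compl) (auto simp: prob_less_V[OF i])
      also have "\<dots> \<le> CQ * exp (\<epsilon> * u)" by (rule one_minus_emp_tail_le[OF m_pos r])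
      finally show ?thesis .
    qed
    moreover have "LIM u at_bot. \<epsilon> * u :> at_bot"
      by (rule filterlim_tendsto_pos_mult_at_bot[OF tendsto_const eps(1) filterlim_ident])
    then have "((\<lambda>u. CQ * exp (\<epsilon> * u)) \<longlongrightarrow> CQ * 0) at_bot"
      by (intro tendsto_intros filterlim_compose[OF exp_at_bot])
    then have "((\<lambda>u. CQ * exp (\<epsilon> * u)) \<longlongrightarrow> 0) at_bot" by simp
    ultimately have "prob {w \<in> space M. V i w \<le> 0} \<le> 0"
      by (intro tendsto_lowerbound[of "\<lambda>u. CQ * exp (\<epsilon> * u)" 0 at_bot]) (auto intro: eventually_mono[OF eventually_le_at_bot[of 0]])
    then have "prob {w \<in> space M. V i w \<le> 0} = 0" by (simp add: measure_le_0_iff)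
    then have "AE w in M. \<not> V i w \<le> 0" by (subst (asm) prob_eq_0) auto
    then show ?thesis by (auto simp: not_le)
  qed
  then show ?thesis by (simp add: AE_all_countable AE_ball_countable)
qed

text \<open>With \<open>uR\<close> the level of radius R, the step integral of index i is
  \<open>min (log_dist i w) uR\<close>, and what exceeds \<open>uR\<close> is d times the positive
  part of ln (V / R). The steps at 0 cancel against those in
  \<open>lim_tail_integral\<close>.\<close>

lemma log_dist_split:
  assumes V: "\<forall>i<n. 0 < V i w"
  shows "integrable lborel (\<lambda>u. near_frac u w - lim_tail u)"
    and "(\<Sum>i<n. log_dist i w) / real n - lim_const
      = (\<integral>u. (near_frac u w - lim_tail u) \<partial>lborel) + real DIM('a) * ((\<Sum>i<n. max 0 (ln (V i w / R))) / real n)"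
proof -
  define uR where "uR = ln (real m * (unit_ball_vol (real DIM('a)) * R ^ DIM('a)))"
  have le: "rad m u < V i w \<and> rad m u < R \<longleftrightarrow> u < min (log_dist i w) uR" if "i < n" for i u
    using V that R_pos m_pos by (auto simp: rad_less_iff log_dist_def uR_def)
  define s where "s i u = (of_bool (u < min (log_dist i w) uR) - of_bool (u < 0) :: real)" for i u
  have s: "integrable lborel (s i)" "(\<integral>u. s i u \<partial>lborel) = min (log_dist i w) uR" for i
    unfolding s_def by (rule step_integral)+
  have fr: "near_frac u w - of_bool (u < 0) = (\<Sum>i<n. s i u) / real n" for u
  proof -
    have "near_frac u w = (\<Sum>i<n. of_bool (u < min (log_dist i w) uR)) / real n"
      unfolding near_frac_def using le by (intro arg_cong2[where f="(/)"] sum.cong) auto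
    then show ?thesis using n_pos unfolding s_def sum_subtractf by (simp add: diff_divide_distrib)
  qed
  have i1: "integrable lborel (\<lambda>u. near_frac u w - of_bool (u < 0))"
    unfolding fr by (intro Bochner_Integration.integrable_divide Bochner_Integration.integrable_sum s)
  have e1: "(\<integral>u. (near_frac u w - of_bool (u < 0)) \<partial>lborel) = (\<Sum>i<n. min (log_dist i w) uR) / real n"
    unfolding fr using s by (simp add: Bochner_Integration.integral_sum)
  have d: "(near_frac u w - of_bool (u < 0)) - (lim_tail u - of_bool (u < 0)) = near_frac u w - lim_tail u" for u by simp
  show "integrable lborel (\<lambda>u. near_frac u w - lim_tail u)"
    using Bochner_Integration.integrable_diff[OF i1 lim_tail_integral(1)] unfolding d .
  have e2: "(\<integral>u. (near_frac u w - lim_tail u) \<partial>lborel) = (\<Sum>i<n. min (log_dist i w) uR) / real n - lim_const"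
    using Bochner_Integration.integral_diff[OF i1 lim_tail_integral(1)] unfolding d e1 lim_tail_integral(2) .
  have "log_dist i w = min (log_dist i w) uR + real DIM('a) * max 0 (ln (V i w / R))" if i: "i < n" for i
  proof -
    have Vi: "0 < V i w" using V i by auto
    have eq: "log_dist i w - uR = real DIM('a) * ln (V i w / R)"
      using Vi R_pos m_pos
      by (simp add: log_dist_def uR_def ln_mult ln_div ln_realpow right_diff_distrib)
    show ?thesis
    proof (cases "0 \<le> ln (V i w / R)")
      case True
      then have "0 \<le> real DIM('a) * ln (V i w / R)" by simp
      then have "uR \<le> log_dist i w" using eq by linarith
      then show ?thesis using eq True by simp
    next
      case False
      then have "real DIM('a) * ln (V i w / R) < 0" by (intro mult_pos_neg) auto
      then have "log_dist i w < uR" using eq by linarith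
      then show ?thesis using False by simp
    qed
  qed
  then have "(\<Sum>i<n. log_dist i w) = (\<Sum>i<n. min (log_dist i w) uR) + real DIM('a) * (\<Sum>i<n. max 0 (ln (V i w / R)))"
    unfolding sum_distrib_left sum.distrib[symmetric] by (intro sum.cong) auto
  then show "(\<Sum>i<n. log_dist i w) / real n - lim_const
      = (\<integral>u. (near_frac u w - lim_tail u) \<partial>lborel) + real DIM('a) * ((\<Sum>i<n. max 0 (ln (V i w / R))) / real n)"
    unfolding e2 by (simp add: add_divide_distrib)
qed

theorem log_dist_mean_square:
  "(\<integral>\<^sup>+w. ennreal (((\<Sum>i<n. log_dist i w) / real n - lim_const)\<^sup>2) \<partial>M)
    \<le> 2 * weight_mass * (rate_n n + rate_m m) + of_nat (2 * DIM('a)\<^sup>2 * l) * log_tail m"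
proof -
  let ?L = "\<lambda>i w. (max 0 (ln (V i w / R)))\<^sup>2"
  let ?D = "\<lambda>w. \<integral>\<^sup>+u. ennreal (weight u * (near_frac u w - lim_tail u)\<^sup>2) \<partial>lborel"
  have [measurable]: "i \<in> {..<n} \<Longrightarrow> V i \<in> borel_measurable M" for i using V_measurable by auto
  have "AE w in M. ennreal (((\<Sum>i<n. log_dist i w) / real n - lim_const)\<^sup>2)
     \<le> 2 * weight_mass * ?D w + ennreal (2 * (real DIM('a))\<^sup>2 / real n) * (\<Sum>i<n. ennreal (?L i w))"
    using AE_V_pos
  proof eventually_elim
    case (elim w)
    define A where "A = (\<integral>u. (near_frac u w - lim_tail u) \<partial>lborel)"
    define B where "B = real DIM('a) * ((\<Sum>i<n. max 0 (ln (V i w / R))) / real n)"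
    have "B\<^sup>2 = (real DIM('a))\<^sup>2 * ((\<Sum>i<n. max 0 (ln (V i w / R)))\<^sup>2 / (real n)\<^sup>2)"
      by (simp add: B_def power_mult_distrib power_divide)
    also have "\<dots> \<le> (real DIM('a))\<^sup>2 * ((\<Sum>i<n. ?L i w) * real n / (real n)\<^sup>2)"
      using sum_squared_le_sum_of_squares[of "\<lambda>i. max 0 (ln (V i w / R))" "{..<n}"]
      by (intro mult_left_mono divide_right_mono) auto
    also have "\<dots> = (real DIM('a))\<^sup>2 / real n * (\<Sum>i<n. ?L i w)" using n_pos by (simp add: power2_eq_square)
    finally have B: "B\<^sup>2 \<le> (real DIM('a))\<^sup>2 / real n * (\<Sum>i<n. ?L i w)" .
    have "((\<Sum>i<n. log_dist i w) / real n - lim_const)\<^sup>2 = (A + B)\<^sup>2"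
      using log_dist_split(2)[OF elim] by (simp add: A_def B_def)
    also have "\<dots> \<le> 2 * A\<^sup>2 + 2 * B\<^sup>2"
      using sum_squares_bound[of A B] by (simp add: power2_sum)
    also have "\<dots> \<le> 2 * A\<^sup>2 + 2 * (real DIM('a))\<^sup>2 / real n * (\<Sum>i<n. ?L i w)" using B by simp
    finally have "ennreal (((\<Sum>i<n. log_dist i w) / real n - lim_const)\<^sup>2)
      \<le> ennreal (2 * A\<^sup>2 + 2 * (real DIM('a))\<^sup>2 / real n * (\<Sum>i<n. ?L i w))" by (rule ennreal_leI)
    also have "\<dots> = 2 * ennreal (A\<^sup>2) + ennreal (2 * (real DIM('a))\<^sup>2 / real n) * (\<Sum>i<n. ennreal (?L i w))"
    proof -
      have 1: "ennreal (2 * A\<^sup>2) = 2 * ennreal (A\<^sup>2)" by (simp add: ennreal_mult)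
      have 2: "ennreal (2 * (real DIM('a))\<^sup>2 / real n * (\<Sum>i<n. ?L i w)) = ennreal (2 * (real DIM('a))\<^sup>2 / real n) * (\<Sum>i<n. ennreal (?L i w))"
        by (subst ennreal_mult) (auto simp: sum_nonneg)
      have "ennreal (2 * A\<^sup>2 + 2 * (real DIM('a))\<^sup>2 / real n * (\<Sum>i<n. ?L i w)) = ennreal (2 * A\<^sup>2) + ennreal (2 * (real DIM('a))\<^sup>2 / real n * (\<Sum>i<n. ?L i w))"
        by (rule ennreal_plus) (auto intro!: divide_nonneg_nonneg mult_nonneg_nonneg sum_nonneg)
      then show ?thesis unfolding 1 2 .
    qed
    also have "\<dots> \<le> 2 * (weight_mass * ?D w) + ennreal (2 * (real DIM('a))\<^sup>2 / real n) * (\<Sum>i<n. ennreal (?L i w))"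
      unfolding A_def by (intro add_right_mono mult_left_mono square_integral_le log_dist_split(1)[OF elim]) auto
    finally show ?case by (simp add: mult.assoc)
  qed
  then have "(\<integral>\<^sup>+w. ennreal (((\<Sum>i<n. log_dist i w) / real n - lim_const)\<^sup>2) \<partial>M)
    \<le> (\<integral>\<^sup>+w. 2 * weight_mass * ?D w + ennreal (2 * (real DIM('a))\<^sup>2 / real n) * (\<Sum>i<n. ennreal (?L i w)) \<partial>M)"
    by (rule nn_integral_mono_AE)
  also have "\<dots> = 2 * weight_mass * (\<integral>\<^sup>+w. ?D w \<partial>M) + ennreal (2 * (real DIM('a))\<^sup>2 / real n) * (\<Sum>i<n. \<integral>\<^sup>+w. ennreal (?L i w) \<partial>M)"
    by (subst nn_integral_add, measurable) (simp add: nn_integral_cmult nn_integral_sum del: sum_ennreal)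
  also have "\<dots> \<le> 2 * weight_mass * (rate_n n + rate_m m) + ennreal (2 * (real DIM('a))\<^sup>2 / real n) * (\<Sum>i<n. of_nat l * log_tail m)"
    by (intro add_mono mult_left_mono nn_integral_weighted_deviation sum_mono nn_integral_log_V) auto
  also have "ennreal (2 * (real DIM('a))\<^sup>2 / real n) * (\<Sum>i<n. of_nat l * log_tail m) = of_nat (2 * DIM('a)\<^sup>2 * l) * log_tail m"
  proof -
    have "ennreal (2 * (real DIM('a))\<^sup>2 / real n) * of_nat n = of_nat (2 * DIM('a)\<^sup>2)"
      using n_pos by (simp add: ennreal_of_nat_eq_real_of_nat ennreal_mult[symmetric])
    then have "ennreal (2 * (real DIM('a))\<^sup>2 / real n) * (of_nat n * (of_nat l * log_tail m)) = of_nat (2 * DIM('a)\<^sup>2) * (of_nat l * log_tail m)"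
      by (simp only: mult.assoc[symmetric])
    then show ?thesis by (simp add: mult.assoc)
  qed
  finally show ?thesis .
qed

lemma mean_square_bound:
  "(\<integral>\<^sup>+w. ennreal (((\<Sum>i<n. ln (real m * (unit_ball_vol (real DIM('a)) * V i w ^ DIM('a)))) / real n - lim_const)\<^sup>2) \<partial>M)
    \<le> err_n n + err_m m"
  using log_dist_mean_square
  by (simp add: log_dist_def err_n_def err_m_def distrib_left add.assoc)

end

section \<open>The functionals of the theorem\<close>

lemma (in prob_density) I_avg_eq: "0 < r \<Longrightarrow> I_avg f x r = ennreal (ball_avg x r)"
proof -
  assume r: "0 < r"
  have "(\<integral>\<^sup>+y\<in>cball x r. ennreal (f y) \<partial>lborel) = emeasure law (cball x r)"
    unfolding law_def by (rule emeasure_density[symmetric]) auto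
  also have "\<dots> = ennreal (ball_prob x r)" by (simp add: ball_prob_def law.emeasure_eq_measure)
  finally show ?thesis
    using r unfolding I_avg_def ball_avg_def by (simp add: divide_ennreal content_cball mult.commute)
qed

lemma nn_integral_law:
  assumes "prob_density p" and [measurable]: "g \<in> borel_measurable borel"
  shows "(\<integral>\<^sup>+x. g x \<partial>prob_density.law p) = (\<integral>\<^sup>+x. ennreal (p x) * g x \<partial>lborel)"
proof -
  interpret prob_density p by fact
  show ?thesis unfolding law_def by (rule nn_integral_density) auto
qed

text \<open>\<open>H\<close> need not be measurable, so the integral of \<open>1 + H\<close> could not be split into a sum.\<close>

lemma (in prob_density) nn_integral_law_le:
  assumes g[measurable]: "g \<in> borel_measurable borel" and H: "\<And>x. g x - 1 \<le> H x"
  shows "(\<integral>\<^sup>+x. g x \<partial>law) \<le> 1 + (\<integral>\<^sup>+x. H x * ennreal (f x) \<partial>lborel)"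
proof -
  have le: "z \<le> 1 + (z - 1)" for z :: ennreal
  proof (cases "1 \<le> z")
    case True
    then show ?thesis by (simp add: add_diff_inverse_ennreal)
  next
    case False
    then have "z \<le> 1" by simp
    also have "1 \<le> 1 + (z - 1)" by simp
    finally show ?thesis .
  qed
  have "(\<integral>\<^sup>+x. g x \<partial>law) \<le> (\<integral>\<^sup>+x. 1 + (g x - 1) \<partial>law)" by (intro nn_integral_mono le)
  also have "\<dots> = 1 + (\<integral>\<^sup>+x. g x - 1 \<partial>law)"
    using law.emeasure_space_1 by (subst nn_integral_add) auto
  also have "(\<integral>\<^sup>+x. g x - 1 \<partial>law) = (\<integral>\<^sup>+x. ennreal (f x) * (g x - 1) \<partial>lborel)"
    unfolding law_def by (rule nn_integral_density) auto
  also have "\<dots> \<le> (\<integral>\<^sup>+x. H x * ennreal (f x) \<partial>lborel)"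
    by (intro nn_integral_mono) (subst mult.commute, rule mult_right_mono[OF H], simp)
  finally show ?thesis by (simp add: add_left_mono)
qed

text \<open>Lowers an exponent at the cost of an additive 1, so that one \<epsilon> can serve both
  functionals.\<close>

lemma powr_le_one_plus_powr:
  fixes a b e e' :: real
  assumes "0 \<le> a" "a \<le> b" "0 < e" "e \<le> e'"
  shows "a powr e \<le> 1 + b powr e'"
proof (cases "a \<le> 1")
  case True
  then have "a powr e \<le> 1" using assms by (simp add: powr_le1)
  then show ?thesis using powr_ge_zero[of b e'] by linarith
next
  case False
  then have "a powr e \<le> a powr e'" using assms by (intro powr_mono) auto
  also have "\<dots> \<le> b powr e'" using assms by (intro powr_mono2) auto
  finally show ?thesis by simp
qed

section \<open>Iterated logarithms and the logarithmic second moment\<close>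

lemma e_iter_Suc: "e_iter (Suc N) = exp (e_iter N)"
  by (simp add: e_iter_def)

lemma e_iter_ge_1: "1 \<le> e_iter N"
proof (induction N)
  case (Suc N)
  have "1 + e_iter N \<le> exp (e_iter N)" by (rule exp_ge_add_one_self)
  then show ?case using Suc by (simp add: e_iter_Suc)
qed (simp add: e_iter_def)

lemma e_iter_le_Suc: "e_iter N \<le> e_iter (Suc N)"
  using exp_ge_add_one_self[of "e_iter N"] unfolding e_iter_Suc by linarith

lemma log_iter_ge_1: "e_iter N \<le> t \<Longrightarrow> 1 \<le> log_iter N t"
proof (induction N arbitrary: t)
  case (Suc N)
  have t: "0 < t" using Suc.prems e_iter_ge_1[of "Suc N"] by linarith
  have "exp (e_iter N) \<le> exp (ln t)" using Suc.prems t by (simp add: e_iter_Suc)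
  then have "e_iter N \<le> ln t" by simp
  then have "1 \<le> log_iter N (ln t)" by (rule Suc.IH)
  then show ?case by (simp add: log_iter_def funpow_swap1)
qed (simp add: e_iter_def log_iter_def)

text \<open>Beyond \<open>exp (e_iter N)\<close> the squared logarithm exceeds
  \<open>e_iter N\<close>, so the iterated logarithm in G is at least 1.\<close>

lemma square_ln_le_G_fun:
  assumes d: "exp (e_iter N) < d" and N: "1 \<le> N"
  shows "(ln d)\<^sup>2 \<le> G_fun N (\<bar>ln d\<bar> powr 2)"
proof -
  have ln: "e_iter N < ln d"
    using d by (metis exp_gt_zero exp_less_cancel_iff exp_ln less_trans)
  have l1: "1 < ln d" using ln e_iter_ge_1[of N] by linarith
  have "ln d * 1 \<le> ln d * ln d" using l1 by (intro mult_left_mono) auto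
  then have t: "e_iter N < (ln d)\<^sup>2" using ln by (simp add: power2_eq_square)
  have "e_iter (N - 1) < (ln d)\<^sup>2" using t e_iter_le_Suc[of "N - 1"] N by simp
  then have "G_fun N ((ln d)\<^sup>2) = (ln d)\<^sup>2 * log_iter N ((ln d)\<^sup>2)" by (simp add: G_fun_def)
  moreover have "(ln d)\<^sup>2 * 1 \<le> (ln d)\<^sup>2 * log_iter N ((ln d)\<^sup>2)"
    using log_iter_ge_1[of N "(ln d)\<^sup>2"] t by (intro mult_left_mono) auto
  ultimately show ?thesis using l1 by simp
qed

lemma log_moment_finite:
  fixes p f :: "'a::euclidean_space \<Rightarrow> real"
  assumes "prob_density p" "prob_density f" and K: "K_fun p f 2 N < \<infinity>" and N: "1 \<le> N" and R: "0 < R"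
  shows "(\<integral>\<^sup>+x. \<integral>\<^sup>+y. ennreal ((max 0 (ln (dist x y / R)))\<^sup>2) \<partial>prob_density.law f \<partial>prob_density.law p) < \<infinity>"
proof -
  interpret P: prob_density p by fact
  interpret Q: prob_density f by fact
  \<comment> \<open>\<open>L\<close> is the threshold of \<open>square_ln_le_G_fun\<close>. The
    first part of \<open>c\<close> absorbs all distances up to \<open>L\<close>, the second the
    passage from ln (d / R) to ln d.\<close>
  define L where "L = exp (e_iter N)"
  define c where "c = (max 0 (ln (L / R)))\<^sup>2 + 2 * (ln R)\<^sup>2"
  define \<phi> where "\<phi> x y = (max 0 (ln (dist x y / R)))\<^sup>2" for x y :: 'a
  \<comment> \<open>A Borel function below the integrand of K: sums of integrals are split with
    \<psi>, while G enters through a pointwise comparison.\<close>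
  define \<psi> where "\<psi> x y = max 0 ((\<phi> x y - c) / 2)" for x y :: 'a
  have [measurable]: "(\<lambda>(x, y). \<phi> x y) \<in> borel_measurable (borel \<Otimes>\<^sub>M borel)"
    unfolding \<phi>_def by measurable
  have [measurable]: "(\<lambda>(x, y). \<psi> x y) \<in> borel_measurable (borel \<Otimes>\<^sub>M borel)"
    unfolding \<psi>_def by measurable
  have c0: "0 \<le> c" by (simp add: c_def)
  have psi_nonneg: "0 \<le> \<psi> x y" for x y by (simp add: \<psi>_def)
  have psi: "\<psi> x y \<le> (if e_iter N < norm (x - y) then G_fun N (\<bar>ln (norm (x - y))\<bar> powr 2) else 0)"
    if "L < dist x y" for x y
  proof -
    let ?d = "dist x y"
    have d: "0 < ?d" using that by (auto simp: L_def intro: less_trans[OF exp_gt_zero])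
    have "\<phi> x y \<le> (ln (?d / R))\<^sup>2" by (simp add: \<phi>_def max_def)
    also have "\<dots> = (ln ?d - ln R)\<^sup>2" using d R by (simp add: ln_div)
    also have "\<dots> \<le> 2 * (ln ?d)\<^sup>2 + 2 * (ln R)\<^sup>2"
      using zero_le_power2[of "ln ?d + ln R"] by (simp add: power2_sum power2_diff)
    finally have "\<phi> x y - c \<le> 2 * (ln ?d)\<^sup>2"
      using zero_le_power2[of "max 0 (ln (L / R))"] unfolding c_def by linarith
    then have "\<psi> x y \<le> (ln ?d)\<^sup>2" by (simp add: \<psi>_def)
    also have "\<dots> \<le> G_fun N (\<bar>ln ?d\<bar> powr 2)"
      using that N by (intro square_ln_le_G_fun) (auto simp: L_def)
    finally show ?thesis
      using that e_iter_le_Suc[of N] by (simp add: L_def dist_norm e_iter_Suc)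
  qed
  have psi0: "\<psi> x y = 0" if "\<not> L < dist x y" for x y
  proof -
    have "ln (dist x y / R) \<le> max 0 (ln (L / R))"
    proof (cases "dist x y = 0")
      case False
      then have "ln (dist x y / R) \<le> ln (L / R)"
        using that R by (intro ln_mono divide_right_mono divide_pos_pos) auto
      then show ?thesis by simp
    qed simp
    then have "max 0 (ln (dist x y / R)) \<le> max 0 (ln (L / R))" by simp
    then have "\<phi> x y \<le> (max 0 (ln (L / R)))\<^sup>2" unfolding \<phi>_def by (intro power_mono) auto
    also have "\<dots> \<le> c" by (simp add: c_def)
    finally show ?thesis by (simp add: \<psi>_def)
  qed
  have Kle: "(\<integral>\<^sup>+x. \<integral>\<^sup>+y. ennreal (\<psi> x y) \<partial>Q.law \<partial>P.law) \<le> K_fun p f 2 N"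
  proof -
    have "(\<integral>\<^sup>+x. \<integral>\<^sup>+y. ennreal (\<psi> x y) \<partial>Q.law \<partial>P.law)
      = (\<integral>\<^sup>+x. ennreal (p x) * (\<integral>\<^sup>+y. ennreal (f y) * ennreal (\<psi> x y) \<partial>lborel) \<partial>lborel)"
      using assms(1,2) by (simp add: nn_integral_law)
    also have "\<dots> = (\<integral>\<^sup>+x. \<integral>\<^sup>+y. ennreal (p x) * (ennreal (f y) * ennreal (\<psi> x y)) \<partial>lborel \<partial>lborel)"
      by (intro nn_integral_cong nn_integral_cmult[symmetric]) measurable
    also have "\<dots> \<le> K_fun p f 2 N"
      unfolding K_fun_def
    proof (intro nn_integral_mono)
      fix x y
      show "ennreal (p x) * (ennreal (f y) * ennreal (\<psi> x y))
        \<le> ennreal (G_fun N (\<bar>ln (norm (x - y))\<bar> powr 2) * p x * f y) * indicator {y. e_iter N < norm (x - y)} y"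
      proof (cases "L < dist x y")
        case True
        have en: "e_iter N < norm (x - y)"
          using True e_iter_le_Suc[of N] by (simp add: L_def dist_norm e_iter_Suc)
        have "ennreal (p x) * (ennreal (f y) * ennreal (\<psi> x y)) = ennreal (\<psi> x y * (p x * f y))"
          using P.dens_nonneg[of x] Q.dens_nonneg[of y] psi_nonneg[of x y] by (simp add: ennreal_mult[symmetric] mult_ac)
        also have "\<dots> \<le> ennreal (G_fun N (\<bar>ln (norm (x - y))\<bar> powr 2) * (p x * f y))"
          using psi[OF True] en P.dens_nonneg[of x] Q.dens_nonneg[of y] by (intro ennreal_leI mult_right_mono) auto
        finally show ?thesis using en by (simp add: mult.assoc)
      qed (simp add: psi0)
    qed
    finally show ?thesis .
  qed
  have "(\<integral>\<^sup>+x. \<integral>\<^sup>+y. ennreal (\<phi> x y) \<partial>Q.law \<partial>P.law) \<le> (\<integral>\<^sup>+x. \<integral>\<^sup>+y. ennreal c + 2 * ennreal (\<psi> x y) \<partial>Q.law \<partial>P.law)"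
  proof (intro nn_integral_mono)
    fix x y
    have "\<phi> x y \<le> c + 2 * \<psi> x y" by (auto simp: \<psi>_def max_def field_simps)
    then have "ennreal (\<phi> x y) \<le> ennreal (c + 2 * \<psi> x y)" by (rule ennreal_leI)
    also have "\<dots> = ennreal c + 2 * ennreal (\<psi> x y)" using c0 by (simp add: ennreal_mult \<psi>_def)
    finally show "ennreal (\<phi> x y) \<le> ennreal c + 2 * ennreal (\<psi> x y)" .
  qed
  also have "\<dots> = ennreal c + 2 * (\<integral>\<^sup>+x. \<integral>\<^sup>+y. ennreal (\<psi> x y) \<partial>Q.law \<partial>P.law)"
  proof -
    have "(\<integral>\<^sup>+y. ennreal c + 2 * ennreal (\<psi> x y) \<partial>Q.law) = ennreal c + 2 * (\<integral>\<^sup>+y. ennreal (\<psi> x y) \<partial>Q.law)" for x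
      using Q.law.emeasure_space_1 by (simp add: nn_integral_add nn_integral_cmult)
    then show ?thesis
      using P.law.emeasure_space_1 by (simp add: nn_integral_add nn_integral_cmult)
  qed
  also have "\<dots> < \<infinity>" using order.strict_trans1[OF Kle K] by (simp add: ennreal_mult_less_top)
  finally show ?thesis unfolding \<phi>_def .
qed

lemma knn_moments_of_functionals:
  fixes p f :: "'a::euclidean_space \<Rightarrow> real"
  assumes p: "prob_density p" and f: "prob_density f"
    and e: "0 < e1" "0 < e2" and r: "0 < r1" "0 < r2" and N: "1 \<le> N" and l: "1 \<le> l"
    and K: "K_fun p f 2 N < \<infinity>" and Q: "Q_fun p f e1 r1 < \<infinity>" and T: "T_fun p f e2 r2 < \<infinity>"
  obtains \<epsilon> R CQ CT where "knn_moments p f \<epsilon> R CQ CT l"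
proof -
  interpret P: prob_density p by fact
  interpret Q: prob_density f by fact
  \<comment> \<open>Common parameters for both functionals: a smaller radius keeps the ball average
    between \<open>m_inf\<close> and \<open>M_sup\<close>, a smaller exponent costs the additive 1
    of \<open>powr_le_one_plus_powr\<close>, and the outer minimum enforces \<epsilon> \<le>
    1.\<close>
  define \<epsilon> where "\<epsilon> = min 1 (min e1 e2)"
  define R where "R = min r1 r2"
  have eps: "0 < \<epsilon>" "\<epsilon> \<le> 1" "\<epsilon> \<le> e1" "\<epsilon> \<le> e2" using e by (auto simp: \<epsilon>_def)
  have R: "0 < R" "R \<le> r1" "R \<le> r2" using r by (auto simp: R_def)
  have up: "(\<integral>\<^sup>+x. ennreal (Q.ball_avg x s powr \<epsilon>) \<partial>P.law) \<le> 1 + Q_fun p f e1 r1" if s: "0 < s" "s \<le> R" for s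
    unfolding Q_fun_def
  proof (rule P.nn_integral_law_le)
    fix x
    have le: "ennreal (Q.ball_avg x s) \<le> M_sup f x r1"
      unfolding M_sup_def using s R by (intro SUP_upper2[of s]) (auto simp: Q.I_avg_eq)
    show "ennreal (Q.ball_avg x s powr \<epsilon>) - 1 \<le> ennreal_powr (M_sup f x r1) e1"
    proof (cases "M_sup f x r1")
      case (real b)
      have "Q.ball_avg x s powr \<epsilon> \<le> 1 + b powr e1"
        using le real s eps by (intro powr_le_one_plus_powr) auto
      then show ?thesis using real by (simp add: ennreal_powr_def ennreal_minus ennreal_1[symmetric] ennreal_leI del: ennreal_1)
    qed (simp add: ennreal_powr_def)
  qed measurable
  have lo: "(\<integral>\<^sup>+x. inverse (ennreal (Q.ball_avg x s powr \<epsilon>)) \<partial>P.law) \<le> 1 + T_fun p f e2 r2" if s: "0 < s" "s \<le> R" for s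
    unfolding T_fun_def
  proof (rule P.nn_integral_law_le)
    fix x
    let ?a = "Q.ball_avg x s"
    have le: "m_inf f x r2 \<le> ennreal ?a"
      unfolding m_inf_def using s R by (intro INF_lower2[of s]) (auto simp: Q.I_avg_eq)
    have a0: "0 \<le> ?a" using s by simp
    then obtain b where b: "m_inf f x r2 = ennreal b" "0 \<le> b" "b \<le> ?a"
      using le by (cases "m_inf f x r2") (auto simp: top_unique)
    show "inverse (ennreal (?a powr \<epsilon>)) - 1 \<le> inverse (ennreal_powr (m_inf f x r2) e2)"
    proof (cases "b = 0")
      case True
      then show ?thesis using b by (simp add: ennreal_powr_def)
    next
      case False
      then have pos: "0 < b" "0 < ?a" using b by auto
      have "(1 / ?a) powr \<epsilon> \<le> 1 + (1 / b) powr e2"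
        using pos b eps by (intro powr_le_one_plus_powr) (auto simp: frac_le)
      then have "inverse (?a powr \<epsilon>) \<le> 1 + inverse (b powr e2)"
        using pos by (simp add: powr_divide inverse_eq_divide)
      then show ?thesis using b pos
        by (simp add: ennreal_powr_def inverse_ennreal ennreal_minus ennreal_1[symmetric] ennreal_leI del: ennreal_1)
    qed
  qed measurable
  obtain CQ where CQ: "1 + Q_fun p f e1 r1 = ennreal CQ" "0 \<le> CQ"
    using Q by (cases "1 + Q_fun p f e1 r1") (auto simp: ennreal_add_eq_top)
  obtain CT where CT: "1 + T_fun p f e2 r2 = ennreal CT" "0 \<le> CT"
    using T by (cases "1 + T_fun p f e2 r2") (auto simp: ennreal_add_eq_top)
  have "knn_moments p f \<epsilon> R CQ CT l"
    using eps R CQ CT l up lo log_moment_finite[OF p f K N R(1)]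
    by unfold_locales auto
  then show thesis by (rule that)
qed

section \<open>Consistency of the divergence estimator\<close>

text \<open>Positivity of q almost surely under p selects the branch of absolute continuity in
  \<open>kl_div\<close>, and integrability of both logarithms makes the positive and negative parts
  finite. Points with p = 0 contribute 0 to either form of the integrand.\<close>

lemma kl_div_eq:
  fixes p q :: "'a::euclidean_space \<Rightarrow> real"
  assumes "knn_moments p q \<epsilon> R CQ CT l" and "knn_moments p p \<epsilon>' R' CQ' CT' l'"
  shows "kl_div p q = ereal ((\<integral>x. ln (p x) \<partial>prob_density.law p) - (\<integral>x. ln (q x) \<partial>prob_density.law p))"
proof -
  interpret kq: knn_moments p q \<epsilon> R CQ CT l by fact
  interpret kp: knn_moments p p \<epsilon>' R' CQ' CT' l' by fact
  let ?g = "\<lambda>x. p x * ln (p x / q x)"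
  have pos: "AE x in lborel. 0 < p x \<longrightarrow> 0 < q x"
    using kq.AE_dens_pos unfolding kq.P.law_def by (subst (asm) AE_density) auto
  have ac: "absolutely_continuous (density lborel (\<lambda>x. ennreal (q x))) (density lborel (\<lambda>x. ennreal (p x)))"
    unfolding absolutely_continuous_def
  proof
    fix A assume "A \<in> null_sets (density lborel (\<lambda>x. ennreal (q x)))"
    then have A: "A \<in> sets lborel" "AE x in lborel. x \<in> A \<longrightarrow> ennreal (q x) = 0"
      by (auto simp: null_sets_density_iff)
    have "AE x in lborel. x \<in> A \<longrightarrow> ennreal (p x) = 0"
      using A(2) pos
    proof eventually_elim
      case (elim x)
      show ?case
      proof
        assume "x \<in> A"
        then have "q x \<le> 0" using elim(1) by (simp add: ennreal_eq_0_iff)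
        then have "p x \<le> 0" using elim(2) by auto
        then show "ennreal (p x) = 0" by (simp add: ennreal_eq_0_iff)
      qed
    qed
    then show "A \<in> null_sets (density lborel (\<lambda>x. ennreal (p x)))"
      using A(1) by (auto simp: null_sets_density_iff)
  qed
  have int: "integrable kq.P.law (\<lambda>x. ln (p x) - ln (q x))"
    using kp.integrable_ln_dens kq.integrable_ln_dens by auto
  then have int': "integrable lborel (\<lambda>x. p x * (ln (p x) - ln (q x)))"
    unfolding kq.P.law_def using kq.P.dens_nonneg by (subst (asm) integrable_density) auto
  have eq: "AE x in lborel. p x * (ln (p x) - ln (q x)) = ?g x"
    using pos
  proof eventually_elim
    case (elim x)
    show ?case
    proof (cases "p x = 0")
      case False
      then have "0 < p x" "0 < q x" using elim kq.P.dens_nonneg[of x] by auto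
      then show ?thesis by (simp add: ln_div)
    qed simp
  qed
  have intg: "integrable lborel ?g"
    using int' by (rule Bochner_Integration.integrable_cong_AE_imp) (use eq in \<open>auto elim!: eventually_mono\<close>)
  have val: "(\<integral>x. ?g x \<partial>lborel) = (\<integral>x. ln (p x) \<partial>kq.P.law) - (\<integral>x. ln (q x) \<partial>kq.P.law)"
  proof -
    have "(\<integral>x. ?g x \<partial>lborel) = (\<integral>x. p x * (ln (p x) - ln (q x)) \<partial>lborel)"
      using eq by (intro integral_cong_AE) (auto elim!: eventually_mono)
    also have "\<dots> = (\<integral>x. (ln (p x) - ln (q x)) \<partial>kq.P.law)"
      unfolding kq.P.law_def using kq.P.dens_nonneg by (subst integral_density) auto
    also have "\<dots> = (\<integral>x. ln (p x) \<partial>kq.P.law) - (\<integral>x. ln (q x) \<partial>kq.P.law)"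
      by (rule Bochner_Integration.integral_diff[OF kp.integrable_ln_dens kq.integrable_ln_dens])
    finally show ?thesis .
  qed
  obtain a b where ab: "(\<integral>\<^sup>+x. ennreal (?g x) \<partial>lborel) = ennreal a" "(\<integral>\<^sup>+x. ennreal (- ?g x) \<partial>lborel) = ennreal b"
     "0 \<le> a" "0 \<le> b" "(\<integral>x. ?g x \<partial>lborel) = a - b"
    by (rule integrableE[OF intg])
  show ?thesis
    unfolding kl_div_def using ac ab val by (simp add: enn2ereal_ennreal)
qed

lemma prob_density_of_distributed:
  fixes X :: "'w \<Rightarrow> 'a::euclidean_space"
  assumes M: "prob_space M" and X: "distributed M lborel X (\<lambda>x. ennreal (p x))" and p: "\<And>x. 0 \<le> p x"
  shows "prob_density p" and "distr M borel X = prob_density.law p"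
proof -
  interpret prob_space M by fact
  have Xm: "X \<in> measurable M lborel" using X by (rule distributed_measurable)
  have pm: "(\<lambda>x. ennreal (p x)) \<in> borel_measurable lborel" using X by (rule distributed_borel_measurable)
  \<comment> \<open>\<open>distributed\<close> provides measurability of the extended-valued
    density; nonnegativity recovers p from it.\<close>
  have "(\<lambda>x. enn2real (ennreal (p x))) \<in> borel_measurable lborel" using pm by measurable
  then have pm': "p \<in> borel_measurable borel" using p by simp
  have d: "distr M lborel X = density lborel (\<lambda>x. ennreal (p x))" by (rule distributed_distr_eq_density[OF X])
  interpret D: prob_space "distr M lborel X" by (rule prob_space_distr[OF Xm])
  show pd: "prob_density p"
  proof
    show "(\<integral>\<^sup>+x. ennreal (p x) \<partial>lborel) = 1"
      using D.emeasure_space_1 pm unfolding d by (simp add: emeasure_density)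
  qed (use pm' p in auto)
  have "distr M borel X = distr M lborel X" by (rule distr_cong) auto
  then show "distr M borel X = prob_density.law p" by (simp add: d prob_density.law_def[OF pd])
qed

lemma knn_dist_le_iff_image:
  fixes c :: "'b \<Rightarrow> 'a::euclidean_space"
  assumes "inj_on h J" "\<And>j. j \<in> J \<Longrightarrow> c (h j) = z j" "finite J" "1 \<le> k" "k \<le> card J"
  shows "norm (v - z (knn_index z v J k)) \<le> r \<longleftrightarrow> k \<le> card {j \<in> h ` J. dist v (c j) \<le> r}"
proof -
  have "{j \<in> h ` J. dist v (c j) \<le> r} = h ` {j \<in> J. norm (v - z j) \<le> r}"
    using assms(2) by (auto simp: dist_norm)
  moreover have "inj_on h {j \<in> J. norm (v - z j) \<le> r}" using assms(1) by (rule inj_on_subset) auto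
  ultimately show ?thesis
    using knn_dist_le_iff[OF assms(3-5), of v z r] by (simp add: card_image)
qed

theorem theorem2:
  fixes M :: "'w measure"
    and X Y :: "'w \<Rightarrow> 'a::euclidean_space"
    and p q :: "'a \<Rightarrow> real"
    and Xs Ys :: "nat \<Rightarrow> 'w \<Rightarrow> 'a"
    and \<epsilon>\<^sub>1 \<epsilon>\<^sub>2 \<epsilon>\<^sub>3 \<epsilon>\<^sub>4 R\<^sub>1 R\<^sub>2 R\<^sub>3 R\<^sub>4 :: real
    and N\<^sub>1 N\<^sub>2 k l :: nat
  assumes "prob_space M"
    and "\<And>x. 0 \<le> p x" and "\<And>x. 0 \<le> q x"
    and "distributed M lborel X (\<lambda>x. ennreal (p x))"
    and "distributed M lborel Y (\<lambda>x. ennreal (q x))"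
    and "prob_space.indep_vars M (\<lambda>_. borel) (case_sum Xs Ys) (UNIV :: (nat + nat) set)"
    and "\<And>i. distr M borel (Xs i) = distr M borel X"
    and "\<And>i. distr M borel (Ys i) = distr M borel Y"
    and "0 < \<epsilon>\<^sub>1" and "0 < \<epsilon>\<^sub>2" and "0 < \<epsilon>\<^sub>3" and "0 < \<epsilon>\<^sub>4"
    and "0 < R\<^sub>1" and "0 < R\<^sub>2" and "0 < R\<^sub>3" and "0 < R\<^sub>4"
    and "1 \<le> N\<^sub>1" and "1 \<le> N\<^sub>2"
    and "K_fun p q 2 N\<^sub>1 < \<infinity>" and "Q_fun p q \<epsilon>\<^sub>1 R\<^sub>1 < \<infinity>" and "T_fun p q \<epsilon>\<^sub>2 R\<^sub>2 < \<infinity>"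
    and "K_fun p p 2 N\<^sub>2 < \<infinity>" and "Q_fun p p \<epsilon>\<^sub>3 R\<^sub>3 < \<infinity>" and "T_fun p p \<epsilon>\<^sub>4 R\<^sub>4 < \<infinity>"
    and "1 \<le> k" and "1 \<le> l"
  shows "((\<lambda>(n, m). \<integral>\<^sup>+\<omega>. e2ennreal
            ((ereal (D_hat (\<lambda>i. Xs i \<omega>) (\<lambda>i. Ys i \<omega>) n m k l) - kl_div p q)\<^sup>2) \<partial>M)
          \<longlongrightarrow> 0) (sequentially \<times>\<^sub>F sequentially)"
proof -
  have pd: "prob_density p" and lawX: "distr M borel X = prob_density.law p"
    using prob_density_of_distributed[OF assms(1,4,2)] by auto
  have qd: "prob_density q" and lawY: "distr M borel Y = prob_density.law q"
    using prob_density_of_distributed[OF assms(1,5,3)] by auto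
  obtain e\<^sub>q r\<^sub>q A\<^sub>q B\<^sub>q where kq: "knn_moments p q e\<^sub>q r\<^sub>q A\<^sub>q B\<^sub>q l"
    by (rule knn_moments_of_functionals[OF pd qd assms(9,10,13,14,17,26,19,20,21)])
  obtain e\<^sub>p r\<^sub>p A\<^sub>p B\<^sub>p where kp: "knn_moments p p e\<^sub>p r\<^sub>p A\<^sub>p B\<^sub>p k"
    by (rule knn_moments_of_functionals[OF pd pd assms(11,12,15,16,18,25,22,23,24)])
  interpret kq: knn_moments p q e\<^sub>q r\<^sub>q A\<^sub>q B\<^sub>q l by (rule kq)
  interpret kp: knn_moments p p e\<^sub>p r\<^sub>p A\<^sub>p B\<^sub>p k by (rule kp)
  interpret M: prob_space M by fact
  define W where "W = case_sum Xs Ys"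
  define D where "D = (\<integral>x. ln (p x) \<partial>kq.P.law) - (\<integral>x. ln (q x) \<partial>kq.P.law)"
  have D: "kl_div p q = ereal D" unfolding D_def by (rule kl_div_eq[OF kq kp])
  define VX where "VX n i w = R_dist (\<lambda>i. Xs i w) n k i" for n i w
  define VY where "VY m i w = V_dist (\<lambda>i. Xs i w) (\<lambda>i. Ys i w) m l i" for m i w
  let ?v = "unit_ball_vol (real DIM('a))"
  let ?F = "\<lambda>n m. \<integral>\<^sup>+\<omega>. e2ennreal ((ereal (D_hat (\<lambda>i. Xs i \<omega>) (\<lambda>i. Ys i \<omega>) n m k l) - kl_div p q)\<^sup>2) \<partial>M"
  have sampleY: "knn_sample p q e\<^sub>q r\<^sub>q A\<^sub>q B\<^sub>q l M W Inl (\<lambda>_. Inr ` {..<m}) n m (VY m)"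
    if nm: "0 < n" "l < m" "kq.rad m 0 < r\<^sub>q" for n m
  proof (unfold_locales)
    show "M.indep_vars (\<lambda>_. borel) W UNIV" unfolding W_def by fact
    show "distr M borel (W (Inl i)) = kq.P.law" for i by (simp add: W_def assms(7) lawX)
    show "distr M borel (W j) = kq.Q.law" if "j \<in> Inr ` {..<m}" for i j
      using that by (auto simp: W_def assms(8) lawY)
    show "(Inl i :: nat + nat) \<noteq> Inl i' \<and> (\<exists>K\<subseteq>Inr ` {..<m}. K \<subseteq> Inr ` {..<m} \<and> card K = m - 1 \<and> Inl i \<notin> K \<and> Inl i' \<notin> K)"
      if "i \<noteq> i'" for i i' :: nat
      \<comment> \<open>All centres share the whole Y-sample; one point is discarded to match the
        size m - 1 dictated by leave-one-out samples.\<close>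
      using that nm by (intro conjI exI[of _ "Inr ` {..<m-1}"]) (auto simp: card_image)
    show "VY m i w \<le> r \<longleftrightarrow> l \<le> card {j \<in> Inr ` {..<m}. dist (W (Inl i) w) (W j w) \<le> r}" for i w r
      unfolding VY_def V_dist_def W_def using nm assms(26)
      by (subst knn_dist_le_iff_image[of Inr _ "\<lambda>j. case_sum Xs Ys j w"]) auto
  qed (use nm in \<open>auto simp: card_image\<close>)
  have sampleX: "knn_sample p p e\<^sub>p r\<^sub>p A\<^sub>p B\<^sub>p k M W Inl (\<lambda>i. Inl ` ({..<n} - {i})) n (n - 1) (VX n)"
    if n: "k < n - 1" "kp.rad (n - 1) 0 < r\<^sub>p" for n
  proof (unfold_locales)
    show "M.indep_vars (\<lambda>_. borel) W UNIV" unfolding W_def by fact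
    show "distr M borel (W (Inl i)) = kq.P.law" for i by (simp add: W_def assms(7) lawX)
    show "distr M borel (W j) = kq.P.law" if "j \<in> Inl ` ({..<n} - {i})" for i j
      using that by (auto simp: W_def assms(7) lawX)
    show "(Inl i :: nat + nat) \<noteq> Inl i' \<and> (\<exists>K\<subseteq>Inl ` ({..<n} - {i}). K \<subseteq> Inl ` ({..<n} - {i'}) \<and> card K = n - 1 - 1 \<and> Inl i \<notin> K \<and> Inl i' \<notin> K)"
      if "i < n" "i' < n" "i \<noteq> i'" for i i' :: nat
    proof -
      \<comment> \<open>Each leave-one-out sample already omits its own centre, so avoiding the
        other centre costs one further point.\<close>
      have "card ({..<n} - {i, i'}) = n - 1 - 1" using that by (simp add: card_Diff_subset)
      then show ?thesis using that
        by (intro conjI exI[of _ "Inl ` ({..<n} - {i, i'})"]) (auto simp: card_image)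
    qed
    show "VX n i w \<le> r \<longleftrightarrow> k \<le> card {j \<in> Inl ` ({..<n} - {i}). dist (W (Inl i) w) (W j w) \<le> r}" if "i < n" for i w r
      unfolding VX_def R_dist_def W_def using n assms(25) that
      by (subst knn_dist_le_iff_image[of Inl _ "\<lambda>j. case_sum Xs Ys j w"]) auto
  qed (use n in \<open>auto simp: card_image\<close>)
  have bound: "?F n m \<le> 2 * (kq.err_n n + kq.err_m m) + 2 * (kp.err_n n + kp.err_m (n - 1))"
    if n: "k < n - 1" "kp.rad (n - 1) 0 < r\<^sub>p" and m: "l < m" "kq.rad m 0 < r\<^sub>q" for n m
  proof -
    have n0: "0 < n" using n by auto
    note sX = sampleX[OF n] and sY = sampleY[OF n0 m]
    define BY where "BY w = (\<Sum>i<n. ln (real m * (?v * VY m i w ^ DIM('a)))) / real n - kq.lim_const" for w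
    define BX where "BX w = (\<Sum>i<n. ln (real (n - 1) * (?v * VX n i w ^ DIM('a)))) / real n - kp.lim_const" for w
    have [measurable]: "i \<in> {..<n} \<Longrightarrow> VX n i \<in> borel_measurable M" "i \<in> {..<n} \<Longrightarrow> VY m i \<in> borel_measurable M" for i
      using knn_sample.V_measurable[OF sX] knn_sample.V_measurable[OF sY] by auto
    have [measurable]: "BX \<in> borel_measurable M" "BY \<in> borel_measurable M"
      unfolding BX_def BY_def by measurable
    have "?F n m \<le> (\<integral>\<^sup>+w. 2 * ennreal ((BY w)\<^sup>2) + 2 * ennreal ((BX w)\<^sup>2) \<partial>M)"
    proof (rule nn_integral_mono_AE)
      show "AE w in M. e2ennreal ((ereal (D_hat (\<lambda>i. Xs i w) (\<lambda>i. Ys i w) n m k l) - kl_div p q)\<^sup>2)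
         \<le> 2 * ennreal ((BY w)\<^sup>2) + 2 * ennreal ((BX w)\<^sup>2)"
        using knn_sample.AE_V_pos[OF sX] knn_sample.AE_V_pos[OF sY]
      proof eventually_elim
        case (elim w)
        let ?D = "D_hat (\<lambda>i. Xs i w) (\<lambda>i. Ys i w) n m k l"
        have "ln (real m * VY m i w ^ DIM('a) / ((real n - 1) * VX n i w ^ DIM('a)))
          = ln (real m * (?v * VY m i w ^ DIM('a))) - ln (real (n - 1) * (?v * VX n i w ^ DIM('a)))" if "i < n" for i
        proof -
          have "real n - 1 = real (n - 1)" using n0 by (simp add: of_nat_diff)
          moreover have "0 < VX n i w" "0 < VY m i w" using elim that by auto
          then have ab: "0 < real m * VY m i w ^ DIM('a)" (is "0 < ?a") "0 < real (n - 1) * VX n i w ^ DIM('a)" (is "0 < ?b")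
            using n m by auto
          \<comment> \<open>The unit ball volume cancels in the quotient; inserting it turns each
            term into the logarithm of sample size times ball volume.\<close>
          have "ln (?a / ?b) = ln (?v * ?a) - ln (?v * ?b)"
            using ab by (simp only: ln_div ln_mult_pos kq.P.unit_ball_vol_DIM_pos less_imp_neq[OF ab(1), symmetric] less_imp_neq[OF ab(2), symmetric]) simp
          ultimately show ?thesis by (simp only: mult.left_commute)
        qed
        then have "?D = Digamma (real k) - Digamma (real l)
           + 1 / real n * (\<Sum>i<n. ln (real m * (?v * VY m i w ^ DIM('a))) - ln (real (n - 1) * (?v * VX n i w ^ DIM('a))))"
          unfolding D_hat_def VX_def[symmetric] VY_def[symmetric] by simp
        \<comment> \<open>The digamma values in the two limit constants cancel those of
          \<open>D_hat\<close>, and their mean logarithms combine to D.\<close>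
        then have "?D - D = BY w - BX w"
          unfolding BX_def BY_def kq.lim_const_def kp.lim_const_def D_def
          by (simp add: sum_subtractf diff_divide_distrib)
        then have "(?D - D)\<^sup>2 = (BY w - BX w)\<^sup>2" by simp
        also have "\<dots> \<le> 2 * (BY w)\<^sup>2 + 2 * (BX w)\<^sup>2"
          using zero_le_power2[of "BY w + BX w"] by (simp add: power2_sum power2_diff)
        finally have "ennreal ((?D - D)\<^sup>2) \<le> ennreal (2 * (BY w)\<^sup>2 + 2 * (BX w)\<^sup>2)" by (rule ennreal_leI)
        also have "\<dots> = 2 * ennreal ((BY w)\<^sup>2) + 2 * ennreal ((BX w)\<^sup>2)" by (simp add: ennreal_mult)
        also have "ennreal ((?D - D)\<^sup>2) = e2ennreal ((ereal ?D - kl_div p q)\<^sup>2)"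
          unfolding D ereal_minus(1) ereal_power e2ennreal_ereal ..
        finally show ?case .
      qed
    qed
    also have "\<dots> = 2 * (\<integral>\<^sup>+w. ennreal ((BY w)\<^sup>2) \<partial>M) + 2 * (\<integral>\<^sup>+w. ennreal ((BX w)\<^sup>2) \<partial>M)"
      by (subst nn_integral_add) (auto simp: nn_integral_cmult)
    also have "\<dots> \<le> 2 * (kq.err_n n + kq.err_m m) + 2 * (kp.err_n n + kp.err_m (n - 1))"
      using knn_sample.mean_square_bound[OF sX] knn_sample.mean_square_bound[OF sY]
      unfolding BX_def BY_def by (intro add_mono mult_left_mono) auto
    finally show ?thesis .
  qed
  let ?G = "\<lambda>z. 2 * (kq.err_n (fst z) + kq.err_m (snd z)) + 2 * (kp.err_n (fst z) + kp.err_m (fst z - 1))"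
  \<comment> \<open>Each summand depends on one coordinate alone, so its limit is composed with a
    projection of the product filter.\<close>
  have "(?G \<longlongrightarrow> 2 * (0 + 0) + 2 * (0 + 0)) (sequentially \<times>\<^sub>F sequentially)"
    by (intro tendsto_add ennreal_tendsto_cmult
        filterlim_compose[OF kq.err_n_limit] filterlim_compose[OF kq.err_m_limit]
        filterlim_compose[OF kp.err_n_limit] filterlim_compose[OF kp.err_m_limit]
        filterlim_compose[OF filterlim_minus_const_nat_at_top] filterlim_fst filterlim_snd) auto
  then have lim: "(?G \<longlongrightarrow> 0) (sequentially \<times>\<^sub>F sequentially)" by simp
  have evn: "\<forall>\<^sub>F n in sequentially. k < n - 1 \<and> kp.rad (n - 1) 0 < r\<^sub>p"
    using eventually_gt_at_top[of "k + 1"]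
      filterlim_compose[OF _ filterlim_minus_const_nat_at_top, of "\<lambda>m. kp.rad m 0" "nhds 0" 1, THEN order_tendstoD(2), OF kp.rad_tendsto_0 kp.R_pos]
    by eventually_elim auto
  have evm: "\<forall>\<^sub>F m in sequentially. l < m \<and> kq.rad m 0 < r\<^sub>q"
    using eventually_gt_at_top[of l] kq.eventually_rad_less[OF kq.R_pos] by eventually_elim auto
  have "\<forall>\<^sub>F z in sequentially \<times>\<^sub>F sequentially. ?F (fst z) (snd z) \<le> ?G z"
    using eventually_conj[OF eventually_compose_filterlim[OF evn filterlim_fst] eventually_compose_filterlim[OF evm filterlim_snd]]
    by (rule eventually_mono) (rule bound, auto)
  then have "((\<lambda>z. ?F (fst z) (snd z)) \<longlongrightarrow> 0) (sequentially \<times>\<^sub>F sequentially)"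
    by (intro tendsto_sandwich[OF _ _ tendsto_const lim]) auto
  then show ?thesis by (simp add: split_beta')
qed

end
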